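(* There is an absolute constant $c>0$ such that the following holds. Let $\ell\le R$ be integers and, for each $j\in[\ell]$, let $U^{(j)}\in\mathbb{R}^{n_j\times R}$ be $\rho_j$-bounded with $\mathrm{K\text{-}rank}_{\tau_j}(U^{(j)})=k_j\ge 2$, where $\sum_{j=1}^{\ell}k_j\ge 2R+\ell-1$. Let $T=[U^{(1)}\;U^{(2)}\;\cdots\;U^{(\ell)}]$ and let $\rho'_1,\dots,\rho'_\ell$ be further parameters. For every $0<\varepsilon'<1$, set \[\varepsilon=\Big(\frac{\varepsilon'}{R}\Big)^{2^{\ell}}\cdot\prod_{j=1}^{\ell}(\tau_j\rho_j\rho'_j n_j)^{-c}.\] Then for any matrices $V^{(j)}\in\mathbb{R}^{n_j\times R}$ ($j\in[\ell]$) with $V^{(j)}$ being $\rho'_j$-bounded and $\|[V^{(1)}\;\cdots\;V^{(\ell)}]-T\|_F\le\varepsilon$, there exist an $R\times R$ permutation matrix $\Pi$ and diagonal $R\times R$ matrices $\Lambda^{(1)},\dots,\Lambda^{(\ell)}$ such that \[\Big\|\prod_{j\in[\ell]}\Lambda^{(j)}-I\Big\|_F\le\varepsilon'\quad\text{and}\quad \|V^{(j)}-U^{(j)}\Pi\Lambda^{(j)}\|_F\le\varepsilon'\ \text{ for all } j\in[\ell].\]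
   Context: For $U^{(i)}\in\mathbb{R}^{n_i\times R}$, $[U^{(1)}\;\cdots\;U^{(\ell)}]:=\sum_{r=1}^R U^{(1)}_r\otimes\cdots\otimes U^{(\ell)}_r$, where $X_r$ is the $r$-th column of $X$; $\|\cdot\|_F$ is the Frobenius norm. A matrix is $\rho$-bounded if each column has Euclidean length at most $\rho$. $\mathrm{K\text{-}rank}_\tau(X)$ is the largest $k$ such that every submatrix of $X$ formed by $k$ of its columns has $k$-th largest singular value at least $1/\tau$. Standing normalization: all $\tau_j,\rho_j,\rho'_j$ are at least $1$. *)

theory Defs
  imports
    Complex_Main
    "HOL-Library.FuncSet"
    "HOL-Library.Multiset"
    "HOL-Combinatorics.Permutations"
    "Jordan_Normal_Form.Char_Poly"
    "Jordan_Normal_Form.DL_Submatrix"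
begin

subsection \<open>Norms and bounded matrices\<close>

definition euclidean_norm :: "real vec \<Rightarrow> real" where
  "euclidean_norm v = sqrt (\<Sum>i<dim_vec v. (v $ i)\<^sup>2)"

definition frobenius_norm :: "real mat \<Rightarrow> real" where
  "frobenius_norm A = sqrt (\<Sum>i<dim_row A. \<Sum>j<dim_col A. (A $$ (i, j))\<^sup>2)"

definition column_bounded :: "real \<Rightarrow> real mat \<Rightarrow> bool" where
  "column_bounded \<rho> A \<longleftrightarrow> (\<forall>r<dim_col A. euclidean_norm (col A r) \<le> \<rho>)"


subsection \<open>Singular values and the robust Kruskal rank\<close>

text \<open>
  The singular values are the square roots of the eigenvalues of \<open>A\<^sup>T A\<close>, listed in decreasing
  order and repeated according to multiplicity.  A matrix thus has as many singular values
  as columns; when it has fewer rows than columns, the surplus ones are \<open>0\<close>.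
\<close>

definition singular_values :: "real mat \<Rightarrow> real list" where
  "singular_values A =
     rev (sorted_list_of_multiset (image_mset sqrt (proots (char_poly (transpose_mat A * A)))))"

definition kth_singular_value :: "nat \<Rightarrow> real mat \<Rightarrow> real" where
  "kth_singular_value k A = singular_values A ! (k - 1)"

text \<open>
  The bound \<open>k \<le> dim_col A\<close> excludes the values of \<open>k\<close> for which there are no submatrices to test.
  The value \<open>k = 0\<close> is always admissible, so the maximum is over a nonempty finite set.
\<close>

definition K_rank :: "real \<Rightarrow> real mat \<Rightarrow> nat" where
  "K_rank \<tau> A = Max {k. k \<le> dim_col A \<and>
     (k = 0 \<or> (\<forall>J \<subseteq> {..<dim_col A}. card J = k \<longrightarrow>
        kth_singular_value k (submatrix A UNIV J) \<ge> 1 / \<tau>))}"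


subsection \<open>Tensors\<close>

text \<open>
  A tensor of order \<open>l\<close> and dimensions \<open>n 0, \<dots>, n (l - 1)\<close> is given by its entries, as a function
  of multi-indices \<open>i \<in> (\<Pi>\<^sub>E j\<in>{..<l}. {..<n j})\<close>; its values elsewhere are irrelevant.
\<close>

type_synonym tensor = "(nat \<Rightarrow> nat) \<Rightarrow> real"

definition outer_product :: "nat \<Rightarrow> (nat \<Rightarrow> real vec) \<Rightarrow> tensor" where
  "outer_product l u = (\<lambda>i. \<Prod>j<l. u j $ i j)"

definition cp_tensor :: "nat \<Rightarrow> nat \<Rightarrow> (nat \<Rightarrow> real mat) \<Rightarrow> tensor" where
  "cp_tensor l R U = (\<lambda>i. \<Sum>r<R. outer_product l (\<lambda>j. col (U j) r) i)"

definition tensor_diff :: "tensor \<Rightarrow> tensor \<Rightarrow> tensor" where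
  "tensor_diff S T = (\<lambda>i. S i - T i)"

definition tensor_frobenius_norm :: "nat \<Rightarrow> (nat \<Rightarrow> nat) \<Rightarrow> tensor \<Rightarrow> real" where
  "tensor_frobenius_norm l n T = sqrt (\<Sum>i \<in> (\<Pi>\<^sub>E j\<in>{..<l}. {..<n j}). (T i)\<^sup>2)"


subsection \<open>Permutation matrices and matrix products\<close>

definition permutation_matrix :: "nat \<Rightarrow> real mat \<Rightarrow> bool" where
  "permutation_matrix R P \<longleftrightarrow>
     (\<exists>\<pi>. \<pi> permutes {..<R} \<and> P = mat R R (\<lambda>(i, j). if i = \<pi> j then 1 else 0))"

definition mat_product :: "nat \<Rightarrow> nat \<Rightarrow> (nat \<Rightarrow> real mat) \<Rightarrow> real mat" where
  "mat_product R l L = foldr (*) (map L [0..<l]) (1\<^sub>m R)"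

end

theory Submission
  imports Defs
    "HOL-Analysis.Inner_Product"
    "HOL-Analysis.L2_Norm"
    "HOL-Library.Nat_Bijection"
begin

text \<open>
  Group the modes into three consecutive blocks, the middle one a single mode, such that the merged
  (Khatri--Rao) factors satisfy Kruskal's condition for three modes; robust Kruskal rank is used
  throughout in its dual form, and dual vectors of a merged block are tensor products.  For three
  modes, contracting the third against \<open>w\<close> and comparing ranks shows that a \<open>w\<close> orthogonal to
  \<open>kC - 1\<close> columns \<open>c'\<close> is almost orthogonal to at least \<open>kC - 1\<close> columns \<open>c\<close>.  Hence exactly
  \<open>kC - 1\<close> columns \<open>c\<close> are close to each span of \<open>kC - 1\<close> columns \<open>c'\<close>, with a gap between the close
  and the far ones.  The gap resets the error, so that the descent from hyperplanes to lines is
  purely combinatorial and all losses stay polynomial with an absolute exponent.  Contracting with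
  dual vectors whose zero sets cover all terms forces the matchings of the three blocks to agree,
  and the same contraction reads off the scalars and their product.  The resulting estimate is linear
  in \<open>\<epsilon>\<close>, with the power 30 of \<open>\<Prod>j. \<tau> j * \<rho> j * \<rho>' j * n j\<close>, which dominates \<open>R\<close>.
\<close>

section \<open>Dual vectors and residuals\<close>

text \<open>The hypotheses are lopsided: the Kruskal ranks concern the \<open>U j\<close> only,
  while the \<open>V j\<close> are merely bounded. Whatever independence is needed on the side of
  \<open>V\<close> has to be derived from the closeness of the tensors (\<open>separated\<close>),
  and comparisons are made by contracting with vectors dual to columns of \<open>U\<close>. The
  obstacle is that a bound passed from one span to the next smaller one would deteriorate at each
  passage. For a span of \<open>kC - 1\<close> columns, however, the set of near columns is the same
  for all tolerances from \<open>\<epsilon> * D ^ 4\<close> up to, but excluding,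
  \<open>1 / D ^ 2\<close>. A weak bound is therefore upgraded before each use, and the tolerance
  \<open>\<epsilon> * D ^ 18\<close> serves for spans of every size. One number
  \<open>D \<ge> 2\<close> bounds \<open>R\<close>, the norms and the dual vectors, so that all
  losses, including factors 2 and 3, become powers of \<open>D\<close>. The dimensions belong to it
  because they control \<open>R\<close>: ranks are at most dimensions, and a sum of numbers that are
  at least 2 is at most their product. The largest power that has to be absorbed is
  \<open>D ^ 28\<close>, when the three matchings are compared; 30 leaves a margin.\<close>

lemma underdetermined_system:
  fixes m :: "'i \<Rightarrow> 't \<Rightarrow> real"
  assumes "finite T" "finite W" "card T < card W"
  shows "\<exists>\<alpha>. (\<exists>r\<in>W. \<alpha> r \<noteq> 0) \<and> (\<forall>t\<in>T. (\<Sum>r\<in>W. \<alpha> r * m r t) = 0)"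
  using assms
proof (induction T arbitrary: W m rule: finite_induct)
  case empty
  then have "W \<noteq> {}" by auto
  then show ?case by (intro exI[of _ "\<lambda>_. 1"]) auto
next
  case (insert t T)
  show ?case
  proof (cases "\<forall>r\<in>W. m r t = 0")
    case True
    have "card T < card W" using insert by simp
    from insert.IH[OF insert.prems(1) this, of m] obtain \<alpha> where
      "\<exists>r\<in>W. \<alpha> r \<noteq> 0" "\<forall>t\<in>T. (\<Sum>r\<in>W. \<alpha> r * m r t) = 0" by blast
    then show ?thesis using True by (intro exI[of _ \<alpha>]) auto
  next
    case False
    then obtain q where q: "q \<in> W" "m q t \<noteq> 0" by blast
    define W' where "W' = W - {q}"
    have W': "finite W'" "q \<notin> W'" "W = insert q W'" using insert.prems(1) q by (auto simp: W'_def)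
    have "card T < card W'" using insert.prems insert.hyps W' by auto
    \<comment> \<open>Gaussian elimination: equation \<open>t\<close> is solved for the unknown
      \<open>q\<close> and substituted into the others; \<open>\<beta>\<close> below is the back
      substitution.\<close>
    from insert.IH[OF W'(1) this, of "\<lambda>r s. m r s - m r t / m q t * m q s"] obtain \<alpha> where
      \<alpha>: "\<exists>r\<in>W'. \<alpha> r \<noteq> 0" "\<forall>s\<in>T. (\<Sum>r\<in>W'. \<alpha> r * (m r s - m r t / m q t * m q s)) = 0" by blast
    define \<beta> where "\<beta> = \<alpha>(q := - (\<Sum>r\<in>W'. \<alpha> r * m r t) / m q t)"
    have sum\<beta>: "(\<Sum>r\<in>W. \<beta> r * m r s) = \<beta> q * m q s + (\<Sum>r\<in>W'. \<alpha> r * m r s)" for s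
    proof -
      have "(\<Sum>r\<in>W'. \<beta> r * m r s) = (\<Sum>r\<in>W'. \<alpha> r * m r s)"
        using W' by (intro sum.cong) (auto simp: \<beta>_def)
      then show ?thesis using W' by simp
    qed
    have "(\<Sum>r\<in>W. \<beta> r * m r s) = 0" if "s \<in> insert t T" for s
    proof (cases "s = t")
      case True
      then show ?thesis unfolding sum\<beta> using q by (simp add: \<beta>_def)
    next
      case False
      then have "s \<in> T" using that by simp
      then have "0 = (\<Sum>r\<in>W'. \<alpha> r * (m r s - m r t / m q t * m q s))" using \<alpha> by simp
      also have "\<dots> = (\<Sum>r\<in>W'. \<alpha> r * m r s) - (\<Sum>r\<in>W'. \<alpha> r * m r t * (m q s / m q t))"
        by (simp add: algebra_simps sum_subtractf)
      also have "(\<Sum>r\<in>W'. \<alpha> r * m r t * (m q s / m q t)) = - \<beta> q * m q s"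
        by (simp add: \<beta>_def sum_distrib_right sum_divide_distrib)
      finally show ?thesis unfolding sum\<beta> by simp
    qed
    moreover have "\<exists>r\<in>W. \<beta> r \<noteq> 0" using \<alpha>(1) W' by (auto simp: \<beta>_def)
    ultimately show ?thesis by blast
  qed
qed

text \<open>Dividing by a coefficient of largest modulus makes that one equal to 1 and keeps the
  others bounded, so a combination with these coefficients is at most as long as its terms
  together.\<close>

lemma underdetermined_system_normalized:
  fixes m :: "'i \<Rightarrow> 't \<Rightarrow> real"
  assumes "finite T" "finite W" "card T < card W"
  obtains \<alpha> q where "q \<in> W" "\<alpha> q = 1" "\<And>r. r \<in> W \<Longrightarrow> \<bar>\<alpha> r\<bar> \<le> 1"
    "\<And>t. t \<in> T \<Longrightarrow> (\<Sum>r\<in>W. \<alpha> r * m r t) = 0"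
proof -
  obtain \<alpha> where \<alpha>: "\<exists>r\<in>W. \<alpha> r \<noteq> 0" "\<forall>t\<in>T. (\<Sum>r\<in>W. \<alpha> r * m r t) = 0"
    using underdetermined_system[OF assms, of m] by blast
  have ne: "(\<lambda>r. \<bar>\<alpha> r\<bar>) ` W \<noteq> {}" using \<alpha> by auto
  have fin: "finite ((\<lambda>r. \<bar>\<alpha> r\<bar>) ` W)" using assms by simp
  obtain q where q: "q \<in> W" "\<bar>\<alpha> q\<bar> = Max ((\<lambda>r. \<bar>\<alpha> r\<bar>) ` W)"
    using Max_in[OF fin ne] by auto
  then have le: "\<bar>\<alpha> r\<bar> \<le> \<bar>\<alpha> q\<bar>" if "r \<in> W" for r using that Max_ge[OF fin] by auto
  have nz: "\<alpha> q \<noteq> 0" using \<alpha>(1) le by fastforce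
  show ?thesis
  proof (rule that[of q "\<lambda>r. \<alpha> r / \<alpha> q"])
    show "\<bar>\<alpha> r / \<alpha> q\<bar> \<le> 1" if "r \<in> W" for r using le[OF that] nz by (simp add: divide_le_eq)
    show "(\<Sum>r\<in>W. \<alpha> r / \<alpha> q * m r t) = 0" if "t \<in> T" for t
    proof -
      have "(\<Sum>r\<in>W. \<alpha> r / \<alpha> q * m r t) = (\<Sum>r\<in>W. \<alpha> r * m r t) / \<alpha> q"
        by (simp add: sum_divide_distrib)
      then show ?thesis using \<alpha> that by simp
    qed
  qed (use q nz in auto)
qed

text \<open>Bang's plank argument: signs that maximise the norm of a signed sum of unit vectors
  make every summand correlate with the sum.\<close>

lemma bang_vector:
  fixes p :: "'i \<Rightarrow> 'a::real_inner"
  assumes "finite J"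
  obtains c where "norm (\<Sum>j\<in>J. c j *\<^sub>R p j) \<le> 1"
    "\<And>i. i \<in> J \<Longrightarrow> norm (p i) \<le> card J * \<bar>inner (p i) (\<Sum>j\<in>J. c j *\<^sub>R p j)\<bar>"
proof (cases "J = {}")
  case True
  show ?thesis by (rule that) (auto simp: True)
next
  case ne: False
  define S where "S = PiE J (\<lambda>_. {-1, 1 :: real})"
  define q where "q j = (1 / norm (p j)) *\<^sub>R p j" for j
  define f where "f e = norm (\<Sum>j\<in>J. e j *\<^sub>R q j)" for e
  have "finite S" using assms by (auto simp: S_def intro: finite_PiE)
  moreover have "S \<noteq> {}" by (auto simp: S_def PiE_eq_empty_iff)
  ultimately have "Max (f ` S) \<in> f ` S" by (intro Max_in) auto
  then obtain e where e: "e \<in> S" "f e = Max (f ` S)" by auto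
  then have max: "f e' \<le> f e" if "e' \<in> S" for e'
    using that \<open>finite S\<close> by (auto intro: Max_ge)
  define w where "w = (\<Sum>j\<in>J. e j *\<^sub>R q j)"
  have nq: "norm (q j) \<le> 1" for j by (simp add: q_def)
  have eJ: "e j = -1 \<or> e j = 1" if "j \<in> J" for j using e(1) that by (auto simp: S_def)
  have "norm w \<le> (\<Sum>j\<in>J. norm (e j *\<^sub>R q j))" unfolding w_def by (rule norm_sum)
  also have "\<dots> \<le> (\<Sum>j\<in>J. 1)" by (rule sum_mono) (use eJ nq in force)
  finally have nw: "norm w \<le> card J" by simp
  have big: "norm (p j) \<le> \<bar>inner (p j) w\<bar>" if j: "j \<in> J" for j
  proof (cases "p j = 0")
    case True then show ?thesis by simp
  next
    case False
    define e' where "e' = e(j := - e j)"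
    have "e' \<in> S" using e(1) j eJ[OF j] by (auto simp: S_def e'_def PiE_iff extensional_def)
    have "(\<Sum>i\<in>J. e' i *\<^sub>R q i) = w - (2 * e j) *\<^sub>R q j"
    proof -
      have "(\<Sum>i\<in>J. e' i *\<^sub>R q i) = e' j *\<^sub>R q j + (\<Sum>i\<in>J-{j}. e' i *\<^sub>R q i)"
        using assms j by (rule sum.remove)
      also have "(\<Sum>i\<in>J-{j}. e' i *\<^sub>R q i) = (\<Sum>i\<in>J-{j}. e i *\<^sub>R q i)"
        by (rule sum.cong) (auto simp: e'_def)
      also have "w = e j *\<^sub>R q j + (\<Sum>i\<in>J-{j}. e i *\<^sub>R q i)"
        unfolding w_def using assms j by (rule sum.remove)
      then have "(\<Sum>i\<in>J-{j}. e i *\<^sub>R q i) = w - e j *\<^sub>R q j" by simp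
      finally show ?thesis by (simp add: e'_def algebra_simps scaleR_2 flip: scaleR_scaleR)
    qed
    with max[OF \<open>e' \<in> S\<close>] have "norm (w - (2 * e j) *\<^sub>R q j) \<le> norm w" by (simp add: f_def w_def)
    then have "(norm (w - (2 * e j) *\<^sub>R q j))\<^sup>2 \<le> (norm w)\<^sup>2" by (intro power_mono) auto
    moreover have "(norm (w - (2 * e j) *\<^sub>R q j))\<^sup>2
        = (norm w)\<^sup>2 - 4 * (e j * inner (q j) w) + 4 * (e j)\<^sup>2 * inner (q j) (q j)"
      unfolding power2_norm_eq_inner
      by (simp add: inner_diff_left inner_diff_right inner_commute power2_eq_square algebra_simps)
    ultimately have "4 * (e j)\<^sup>2 * inner (q j) (q j) \<le> 4 * (e j * inner (q j) w)" by simp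
    moreover have "inner (q j) (q j) = 1" using False by (simp add: q_def dot_square_norm power2_eq_square)
    moreover have "(e j)\<^sup>2 = 1" using eJ[OF j] by auto
    moreover have "e j * inner (q j) w \<le> \<bar>inner (q j) w\<bar>" using eJ[OF j] by auto
    ultimately have "1 \<le> \<bar>inner (q j) w\<bar>" by simp
    also have "\<dots> = \<bar>inner (p j) w\<bar> / norm (p j)" by (simp add: q_def abs_mult)
    finally show ?thesis using False by (simp add: le_divide_eq)
  qed
  have cJ: "real (card J) > 0" using ne assms by (simp add: card_gt_0_iff)
  \<comment> \<open>Dividing by \<open>card J\<close> puts the vector into the unit ball and causes
    the factor \<open>card J\<close> in the second bound. As a combination of the
    \<open>p j\<close>, the vector is orthogonal to everything that all of them are orthogonal
    to.\<close>
  define c where "c j = e j / (norm (p j) * card J)" for j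
  have cw: "(\<Sum>j\<in>J. c j *\<^sub>R p j) = (1 / card J) *\<^sub>R w"
    by (simp add: w_def c_def q_def scaleR_sum_right mult.commute)
  show ?thesis
  proof (rule that[of c], unfold cw)
    show "norm ((1 / card J) *\<^sub>R w) \<le> 1" using nw cJ by (simp add: divide_le_eq)
    show "norm (p i) \<le> card J * \<bar>inner (p i) ((1 / card J) *\<^sub>R w)\<bar>" if "i \<in> J" for i
      using big[OF that] cJ by (simp add: abs_mult)
  qed
qed

section \<open>Distance to a finite span\<close>

text \<open>A Gram-Schmidt step: the components along the old span are removed from both
  \<open>z\<close> and the new vector \<open>y q\<close>, and then \<open>z'\<close> is made
  orthogonal to \<open>y'\<close>.\<close>

lemma orthogonal_residual:
  fixes y :: "'i \<Rightarrow> 'a::real_inner"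
  assumes "finite Q"
  shows "\<exists>\<beta>. \<forall>s\<in>Q. inner (z - (\<Sum>t\<in>Q. \<beta> t *\<^sub>R y t)) (y s) = 0"
  using assms
proof (induction Q arbitrary: z rule: finite_induct)
  case empty then show ?case by simp
next
  case (insert q Q)
  obtain \<beta> where \<beta>: "\<forall>s\<in>Q. inner (z - (\<Sum>t\<in>Q. \<beta> t *\<^sub>R y t)) (y s) = 0" using insert.IH by blast
  obtain \<gamma> where \<gamma>: "\<forall>s\<in>Q. inner (y q - (\<Sum>t\<in>Q. \<gamma> t *\<^sub>R y t)) (y s) = 0" using insert.IH by blast
  define z' where "z' = z - (\<Sum>t\<in>Q. \<beta> t *\<^sub>R y t)"
  define y' where "y' = y q - (\<Sum>t\<in>Q. \<gamma> t *\<^sub>R y t)"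
  \<comment> \<open>For \<open>y' = 0\<close> the division yields \<open>k = 0\<close>, which is
    right: \<open>y q\<close> then lies in the old span already.\<close>
  define k where "k = inner z' y' / inner y' y'"
  define \<delta> where "\<delta> t = (if t = q then k else \<beta> t - k * \<gamma> t)" for t
  have "(\<Sum>t\<in>Q. \<delta> t *\<^sub>R y t) = (\<Sum>t\<in>Q. (\<beta> t - k * \<gamma> t) *\<^sub>R y t)"
    using insert.hyps by (intro sum.cong) (auto simp: \<delta>_def)
  also have "\<dots> = (\<Sum>t\<in>Q. \<beta> t *\<^sub>R y t) - k *\<^sub>R (\<Sum>t\<in>Q. \<gamma> t *\<^sub>R y t)"
    by (simp add: scaleR_diff_left sum_subtractf scaleR_sum_right)
  finally have eq: "z - (\<Sum>t\<in>insert q Q. \<delta> t *\<^sub>R y t) = z' - k *\<^sub>R y'"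
    using insert.hyps by (simp add: \<delta>_def z'_def y'_def algebra_simps)
  have Q: "inner (z' - k *\<^sub>R y') (y s) = 0" if "s \<in> Q" for s
    using \<beta> \<gamma> that by (simp add: inner_diff_left z'_def[symmetric] y'_def[symmetric])
  have yq: "y q = y' + (\<Sum>t\<in>Q. \<gamma> t *\<^sub>R y t)" by (simp add: y'_def)
  have "inner (z' - k *\<^sub>R y') (y q) = inner (z' - k *\<^sub>R y') y' + (\<Sum>t\<in>Q. \<gamma> t * inner (z' - k *\<^sub>R y') (y t))"
    unfolding yq inner_add_right inner_sum_right inner_scaleR_right ..
  also have "\<dots> = inner (z' - k *\<^sub>R y') y'" using Q by simp
  also have "\<dots> = 0" by (cases "y' = 0") (simp_all add: inner_diff_left k_def)
  finally show ?case using Q eq by (intro exI[of _ \<delta>]) auto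
qed

text \<open>For finite \<open>Q\<close> this is the component of \<open>z\<close> orthogonal to the
  span of the \<open>y t\<close>, so its norm is the distance from \<open>z\<close> to that span.
  The coefficients are a choice, being ambiguous for dependent \<open>y t\<close>; the vector is
  unique.\<close>

definition residual :: "('i \<Rightarrow> 'a::real_inner) \<Rightarrow> 'i set \<Rightarrow> 'a \<Rightarrow> 'a" where
  "residual y Q z =
     z - (\<Sum>t\<in>Q. (SOME \<beta>. \<forall>s\<in>Q. inner (z - (\<Sum>t\<in>Q. \<beta> t *\<^sub>R y t)) (y s) = 0) t *\<^sub>R y t)"

lemma residual_orthogonal:
  assumes "finite Q" "s \<in> Q"
  shows "inner (residual y Q z) (y s) = 0"
  unfolding residual_def using someI_ex[OF orthogonal_residual[OF assms(1), of z y]] assms(2) by blast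

lemma residual_combination: "\<exists>\<beta>. residual y Q z = z - (\<Sum>t\<in>Q. \<beta> t *\<^sub>R y t)"
  unfolding residual_def by blast

lemma residual_minimal:
  assumes "finite Q"
  shows "norm (residual y Q z) \<le> norm (z - (\<Sum>t\<in>Q. \<beta> t *\<^sub>R y t))"
proof -
  obtain \<gamma> where \<gamma>: "residual y Q z = z - (\<Sum>t\<in>Q. \<gamma> t *\<^sub>R y t)" using residual_combination by blast
  define r where "r = residual y Q z"
  define d where "d = (\<Sum>t\<in>Q. (\<gamma> t - \<beta> t) *\<^sub>R y t)"
  have eq: "z - (\<Sum>t\<in>Q. \<beta> t *\<^sub>R y t) = r + d"
    by (simp add: r_def \<gamma> d_def scaleR_diff_left sum_subtractf)
  have "inner r (y s) = 0" if "s \<in> Q" for s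
    unfolding r_def using residual_orthogonal[OF assms that] .
  then have "inner r d = 0" by (simp add: d_def inner_sum_right)
  then have "(norm (r + d))\<^sup>2 = (norm r)\<^sup>2 + (norm d)\<^sup>2"
    by (simp add: power2_norm_eq_inner inner_add_left inner_add_right inner_commute)
  then have "(norm r)\<^sup>2 \<le> (norm (r + d))\<^sup>2" by simp
  then show ?thesis unfolding eq r_def[symmetric] by (rule power2_le_imp_le) simp
qed

section \<open>Kruskal rank in terms of dual vectors\<close>

text \<open>The dual form of robust Kruskal rank at least \<open>k\<close>: no column is closer than
  \<open>1 / D\<close> to the span of fewer than \<open>k\<close> others. The advantage over
  singular values is that dual vectors of several modes can be multiplied.\<close>

definition robust_duals :: "nat \<Rightarrow> nat \<Rightarrow> real \<Rightarrow> (nat \<Rightarrow> 'a::real_inner) \<Rightarrow> bool" where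
  "robust_duals R k D x \<longleftrightarrow> (\<forall>I r. I \<subseteq> {..<R} \<longrightarrow> card I \<le> k \<longrightarrow> r \<in> I \<longrightarrow>
     (\<exists>w. norm w \<le> D \<and> inner (x r) w = 1 \<and> (\<forall>s\<in>I - {r}. inner (x s) w = 0)))"

lemma robust_dualsE:
  assumes "robust_duals R k D x" "I \<subseteq> {..<R}" "card I \<le> k" "r \<in> I"
  obtains w where "norm w \<le> D" "inner (x r) w = 1" "\<And>s. s \<in> I \<Longrightarrow> s \<noteq> r \<Longrightarrow> inner (x s) w = 0"
  using assms unfolding robust_duals_def by (metis DiffI singletonD)

lemma robust_duals_lower_bound:
  assumes "robust_duals R k D x" "I \<subseteq> {..<R}" "card I \<le> k" "r \<in> I"
  shows "\<bar>f r\<bar> \<le> D * norm (\<Sum>i\<in>I. f i *\<^sub>R x i)"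
proof -
  obtain w where w: "norm w \<le> D" "inner (x r) w = 1" "\<And>s. s \<in> I \<Longrightarrow> s \<noteq> r \<Longrightarrow> inner (x s) w = 0"
    using robust_dualsE[OF assms] by blast
  have fin: "finite I" using assms(2) finite_subset by blast
  have "inner (\<Sum>i\<in>I. f i *\<^sub>R x i) w = (\<Sum>i\<in>I. if i = r then f r else 0)"
    unfolding inner_sum_left by (intro sum.cong) (use w in auto)
  then have "f r = inner (\<Sum>i\<in>I. f i *\<^sub>R x i) w" using fin assms(4) by simp
  then have "\<bar>f r\<bar> \<le> norm (\<Sum>i\<in>I. f i *\<^sub>R x i) * norm w" using Cauchy_Schwarz_ineq2 by metis
  also have "\<dots> \<le> norm (\<Sum>i\<in>I. f i *\<^sub>R x i) * D" using w by (intro mult_left_mono) auto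
  finally show ?thesis by (simp add: mult.commute)
qed

text \<open>The dual vector is the residual of \<open>x r\<close> modulo the other vectors, divided
  by its squared norm. Its length is the reciprocal of a distance, and the hypothesis bounds that
  distance from below.\<close>

lemma robust_dualsI:
  assumes "\<And>I r f. I \<subseteq> {..<R} \<Longrightarrow> card I \<le> k \<Longrightarrow> r \<in> I \<Longrightarrow> f r = 1 \<Longrightarrow>
    1 \<le> D * norm (\<Sum>i\<in>I. f i *\<^sub>R x i)" "D > 0"
  shows "robust_duals R k D x"
  unfolding robust_duals_def
proof (intro allI impI)
  fix I r assume I: "I \<subseteq> {..<R}" "card I \<le> k" "r \<in> I"
  have fin: "finite (I - {r})" using I(1) finite_subset by blast
  define z where "z = residual x (I - {r}) (x r)"
  obtain \<beta> where \<beta>: "z = x r - (\<Sum>t\<in>I-{r}. \<beta> t *\<^sub>R x t)" using residual_combination z_def by blast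
  define f where "f t = (if t = r then 1 else - \<beta> t)" for t
  have "(\<Sum>i\<in>I. f i *\<^sub>R x i) = x r + (\<Sum>i\<in>I-{r}. f i *\<^sub>R x i)"
    using I fin by (subst sum.remove[of I r]) (auto simp: f_def finite_subset[OF I(1)])
  also have "(\<Sum>i\<in>I-{r}. f i *\<^sub>R x i) = - (\<Sum>i\<in>I-{r}. \<beta> i *\<^sub>R x i)"
    unfolding sum_negf[symmetric] by (intro sum.cong) (auto simp: f_def)
  finally have zf: "z = (\<Sum>i\<in>I. f i *\<^sub>R x i)" by (simp add: \<beta>)
  have nz: "1 \<le> D * norm z" unfolding zf by (rule assms(1)) (use I in \<open>auto simp: f_def\<close>)
  then have z0: "norm z > 0" using assms(2) by (cases "z = 0") auto
  have orth: "inner z (x s) = 0" if "s \<in> I - {r}" for s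
    unfolding z_def using residual_orthogonal[OF fin that] .
  have "inner z (x r) = inner z (z + (\<Sum>t\<in>I-{r}. \<beta> t *\<^sub>R x t))" by (simp add: \<beta>)
  also have "\<dots> = inner z z" using orth by (simp add: inner_add_right inner_sum_right)
  finally have zr: "inner z (x r) = (norm z)\<^sup>2" by (simp add: dot_square_norm)
  show "\<exists>w. norm w \<le> D \<and> inner (x r) w = 1 \<and> (\<forall>s\<in>I - {r}. inner (x s) w = 0)"
  proof (intro exI[of _ "(1 / (norm z)\<^sup>2) *\<^sub>R z"] conjI ballI)
    have "1 / norm z \<le> D" using nz z0 by (simp add: divide_le_eq)
    then show "norm ((1 / (norm z)\<^sup>2) *\<^sub>R z) \<le> D" using z0 by (simp add: power2_eq_square)
    show "inner (x r) ((1 / (norm z)\<^sup>2) *\<^sub>R z) = 1" using zr z0 by (simp add: inner_commute)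
    show "inner (x s) ((1 / (norm z)\<^sup>2) *\<^sub>R z) = 0" if "s \<in> I - {r}" for s
      using orth[OF that] by (simp add: inner_commute)
  qed
qed

section \<open>Matching the columns of one mode\<close>

text \<open>The unprimed vectors carry the duals, the primed ones are only bounded. Closeness is
  required only of contractions with three vectors, which keeps the locale independent of how
  tensors are modelled and makes it symmetric in the three modes.\<close>

locale close_decompositions =
  fixes R kA kB kC :: nat and D \<epsilon> :: real
    and a a' :: "nat \<Rightarrow> 'a::real_inner" and b b' :: "nat \<Rightarrow> 'b::real_inner"
    and c c' :: "nat \<Rightarrow> 'c::real_inner"
  assumes D2: "2 \<le> D" and RD: "real R \<le> D" and eps0: "0 \<le> \<epsilon>" and eps_small: "\<epsilon> * D ^ 30 < 1"
    and kA: "2 \<le> kA" "kA \<le> R" and kB: "2 \<le> kB" "kB \<le> R" and kC: "2 \<le> kC" "kC \<le> R"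
    and k_sum: "2 * R + 2 \<le> kA + kB + kC"
    and dual_a: "robust_duals R kA D a" and dual_b: "robust_duals R kB D b"
    and dual_c: "robust_duals R kC D c"
    and bnd_a: "\<And>i. i < R \<Longrightarrow> norm (a' i) \<le> D" and bnd_b: "\<And>i. i < R \<Longrightarrow> norm (b' i) \<le> D"
    and bnd_c: "\<And>i. i < R \<Longrightarrow> norm (c' i) \<le> D"
    and close: "\<And>u v w. \<bar>(\<Sum>r<R. inner (a r) u * inner (b r) v * inner (c r) w) -
        (\<Sum>r<R. inner (a' r) u * inner (b' r) v * inner (c' r) w)\<bar> \<le> \<epsilon> * (norm u * norm v * norm w)"
begin

lemma D_ge1: "1 \<le> D" "0 < D" "0 \<le> D" using D2 by auto

lemma eps_power: "p \<le> 30 \<Longrightarrow> \<epsilon> * D ^ p < 1"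
proof -
  assume "p \<le> 30"
  then have "\<epsilon> * D ^ p \<le> \<epsilon> * D ^ 30"
    using eps0 D_ge1 by (intro mult_left_mono power_increasing) auto
  then show ?thesis using eps_small by simp
qed

section \<open>Comparison of ranks after contracting the third mode\<close>

text \<open>Up to terms of size \<open>\<nu>\<close>, contracting the third mode with
  \<open>w\<close> leaves a matrix of rank at most \<open>card T\<close> on the primed side. If all
  \<open>inner (c r) w\<close> with \<open>r \<in> W\<close> were large, the other side would
  robustly have larger rank. The proof exhibits test vectors \<open>U\<close> and \<open>v\<close>
  that annihilate the terms in \<open>T\<close> and isolate one term \<open>q\<close> of
  \<open>W\<close>.\<close>

lemma few_large_contractions:
  assumes T: "T \<subseteq> {..<R}" "card T \<le> R - kC + 1" and W: "W \<subseteq> {..<R}" "card T < card W"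
    and w: "norm w \<le> 1" and \<nu>: "\<And>i. i < R \<Longrightarrow> i \<notin> T \<Longrightarrow> \<bar>inner (c' i) w\<bar> \<le> \<nu>" and \<nu>0: "0 \<le> \<nu>"
  shows "\<exists>r\<in>W. \<bar>inner (c r) w\<bar> \<le> \<epsilon> * D ^ 3 + D ^ 6 * \<nu>"
proof -
  obtain W0 where W0: "W0 \<subseteq> W" "card W0 = card T + 1"
    by (metis Suc_eq_plus1 Suc_leI W(2) obtain_subset_with_card_n)
  have finR: "finite {..<R}" by simp
  have fin: "finite T" "finite W" "finite W0" using T W W0 finite_subset[OF _ finR]
    by (meson finite_subset finite_lessThan)+
  have W0R: "W0 \<subseteq> {..<R}" using W W0 by auto
  \<comment> \<open>\<open>card W0\<close> is at most \<open>R - kC + 2\<close>, and this is at most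
    \<open>kA\<close> by Kruskal's condition and \<open>kB \<le> R\<close>.\<close>
  have cW0: "card W0 \<le> kA" using W0 T k_sum kA kB kC by linarith
  have "\<exists>Z. W0 \<subseteq> Z \<and> Z \<subseteq> {..<R} \<and> card Z = kA"
  proof -
    have "kA - card W0 \<le> card ({..<R} - W0)" using W0R fin kA by (simp add: card_Diff_subset)
    then obtain Y where Y: "Y \<subseteq> {..<R} - W0" "card Y = kA - card W0"
      using obtain_subset_with_card_n by metis
    have "card (W0 \<union> Y) = kA"
      using Y fin cW0 by (subst card_Un_disjoint) (auto intro: finite_subset[OF Y(1)])
    then show ?thesis using Y W0R by (intro exI[of _ "W0 \<union> Y"]) auto
  qed
  then obtain Z where Z: "W0 \<subseteq> Z" "Z \<subseteq> {..<R}" "card Z = kA" by blast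
  have finZ: "finite Z" using Z finite_subset by blast
  have "\<forall>r\<in>W0. \<exists>u. norm u \<le> D \<and> inner (a r) u = 1 \<and> (\<forall>s\<in>Z - {r}. inner (a s) u = 0)"
    using dual_a Z unfolding robust_duals_def by blast
  then obtain u where u: "\<And>r. r \<in> W0 \<Longrightarrow> norm (u r) \<le> D" "\<And>r. r \<in> W0 \<Longrightarrow> inner (a r) (u r) = 1"
    "\<And>r s. r \<in> W0 \<Longrightarrow> s \<in> Z \<Longrightarrow> s \<noteq> r \<Longrightarrow> inner (a s) (u r) = 0"
    by (metis DiffI singletonD)
  \<comment> \<open>With one element more in \<open>W0\<close> than in \<open>T\<close>, some
    combination of the duals annihilates all \<open>a' t\<close>, \<open>t \<in> T\<close>. The
    coefficient normalized to 1 selects the column \<open>q\<close> that survives.\<close>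
  obtain \<alpha> q where q: "q \<in> W0" "\<alpha> q = 1" "\<And>r. r \<in> W0 \<Longrightarrow> \<bar>\<alpha> r\<bar> \<le> 1"
    and \<alpha>: "\<And>t. t \<in> T \<Longrightarrow> (\<Sum>r\<in>W0. \<alpha> r * inner (a' t) (u r)) = 0"
    using underdetermined_system_normalized[of T W0 "\<lambda>r t. inner (a' t) (u r)"] fin W0
    by (metis less_add_one)
  define U where "U = (\<Sum>r\<in>W0. \<alpha> r *\<^sub>R u r)"
  have inU: "inner x U = (\<Sum>r\<in>W0. \<alpha> r * inner x (u r))" for x
    by (simp add: U_def inner_sum_right)
  have "norm U \<le> (\<Sum>r\<in>W0. norm (\<alpha> r *\<^sub>R u r))" unfolding U_def by (rule norm_sum)
  also have "\<dots> \<le> (\<Sum>r\<in>W0. 1 * D)" unfolding norm_scaleR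
    by (intro sum_mono mult_mono) (use q u in auto)
  also have "\<dots> \<le> D * D"
  proof -
    have "real (card W0) \<le> real R" using card_mono[OF finR W0R] by simp
    then show ?thesis using RD D_ge1 by (simp add: mult_right_mono)
  qed
  finally have nU: "norm U \<le> D\<^sup>2" by (simp add: power2_eq_square)
  have aU: "inner (a s) U = 0" if "s \<in> Z - W0" for s
    unfolding inU using that u(3) by (intro sum.neutral) auto
  have aUq: "inner (a q) U = 1"
  proof -
    have "inner (a q) U = (\<Sum>r\<in>W0. if r = q then 1 else 0)"
      unfolding inU by (intro sum.cong) (use q u Z in auto)
    then show ?thesis using fin q by simp
  qed
  \<comment> \<open>\<open>U\<close> vanishes on \<open>Z - W0\<close>, so \<open>v\<close> has to
    remove the rest of \<open>W0\<close> and everything outside \<open>Z\<close>. That these are few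
    enough, \<open>R - kC + 2 + (R - kA) \<le> kB\<close>, is exactly Kruskal's condition.\<close>
  define I where "I = W0 \<union> ({..<R} - Z)"
  have I: "I \<subseteq> {..<R}" "q \<in> I" using W0R q by (auto simp: I_def)
  have "card I \<le> card W0 + card ({..<R} - Z)" unfolding I_def by (rule card_Un_le)
  also have "card ({..<R} - Z) = R - kA" using Z finZ by (simp add: card_Diff_subset)
  finally have cI: "card I \<le> kB" using W0 T k_sum kA kC by linarith
  obtain v where v: "norm v \<le> D" "inner (b q) v = 1" "\<And>s. s \<in> I \<Longrightarrow> s \<noteq> q \<Longrightarrow> inner (b s) v = 0"
    using robust_dualsE[OF dual_b I(1) cI I(2)] by blast
  have "(\<Sum>r<R. inner (a r) U * inner (b r) v * inner (c r) w) = (\<Sum>r<R. if r = q then inner (c q) w else 0)"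
  proof (rule sum.cong)
    fix r assume "r \<in> {..<R}"
    then show "inner (a r) U * inner (b r) v * inner (c r) w = (if r = q then inner (c q) w else 0)"
      using aU aUq v by (cases "r \<in> I") (auto simp: I_def)
  qed simp
  also have "\<dots> = inner (c q) w" using I by auto
  finally have lhs: "(\<Sum>r<R. inner (a r) U * inner (b r) v * inner (c r) w) = inner (c q) w" .
  have bound: "\<bar>inner (a' i) U * inner (b' i) v * inner (c' i) w\<bar> \<le> D ^ 5 * \<nu>" if i: "i < R" for i
  proof (cases "i \<in> T")
    case True
    then have "inner (a' i) U = 0" using \<alpha> by (simp add: inU)
    then show ?thesis using \<nu>0 D_ge1 by simp
  next
    case False
    have "\<bar>inner (a' i) U\<bar> \<le> norm (a' i) * norm U" by (rule Cauchy_Schwarz_ineq2)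
    also have "\<dots> \<le> D * D\<^sup>2" using bnd_a[OF i] nU D_ge1 by (intro mult_mono) auto
    finally have 1: "\<bar>inner (a' i) U\<bar> \<le> D * D\<^sup>2" .
    have "\<bar>inner (b' i) v\<bar> \<le> norm (b' i) * norm v" by (rule Cauchy_Schwarz_ineq2)
    also have "\<dots> \<le> D * D" using bnd_b[OF i] v D_ge1 by (intro mult_mono) auto
    finally have 2: "\<bar>inner (b' i) v\<bar> \<le> D * D" .
    have "\<bar>inner (a' i) U\<bar> * \<bar>inner (b' i) v\<bar> * \<bar>inner (c' i) w\<bar> \<le> (D * D\<^sup>2) * (D * D) * \<nu>"
      using 1 2 \<nu>[OF i False] D_ge1 by (intro mult_mono) auto
    then show ?thesis by (simp add: abs_mult power_numeral_reduce mult.assoc)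
  qed
  have "\<bar>\<Sum>r<R. inner (a' r) U * inner (b' r) v * inner (c' r) w\<bar> \<le> (\<Sum>r<R. D ^ 5 * \<nu>)"
    by (rule order_trans[OF sum_abs]) (rule sum_mono, use bound in auto)
  also have "\<dots> = real R * (D ^ 5 * \<nu>)" by simp
  also have "\<dots> \<le> D * (D ^ 5 * \<nu>)" using RD \<nu>0 D_ge1 by (intro mult_right_mono) auto
  finally have rhs: "\<bar>\<Sum>r<R. inner (a' r) U * inner (b' r) v * inner (c' r) w\<bar> \<le> D ^ 6 * \<nu>"
    by (simp add: power_numeral_reduce mult.assoc)
  have "\<epsilon> * (norm U * norm v * norm w) \<le> \<epsilon> * (D\<^sup>2 * D * 1)"
    using nU v w D_ge1 eps0 by (intro mult_left_mono mult_mono) auto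
  then have "\<bar>inner (c q) w\<bar> \<le> \<epsilon> * D ^ 3 + D ^ 6 * \<nu>"
    using close[of U v w] rhs unfolding lhs by (simp add: power_numeral_reduce mult.assoc)
  then show ?thesis using q W0 by blast
qed

section \<open>Columns near a span of primed columns\<close>

definition near :: "real \<Rightarrow> nat set \<Rightarrow> nat set" where
  "near \<delta> Q = {j. j < R \<and> norm (residual c' Q (c j)) \<le> \<delta>}"

lemma finite_near: "finite (near \<delta> Q)" by (simp add: near_def)

lemma near_mono: "\<delta> \<le> \<delta>' \<Longrightarrow> near \<delta> Q \<subseteq> near \<delta>' Q" by (auto simp: near_def)

lemma near_subset_mono:
  assumes "Q \<subseteq> Q'" "Q' \<subseteq> {..<R}"
  shows "near \<delta> Q \<subseteq> near \<delta> Q'"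
proof
  fix j assume j: "j \<in> near \<delta> Q"
  have fin: "finite Q'" using assms(2) finite_subset by blast
  obtain \<beta> where \<beta>: "residual c' Q (c j) = c j - (\<Sum>t\<in>Q. \<beta> t *\<^sub>R c' t)"
    using residual_combination by blast
  have "(\<Sum>t\<in>Q. \<beta> t *\<^sub>R c' t) = (\<Sum>t\<in>Q'. (if t \<in> Q then \<beta> t else 0) *\<^sub>R c' t)"
    using assms fin by (intro sum.mono_neutral_cong_left) auto
  then show "j \<in> near \<delta> Q'"
    using residual_minimal[OF fin, of c' "c j" "\<lambda>t. if t \<in> Q then \<beta> t else 0"] j \<beta>
    by (auto simp: near_def)
qed

text \<open>More than \<open>card Q\<close> near columns have linearly dependent coordinates over
  \<open>Q\<close>. The dependency, normalized, turns into a combination of the columns of norm at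
  most \<open>D * \<delta>\<close>, which is too short for a family with dual vectors.\<close>

lemma card_near_le:
  assumes Q: "Q \<subseteq> {..<R}" "card Q < kC" and \<delta>: "\<delta> * D\<^sup>2 < 1"
  shows "card (near \<delta> Q) \<le> card Q"
proof (rule ccontr)
  assume "\<not> ?thesis"
  then obtain J where J: "J \<subseteq> near \<delta> Q" "card J = card Q + 1"
    using obtain_subset_with_card_n[of "card Q + 1" "near \<delta> Q"] by auto
  have JR: "J \<subseteq> {..<R}" using J by (auto simp: near_def)
  have fin: "finite Q" "finite J" using Q JR finite_subset by blast+
  have "\<forall>j. \<exists>\<beta>. residual c' Q (c j) = c j - (\<Sum>t\<in>Q. \<beta> t *\<^sub>R c' t)" using residual_combination by blast
  then obtain \<beta> where \<beta>: "\<And>j. residual c' Q (c j) = c j - (\<Sum>t\<in>Q. \<beta> j t *\<^sub>R c' t)" by metis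
  obtain \<gamma> q where q: "q \<in> J" "\<gamma> q = 1" "\<And>r. r \<in> J \<Longrightarrow> \<bar>\<gamma> r\<bar> \<le> 1"
    and \<gamma>: "\<And>t. t \<in> Q \<Longrightarrow> (\<Sum>r\<in>J. \<gamma> r * \<beta> r t) = 0"
    using underdetermined_system_normalized[of Q J \<beta>] fin J by (metis less_add_one)
  have "(\<Sum>j\<in>J. \<gamma> j *\<^sub>R (\<Sum>t\<in>Q. \<beta> j t *\<^sub>R c' t)) = (\<Sum>t\<in>Q. (\<Sum>j\<in>J. \<gamma> j * \<beta> j t) *\<^sub>R c' t)"
    unfolding scaleR_sum_right scaleR_sum_left scaleR_scaleR by (rule sum.swap)
  also have "\<dots> = 0" using \<gamma> by simp
  finally have "(\<Sum>j\<in>J. \<gamma> j *\<^sub>R c j) = (\<Sum>j\<in>J. \<gamma> j *\<^sub>R residual c' Q (c j))"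
    unfolding \<beta> by (simp add: scaleR_diff_right sum_subtractf)
  also have "norm \<dots> \<le> (\<Sum>j\<in>J. norm (\<gamma> j *\<^sub>R residual c' Q (c j)))" by (rule norm_sum)
  also have "\<dots> \<le> (\<Sum>j\<in>J. 1 * \<delta>)" unfolding norm_scaleR
    by (intro sum_mono mult_mono) (use q J in \<open>auto simp: near_def\<close>)
  also have "\<dots> = real (card J) * \<delta>" by simp
  finally have n: "norm (\<Sum>j\<in>J. \<gamma> j *\<^sub>R c j) \<le> real (card J) * \<delta>" .
  have \<delta>0: "0 \<le> \<delta>" using q(1) J by (auto simp: near_def intro: order_trans[OF norm_ge_zero])
  have "real (card J) \<le> D" using card_mono[OF _ JR] RD by simp
  then have "real (card J) * \<delta> \<le> D * \<delta>" using \<delta>0 by (rule mult_right_mono)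
  with n have "D * norm (\<Sum>j\<in>J. \<gamma> j *\<^sub>R c j) \<le> D * (D * \<delta>)" using D_ge1 by (intro mult_left_mono) auto
  moreover have "\<bar>\<gamma> q\<bar> \<le> D * norm (\<Sum>j\<in>J. \<gamma> j *\<^sub>R c j)"
    by (rule robust_duals_lower_bound[OF dual_c JR]) (use J Q q in auto)
  ultimately show False using \<delta> q by (simp add: power2_eq_square mult_ac)
qed

text \<open>The comparison of ranks counts columns for one fixed \<open>w\<close>, so a single
  \<open>w\<close> has to detect the distance from the span of \<open>S\<close> for all columns at
  once. Bang's vector of the residuals does this while staying orthogonal to the span; the price is
  a factor \<open>R \<le> D\<close>, which raises the exponents 3 and 6 to 4 and 7.\<close>

lemma many_near:
  assumes S: "S \<subseteq> {..<R}" and T: "T \<subseteq> {..<R}" "S \<inter> T = {}" "card T \<le> R - kC + 1"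
    and \<nu>: "\<And>i. i < R \<Longrightarrow> i \<notin> S \<Longrightarrow> i \<notin> T \<Longrightarrow> norm (residual c' S (c' i)) \<le> \<nu>" and \<nu>0: "0 \<le> \<nu>"
  shows "R - card T \<le> card (near (\<epsilon> * D ^ 4 + D ^ 7 * \<nu>) S)"
proof -
  have finS: "finite S" using S finite_subset by blast
  define p where "p j = residual c' S (c j)" for j
  obtain e where e: "norm (\<Sum>j<R. e j *\<^sub>R p j) \<le> 1"
    "\<And>i. i < R \<Longrightarrow> norm (p i) \<le> real R * \<bar>inner (p i) (\<Sum>j<R. e j *\<^sub>R p j)\<bar>"
    using bang_vector[of "{..<R}" p] by auto
  define w where "w = (\<Sum>j<R. e j *\<^sub>R p j)"
  have orth: "inner (c' s) w = 0" if "s \<in> S" for s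
    using residual_orthogonal[OF finS that, of c'] by (simp add: w_def p_def inner_sum_right inner_commute)
  have res: "inner z w = inner (residual c' S z) w" for z
  proof -
    obtain \<beta> where "residual c' S z = z - (\<Sum>t\<in>S. \<beta> t *\<^sub>R c' t)" using residual_combination by blast
    then show ?thesis using orth by (simp add: inner_diff_left inner_sum_left)
  qed
  have c'w: "\<bar>inner (c' i) w\<bar> \<le> \<nu>" if i: "i < R" "i \<notin> T" for i
  proof (cases "i \<in> S")
    case True then show ?thesis using orth \<nu>0 by simp
  next
    case False
    have "\<bar>inner (c' i) w\<bar> \<le> norm (residual c' S (c' i)) * norm w"
      unfolding res[of "c' i"] by (rule Cauchy_Schwarz_ineq2)
    also have "\<dots> \<le> \<nu> * 1" using \<nu>[OF i(1) False i(2)] e(1) \<nu>0 by (intro mult_mono) (auto simp: w_def)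
    finally show ?thesis by simp
  qed
  define N where "N = {j. j < R \<and> \<bar>inner (c j) w\<bar> \<le> \<epsilon> * D ^ 3 + D ^ 6 * \<nu>}"
  have NR: "N \<subseteq> {..<R}" by (auto simp: N_def)
  have "N \<subseteq> near (\<epsilon> * D ^ 4 + D ^ 7 * \<nu>) S"
  proof
    fix j assume "j \<in> N"
    then have j: "j < R" "\<bar>inner (c j) w\<bar> \<le> \<epsilon> * D ^ 3 + D ^ 6 * \<nu>" by (auto simp: N_def)
    have "norm (p j) \<le> real R * \<bar>inner (c j) w\<bar>" using e(2)[OF j(1)] res[of "c j"] by (simp add: w_def p_def)
    also have "\<dots> \<le> D * (\<epsilon> * D ^ 3 + D ^ 6 * \<nu>)" using j RD D_ge1 by (intro mult_mono) auto
    finally show "j \<in> near (\<epsilon> * D ^ 4 + D ^ 7 * \<nu>) S"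
      using j by (simp add: near_def p_def algebra_simps power_numeral_reduce)
  qed
  then have NN: "card N \<le> card (near (\<epsilon> * D ^ 4 + D ^ 7 * \<nu>) S)" by (rule card_mono[OF finite_near])
  have "R - card T \<le> card N"
  proof (rule ccontr)
    assume "\<not> ?thesis"
    then have "card T < R - card N" by linarith
    also have "R - card N = card ({..<R} - N)" using NR by (simp add: card_Diff_subset finite_subset)
    finally have "card T < card ({..<R} - N)" .
    from few_large_contractions[OF T(1,3) _ this _ c'w \<nu>0] e(1)
    have "\<exists>r\<in>{..<R} - N. \<bar>inner (c r) w\<bar> \<le> \<epsilon> * D ^ 3 + D ^ 6 * \<nu>" by (auto simp: w_def)
    then show False by (auto simp: N_def)
  qed
  with NN show ?thesis by linarith
qed

text \<open>If \<open>T\<close> is everything outside \<open>S\<close>, the lower bound from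
  \<open>many_near\<close> is \<open>kC - 1\<close> and meets the upper bound from
  \<open>card_near_le\<close>. Enlarging the tolerance within the allowed range thus adds no column:
  this is the gap.\<close>

lemma near_hyperplane:
  assumes S: "S \<subseteq> {..<R}" "card S = kC - 1" and \<delta>: "\<epsilon> * D ^ 4 \<le> \<delta>" "\<delta> * D\<^sup>2 < 1"
  shows "near \<delta> S = near (\<epsilon> * D ^ 4) S" "card (near \<delta> S) = kC - 1"
proof -
  have finS: "finite S" using S finite_subset by blast
  have T: "card ({..<R} - S) = R - kC + 1" using S finS kC by (simp add: card_Diff_subset)
  have "R - (R - kC + 1) \<le> card (near (\<epsilon> * D ^ 4 + D ^ 7 * 0) S)"
    using many_near[OF S(1), of "{..<R} - S" 0] T by auto
  then have ge: "kC - 1 \<le> card (near (\<epsilon> * D ^ 4) S)" using kC by simp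
  have le: "card (near \<delta> S) \<le> kC - 1" using card_near_le[OF S(1) _ \<delta>(2)] S kC by simp
  have sub: "near (\<epsilon> * D ^ 4) S \<subseteq> near \<delta> S" by (rule near_mono[OF \<delta>(1)])
  show eq: "near \<delta> S = near (\<epsilon> * D ^ 4) S"
    using card_seteq[OF finite_near sub] le ge by simp
  show "card (near \<delta> S) = kC - 1" using le ge eq by simp
qed

text \<open>Independence is inherited by the primed columns: if \<open>c' i\<close> were close to
  the span of \<open>K - {i}\<close>, the exceptional set \<open>T\<close> could be one smaller, and
  \<open>kC\<close> columns would be near a span of \<open>kC - 1\<close>.\<close>

lemma separated:
  assumes K: "K \<subseteq> {..<R}" "card K = kC" "i \<in> K"
  shows "1 < D ^ 10 * norm (residual c' (K - {i}) (c' i))"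
proof (rule ccontr)
  define \<nu> where "\<nu> = norm (residual c' (K - {i}) (c' i))"
  assume "\<not> ?thesis"
  then have \<nu>: "D ^ 10 * \<nu> \<le> 1" by (simp add: \<nu>_def)
  have finK: "finite K" using K finite_subset by blast
  define S where "S = K - {i}"
  have S: "S \<subseteq> {..<R}" "card S = kC - 1" using K finK by (auto simp: S_def)
  have T: "card ({..<R} - K) = R - kC" using K finK by (simp add: card_Diff_subset)
  have "R - (R - kC) \<le> card (near (\<epsilon> * D ^ 4 + D ^ 7 * \<nu>) S)"
    unfolding T[symmetric] using T by (intro many_near[OF S(1)]) (auto simp: S_def \<nu>_def)
  then have ge: "kC \<le> card (near (\<epsilon> * D ^ 4 + D ^ 7 * \<nu>) S)" using kC by simp
  have "(\<epsilon> * D ^ 4 + D ^ 7 * \<nu>) * D\<^sup>2 < 1"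
  proof -
    have "D ^ 9 * \<nu> * 2 \<le> D ^ 9 * \<nu> * D" using D2 by (intro mult_left_mono) (auto simp: \<nu>_def)
    also have "\<dots> \<le> 1" using \<nu> by (simp add: power_numeral_reduce mult_ac)
    finally have 1: "D ^ 9 * \<nu> \<le> 1 / 2" by simp
    have "\<epsilon> * D ^ 6 * 2 \<le> \<epsilon> * D ^ 6 * D" using D2 eps0 by (intro mult_left_mono) auto
    also have "\<dots> = \<epsilon> * D ^ 7" by (simp add: power_numeral_reduce mult_ac)
    also have "\<dots> < 1" by (rule eps_power) simp
    finally have 2: "\<epsilon> * D ^ 6 < 1 / 2" by simp
    have "(\<epsilon> * D ^ 4 + D ^ 7 * \<nu>) * D\<^sup>2 = \<epsilon> * D ^ 6 + D ^ 9 * \<nu>"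
      by (simp add: power_numeral_reduce algebra_simps)
    then show ?thesis using 1 2 by linarith
  qed
  then have "card (near (\<epsilon> * D ^ 4 + D ^ 7 * \<nu>) S) \<le> card S"
    using S kC by (intro card_near_le) auto
  then show False using ge S kC by linarith
qed

text \<open>Divided by \<open>f i\<close>, the combination is a difference of \<open>c' i\<close>
  and an element of the span of the others, hence at least as long as the residual in
  \<open>separated\<close>.\<close>

lemma coefficient_bound:
  assumes K: "K \<subseteq> {..<R}" "card K = kC" "i \<in> K"
  shows "\<bar>f i\<bar> \<le> D ^ 10 * norm (\<Sum>s\<in>K. f s *\<^sub>R c' s)"
proof (cases "f i = 0")
  case True then show ?thesis using D_ge1 by simp
next
  case False
  have finK: "finite K" using K finite_subset by blast
  have "(\<Sum>s\<in>K. f s *\<^sub>R c' s) = f i *\<^sub>R c' i + (\<Sum>s\<in>K-{i}. f s *\<^sub>R c' s)"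
    using finK K by (simp add: sum.remove)
  also have "(\<Sum>s\<in>K-{i}. f s *\<^sub>R c' s) = - (f i *\<^sub>R (\<Sum>s\<in>K-{i}. (- f s / f i) *\<^sub>R c' s))"
    using False by (simp add: scaleR_sum_right sum_negf)
  finally have eq: "(\<Sum>s\<in>K. f s *\<^sub>R c' s) = f i *\<^sub>R (c' i - (\<Sum>s\<in>K-{i}. (- f s / f i) *\<^sub>R c' s))"
    by (simp add: scaleR_diff_right)
  have "norm (residual c' (K-{i}) (c' i)) \<le> norm (c' i - (\<Sum>s\<in>K-{i}. (- f s / f i) *\<^sub>R c' s))"
    by (rule residual_minimal) (use finK in auto)
  then have "D ^ 10 * norm (residual c' (K-{i}) (c' i)) \<le> D ^ 10 * norm (c' i - (\<Sum>s\<in>K-{i}. (- f s / f i) *\<^sub>R c' s))"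
    using D_ge1 by (intro mult_left_mono) auto
  then have "\<bar>f i\<bar> * 1 \<le> \<bar>f i\<bar> * (D ^ 10 * norm (c' i - (\<Sum>s\<in>K-{i}. (- f s / f i) *\<^sub>R c' s)))"
    using separated[OF K] by (intro mult_left_mono) auto
  then show ?thesis unfolding eq by (simp add: mult_ac)
qed

section \<open>Descent from hyperplanes to lines\<close>

text \<open>The tolerance kept throughout the descent. The exponent consists of 4 from the
  hyperplanes, 10 from \<open>coefficient_bound\<close>, 2 for the norm and the number of discarded
  terms, and 2 for a numerical factor 3.\<close>

abbreviation "\<delta> \<equiv> \<epsilon> * D ^ 18"

lemma \<delta>_bounds: "\<epsilon> * D ^ 4 \<le> \<delta>" "\<delta> * D\<^sup>2 < 1" "0 \<le> \<delta>"
proof -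
  show "\<epsilon> * D ^ 4 \<le> \<delta>" using eps0 D_ge1 by (intro mult_left_mono power_increasing) auto
  show "\<delta> * D\<^sup>2 < 1" using eps_power[of 20] by (simp add: power_add[symmetric] mult.assoc)
  show "0 \<le> \<delta>" using eps0 D_ge1 by simp
qed

lemma near_intersection_hyperplanes:
  assumes K: "K \<subseteq> {..<R}" "card K = kC" and Q: "Q \<subset> K"
    and j: "\<And>i. i \<in> K - Q \<Longrightarrow> j \<in> near \<delta> (K - {i})"
  shows "j \<in> near \<delta> Q"
proof -
  have finK: "finite K" using K finite_subset by blast
  then have finQ: "finite Q" using Q finite_subset by blast
  have "j \<in> near (\<epsilon> * D ^ 4) (K - {i})" if "i \<in> K - Q" for i
  proof -
    have "K - {i} \<subseteq> {..<R}" "card (K - {i}) = kC - 1" using K that finK by auto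
    from near_hyperplane(1)[OF this \<delta>_bounds(1,2)] show ?thesis using j[OF that] by simp
  qed
  then have jn: "j < R" "\<And>i. i \<in> K - Q \<Longrightarrow> norm (residual c' (K - {i}) (c j)) \<le> \<epsilon> * D ^ 4"
    using Q by (auto simp: near_def)
  have "\<forall>i. \<exists>\<beta>. residual c' (K - {i}) (c j) = c j - (\<Sum>t\<in>K - {i}. \<beta> t *\<^sub>R c' t)"
    using residual_combination by blast
  then obtain \<beta>0 where \<beta>0: "\<And>i. residual c' (K - {i}) (c j) = c j - (\<Sum>t\<in>K - {i}. \<beta>0 i t *\<^sub>R c' t)" by metis
  \<comment> \<open>Continued by zero, all representations live on \<open>K\<close>; since
    \<open>\<beta> i i = 0\<close>, the difference to the representation for \<open>i\<close> bounds
    \<open>\<beta> q i\<close> itself.\<close>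
  define \<beta> where "\<beta> i t = (if t = i then 0 else \<beta>0 i t)" for i t
  have \<beta>: "residual c' (K - {i}) (c j) = c j - (\<Sum>t\<in>K. \<beta> i t *\<^sub>R c' t)" for i
  proof -
    have "(\<Sum>t\<in>K. \<beta> i t *\<^sub>R c' t) = (\<Sum>t\<in>K-{i}. \<beta>0 i t *\<^sub>R c' t)"
      using finK by (intro sum.mono_neutral_cong_right) (auto simp: \<beta>_def)
    then show ?thesis using \<beta>0 by simp
  qed
  obtain q where q: "q \<in> K - Q" using Q by blast
  have small: "\<bar>\<beta> q i\<bar> \<le> 2 * \<epsilon> * D ^ 14" if i: "i \<in> K - Q" for i
  proof -
    have "(\<Sum>t\<in>K. (\<beta> q t - \<beta> i t) *\<^sub>R c' t) = residual c' (K - {i}) (c j) - residual c' (K - {q}) (c j)"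
      unfolding \<beta> by (simp add: scaleR_diff_left sum_subtractf)
    also have "norm \<dots> \<le> \<epsilon> * D ^ 4 + \<epsilon> * D ^ 4"
      using jn(2)[OF i] jn(2)[OF q] by (intro order_trans[OF norm_triangle_ineq4] add_mono)
    finally have "D ^ 10 * norm (\<Sum>t\<in>K. (\<beta> q t - \<beta> i t) *\<^sub>R c' t) \<le> D ^ 10 * (\<epsilon> * D ^ 4 + \<epsilon> * D ^ 4)"
      using D_ge1 by (intro mult_left_mono) auto
    then have "\<bar>\<beta> q i - \<beta> i i\<bar> \<le> D ^ 10 * (\<epsilon> * D ^ 4 + \<epsilon> * D ^ 4)"
      using coefficient_bound[OF K, of i "\<lambda>t. \<beta> q t - \<beta> i t"] i by auto
    also have "\<dots> = 2 * \<epsilon> * D ^ 14" by (simp add: algebra_simps power_add[symmetric])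
    finally show ?thesis by (simp add: \<beta>_def)
  qed
  have split: "(\<Sum>t\<in>K. \<beta> q t *\<^sub>R c' t) = (\<Sum>t\<in>Q. \<beta> q t *\<^sub>R c' t) + (\<Sum>t\<in>K-Q. \<beta> q t *\<^sub>R c' t)"
    using finK Q by (subst sum.subset_diff[of Q K]) auto
  have "norm (\<Sum>t\<in>K-Q. \<beta> q t *\<^sub>R c' t) \<le> (\<Sum>t\<in>K-Q. norm (\<beta> q t *\<^sub>R c' t))" by (rule norm_sum)
  also have "\<dots> \<le> (\<Sum>t\<in>K-Q. 2 * \<epsilon> * D ^ 14 * D)"
    unfolding norm_scaleR by (intro sum_mono mult_mono) (use small bnd_c K eps0 D_ge1 in auto)
  also have "\<dots> = card (K - Q) * (2 * \<epsilon> * D ^ 14 * D)" by simp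
  also have "\<dots> \<le> D * (2 * \<epsilon> * D ^ 14 * D)"
  proof (intro mult_right_mono)
    have "card (K - Q) \<le> card {..<R}" using K by (intro card_mono) auto
    then show "real (card (K - Q)) \<le> D" using RD by simp
  qed (use eps0 D_ge1 in auto)
  also have "\<dots> = 2 * \<epsilon> * D ^ 16" by (simp add: power_numeral_reduce mult_ac)
  finally have rest: "norm (\<Sum>t\<in>K-Q. \<beta> q t *\<^sub>R c' t) \<le> 2 * \<epsilon> * D ^ 16" .
  have "norm (residual c' Q (c j)) \<le> norm (c j - (\<Sum>t\<in>Q. \<beta> q t *\<^sub>R c' t))"
    by (rule residual_minimal[OF finQ])
  also have "c j - (\<Sum>t\<in>Q. \<beta> q t *\<^sub>R c' t) = residual c' (K - {q}) (c j) + (\<Sum>t\<in>K-Q. \<beta> q t *\<^sub>R c' t)"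
    unfolding \<beta> split by simp
  also have "norm \<dots> \<le> \<epsilon> * D ^ 4 + 2 * \<epsilon> * D ^ 16"
    by (intro order_trans[OF norm_triangle_ineq] add_mono jn(2)[OF q] rest)
  also have "\<dots> \<le> \<epsilon> * D ^ 16 + 2 * \<epsilon> * D ^ 16"
    using eps0 D_ge1 by (intro add_right_mono mult_left_mono power_increasing) auto
  also have "\<dots> = (\<epsilon> * D ^ 16) * 3" by simp
  also have "\<dots> \<le> (\<epsilon> * D ^ 16) * D\<^sup>2"
    using eps0 D_ge1 power_mono[OF D2, of 2] by (intro mult_left_mono) auto
  also have "\<dots> = \<delta>" by (simp add: power_add[symmetric] mult.assoc)
  finally show ?thesis using jn(1) by (simp add: near_def)
qed

text \<open>\<open>Q1 \<union> Q2\<close> is padded to a set \<open>K\<close> of \<open>kC\<close>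
  indices. An index outside \<open>Q1 \<inter> Q2\<close> is missing from \<open>Q1\<close> or from
  \<open>Q2\<close>, so removing it from \<open>K\<close> leaves a hyperplane whose index set
  contains one of the two.\<close>

lemma near_inter:
  assumes "Q1 \<subseteq> {..<R}" "Q2 \<subseteq> {..<R}" "card (Q1 \<union> Q2) \<le> kC" "card Q1 < kC" "card Q2 < kC"
    "j \<in> near \<delta> Q1" "j \<in> near \<delta> Q2"
  shows "j \<in> near \<delta> (Q1 \<inter> Q2)"
proof -
  have fin: "finite (Q1 \<union> Q2)" using assms finite_subset by blast
  have "kC - card (Q1 \<union> Q2) \<le> card ({..<R} - (Q1 \<union> Q2))"
    using fin assms(1,2) kC by (subst card_Diff_subset) auto
  then obtain Y where Y: "Y \<subseteq> {..<R} - (Q1 \<union> Q2)" "card Y = kC - card (Q1 \<union> Q2)"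
    using obtain_subset_with_card_n by metis
  define K where "K = Q1 \<union> Q2 \<union> Y"
  have K: "K \<subseteq> {..<R}" using Y assms by (auto simp: K_def)
  have cK: "card K = kC"
    unfolding K_def using Y fin assms(3) by (subst card_Un_disjoint) (auto intro: finite_subset[OF Y(1)])
  have Q: "Q1 \<inter> Q2 \<subset> K"
  proof
    show "Q1 \<inter> Q2 \<subseteq> K" by (auto simp: K_def)
    have "card (Q1 \<inter> Q2) \<le> card Q1" using fin by (intro card_mono) auto
    then show "Q1 \<inter> Q2 \<noteq> K" using cK assms by auto
  qed
  show ?thesis
  proof (rule near_intersection_hyperplanes[OF K cK Q])
    fix i assume i: "i \<in> K - Q1 \<inter> Q2"
    then have "Q1 \<subseteq> K - {i} \<or> Q2 \<subseteq> K - {i}" by (auto simp: K_def)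
    then show "j \<in> near \<delta> (K - {i})"
      using near_subset_mono[of _ "K - {i}" \<delta>] assms K by (meson Diff_subset subset_iff subset_trans)
  qed
qed

text \<open>Descent from hyperplanes to smaller spans: the sets of columns gained by the different one-element
  extensions of \<open>Q\<close> are disjoint, and counting them leaves no room for a deficit.\<close>

lemma card_near:
  assumes "Q \<subseteq> {..<R}" "card Q < kC"
  shows "card (near \<delta> Q) = card Q"
  using assms
proof (induction "kC - card Q" arbitrary: Q rule: less_induct)
  case less
  have finQ: "finite Q" using less.prems finite_subset by blast
  show ?case
  proof (cases "card Q = kC - 1")
    case True
    then show ?thesis using near_hyperplane(2)[OF less.prems(1) True \<delta>_bounds(1,2)] by simp
  next
    case False
    then have s: "card Q + 2 \<le> kC" using less.prems by linarith
    define t where "t = card (near \<delta> Q)"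
    have t: "t \<le> card Q" unfolding t_def by (rule card_near_le[OF less.prems \<delta>_bounds(2)])
    define X where "X = {..<R} - Q"
    have cX: "card X = R - card Q" using finQ less.prems by (simp add: X_def card_Diff_subset)
    define P where "P i = near \<delta> (insert i Q) - near \<delta> Q" for i
    have cP: "card (P i) = card Q + 1 - t" if "i \<in> X" for i
    proof -
      have i: "i \<notin> Q" "i < R" using that by (auto simp: X_def)
      have "card (near \<delta> (insert i Q)) = card (insert i Q)"
        using less.prems i finQ s by (intro less.hyps) auto
      moreover have "near \<delta> Q \<subseteq> near \<delta> (insert i Q)"
        using less.prems i by (intro near_subset_mono) auto
      ultimately show ?thesis using i finQ by (simp add: P_def card_Diff_subset finite_near t_def)
    qed
    have disj: "P i \<inter> P i' = {}" if "i \<in> X" "i' \<in> X" "i \<noteq> i'" for i i'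
    proof (rule ccontr)
      assume "P i \<inter> P i' \<noteq> {}"
      then obtain j where j: "j \<in> near \<delta> (insert i Q)" "j \<in> near \<delta> (insert i' Q)" "j \<notin> near \<delta> Q"
        by (auto simp: P_def)
      have "insert i Q \<union> insert i' Q = insert i (insert i' Q)" by auto
      then have c: "card (insert i Q \<union> insert i' Q) \<le> kC"
        using finQ s that by (auto simp: X_def)
      have "insert i Q \<inter> insert i' Q = Q" using that by (auto simp: X_def)
      moreover have "j \<in> near \<delta> (insert i Q \<inter> insert i' Q)"
        using j c less.prems that finQ s by (intro near_inter) (auto simp: X_def)
      ultimately show False using j by simp
    qed
    have "card X * (card Q + 1 - t) = (\<Sum>i\<in>X. card (P i))" using cP by simp
    also have "\<dots> = card (\<Union>i\<in>X. P i)"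
      by (rule card_UN_disjoint[symmetric]) (use disj in \<open>auto simp: X_def P_def finite_near\<close>)
    also have "\<dots> \<le> card ({..<R} - near \<delta> Q)" by (rule card_mono) (auto simp: P_def near_def)
    also have "\<dots> = R - t"
      using finite_near by (subst card_Diff_subset) (auto simp: t_def near_def)
    finally have count: "(R - card Q) * (card Q + 1 - t) \<le> R - t" by (simp add: cX)
    have "t = card Q"
    proof (rule ccontr)
      assume "t \<noteq> card Q"
      then obtain d where d: "card Q = t + d" "d \<ge> 1" using t by (metis le_Suc_ex less_one linorder_not_le nat_neq_iff add_0_right)
      obtain m where m: "R = card Q + m" "m \<ge> 2" using s kC by (metis add_le_cancel_left le_trans le_Suc_ex add_leD1)
      \<comment> \<open>With deficit \<open>d\<close> and \<open>m\<close> indices outside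
        \<open>Q\<close> the count says \<open>m * d \<le> d\<close>. It is contradictory because
        \<open>card Q + 2 \<le> kC \<le> R\<close> gives \<open>m \<ge> 2\<close>.\<close>
      have "m * (d + 1) \<le> d + m" using count d m by simp
      then have "m * d \<le> d" by simp
      moreover have "2 * d \<le> m * d" using m by (intro mult_right_mono) auto
      ultimately show False using d by linarith
    qed
    then show ?thesis by (simp add: t_def)
  qed
qed

text \<open>For the span of one column the near set is a singleton, which is the match. Two indices
  with the same match would put that column near the span of the empty set, but nothing is near
  that.\<close>

lemma matching:
  obtains \<pi> where "inj_on \<pi> {..<R}" "\<pi> ` {..<R} \<subseteq> {..<R}"
    "\<And>i. i < R \<Longrightarrow> \<exists>\<beta>. norm (c (\<pi> i) - \<beta> *\<^sub>R c' i) \<le> \<delta>"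
proof -
  have "\<exists>j. near \<delta> {i} = {j}" if "i < R" for i
    using card_near[of "{i}"] that kC by (simp add: card_1_singleton_iff)
  then obtain \<pi> where \<pi>: "\<And>i. i < R \<Longrightarrow> near \<delta> {i} = {\<pi> i}" by metis
  show ?thesis
  proof (rule that)
    show "\<pi> ` {..<R} \<subseteq> {..<R}" using \<pi> by (auto simp: near_def)
    show "inj_on \<pi> {..<R}"
    proof (rule inj_onI, rule ccontr)
      fix i i' assume i: "i \<in> {..<R}" "i' \<in> {..<R}" "\<pi> i = \<pi> i'" "i \<noteq> i'"
      then have "\<pi> i \<in> near \<delta> ({i} \<inter> {i'})" using \<pi> kC by (intro near_inter) auto
      moreover have "card (near \<delta> {}) = 0" using card_near[of "{}"] kC by simp
      ultimately show False using i finite_near by auto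
    qed
    show "\<exists>\<beta>. norm (c (\<pi> i) - \<beta> *\<^sub>R c' i) \<le> \<delta>" if "i < R" for i
    proof -
      obtain \<beta> where "residual c' {i} (c (\<pi> i)) = c (\<pi> i) - (\<Sum>t\<in>{i}. \<beta> t *\<^sub>R c' t)"
        using residual_combination by blast
      moreover have "\<pi> i \<in> near \<delta> {i}" using \<pi>[OF that] by simp
      ultimately show ?thesis by (auto simp: near_def)
    qed
  qed
qed

end

section \<open>Agreement of the three matchings\<close>

text \<open>All of \<open>x\<close> except a part of length \<open>\<eta>\<close> is carried by the
  multiple of \<open>y\<close>, and \<open>x\<close> is not short, so the scalar cannot be small.
  This allows a match to be inverted.\<close>

lemma match_scale_bound:
  fixes x y :: "'a::real_inner"
  assumes D: "2 \<le> D" and x: "1 \<le> D * norm x" and y: "norm y \<le> D"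
    and xy: "norm (x - \<beta> *\<^sub>R y) \<le> \<eta>" and \<eta>: "\<eta> * D\<^sup>2 < 1"
  shows "1 \<le> D ^ 3 * \<bar>\<beta>\<bar>"
proof -
  have "norm x \<le> norm (\<beta> *\<^sub>R y) + \<eta>" using norm_triangle_sub[of x "\<beta> *\<^sub>R y"] xy by linarith
  also have "norm (\<beta> *\<^sub>R y) \<le> \<bar>\<beta>\<bar> * D" using y by (simp add: mult_left_mono)
  finally have "D * norm x \<le> D * (\<bar>\<beta>\<bar> * D + \<eta>)" using D by (intro mult_left_mono) auto
  with x have 1: "1 \<le> D\<^sup>2 * \<bar>\<beta>\<bar> + D * \<eta>" by (simp add: algebra_simps power2_eq_square)
  have "0 \<le> \<eta>" using xy norm_ge_zero order_trans by blast
  then have "2 * (D * \<eta>) \<le> D * (D * \<eta>)" using D by (intro mult_right_mono) auto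
  then have "2 * (D * \<eta>) < 1" using \<eta> by (simp add: power2_eq_square mult_ac)
  with 1 have "1 \<le> 2 * (D\<^sup>2 * \<bar>\<beta>\<bar>)" by linarith
  also have "\<dots> \<le> D * (D\<^sup>2 * \<bar>\<beta>\<bar>)" using D by (intro mult_right_mono) auto
  finally show ?thesis by (simp add: power_numeral_reduce mult_ac)
qed

text \<open>Up to the error, \<open>y\<close> is \<open>x\<close> divided by \<open>\<beta>\<close>.
  Hence a vector that annihilates an unprimed column almost annihilates every primed column matched
  to it.\<close>

lemma match_orthogonal_bound:
  fixes x y :: "'a::real_inner"
  assumes D: "2 \<le> D" and x: "1 \<le> D * norm x" and y: "norm y \<le> D"
    and xy: "norm (x - \<beta> *\<^sub>R y) \<le> \<eta>" and \<eta>: "\<eta> * D\<^sup>2 < 1"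
    and w: "inner x w = 0" "norm w \<le> D"
  shows "\<bar>inner y w\<bar> \<le> D ^ 4 * \<eta>"
proof -
  have \<eta>0: "0 \<le> \<eta>" using xy norm_ge_zero order_trans by blast
  have "\<bar>inner y w\<bar> \<le> (D ^ 3 * \<bar>\<beta>\<bar>) * \<bar>inner y w\<bar>"
    using match_scale_bound[OF D x y xy \<eta>] mult_right_mono[of 1 "D ^ 3 * \<bar>\<beta>\<bar>" "\<bar>inner y w\<bar>"] by simp
  also have "\<dots> = D ^ 3 * \<bar>inner (x - \<beta> *\<^sub>R y) w\<bar>"
    using w by (simp add: inner_diff_left abs_mult)
  also have "\<dots> \<le> D ^ 3 * (norm (x - \<beta> *\<^sub>R y) * norm w)"
    using D by (intro mult_left_mono Cauchy_Schwarz_ineq2) auto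
  also have "\<dots> \<le> D ^ 3 * (\<eta> * D)" using D xy w \<eta>0 by (intro mult_left_mono mult_mono) auto
  finally show ?thesis by (simp add: power_numeral_reduce mult_ac)
qed

lemma robust_duals_norm:
  assumes "robust_duals R k D x" "1 \<le> k" "r < R"
  shows "1 \<le> D * norm (x r)"
proof -
  obtain w where w: "norm w \<le> D" "inner (x r) w = 1"
    using robust_dualsE[OF assms(1), of "{r}" r] assms by auto
  have "1 \<le> norm (x r) * norm w" using norm_cauchy_schwarz[of "x r" w] w by simp
  also have "\<dots> \<le> norm (x r) * D" using w by (intro mult_left_mono) auto
  finally show ?thesis by (simp add: mult.commute)
qed

section \<open>Zero sets that separate conflicting matchings\<close>

text \<open>\<open>A\<close>, \<open>B\<close> and \<open>C\<close> will be zero sets of vectors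
  dual at \<open>q\<close>, so they must avoid \<open>q\<close>; the index \<open>m\<close> with
  \<open>\<pi> m = q\<close> can then not be covered by \<open>C\<close>. It is covered by placing
  \<open>\<sigma> m\<close> in \<open>A\<close>. After \<open>B\<close> has taken the remaining
  columns other than \<open>q\<close>, at most \<open>R - kA\<close> indices are left, and
  \<open>C\<close> is the set of their images.\<close>

lemma covering_sets_aux:
  fixes \<sigma> \<rho> \<pi> :: "nat \<Rightarrow> nat"
  assumes \<sigma>: "inj_on \<sigma> {..<R}" "\<sigma> ` {..<R} \<subseteq> {..<R}"
    and \<pi>: "inj_on \<pi> {..<R}" "\<pi> ` {..<R} \<subseteq> {..<R}"
    and m: "m < R" "\<pi> m = q" "\<sigma> m \<noteq> q" and q: "q < R"
    and kA: "1 \<le> kA" "kA \<le> R - 1" and s: "R \<le> kA + kB" "R \<le> kA + kC"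
  shows "\<exists>A B C. A \<subseteq> {..<R} - {q} \<and> B \<subseteq> {..<R} - {q} \<and> C \<subseteq> {..<R} - {q} \<and>
    card A \<le> kA \<and> card B \<le> kB \<and> card C \<le> kC \<and> {..<R} - {q} \<subseteq> A \<union> B \<union> C \<and>
    (\<forall>i<R. \<sigma> i \<in> A \<or> \<rho> i \<in> B \<or> \<pi> i \<in> C)"
proof -
  have "\<sigma> m < R" using \<sigma> m by auto
  have "card ({..<R} - {q, \<sigma> m}) = R - 2"
    using q m \<open>\<sigma> m < R\<close> by (subst card_Diff_subset) auto
  then have "kA - 1 \<le> card ({..<R} - {q, \<sigma> m})" using kA by simp
  then obtain Y where Y: "Y \<subseteq> {..<R} - {q, \<sigma> m}" "card Y = kA - 1" "finite Y"
    using obtain_subset_with_card_n by metis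
  define A where "A = insert (\<sigma> m) Y"
  define B where "B = {..<R} - {q} - A"
  define U where "U = {i. i < R \<and> \<sigma> i \<notin> A \<and> \<rho> i \<notin> B}"
  have A: "A \<subseteq> {..<R} - {q}" "finite A" using Y m \<open>\<sigma> m < R\<close> by (auto simp: A_def)
  have "\<sigma> m \<notin> Y" using Y by auto
  then have cA: "card A = kA" using Y kA by (simp add: A_def)
  have "card B = R - 1 - kA" unfolding B_def using A q cA by (subst card_Diff_subset) auto
  then have cB: "card B \<le> kB" using s by simp
  have "card U \<le> card ({..<R} - A)"
    by (rule card_inj_on_le[of \<sigma>]) (use \<sigma> in \<open>auto simp: U_def intro: inj_on_subset\<close>)
  also have "\<dots> = R - kA" using A cA by (subst card_Diff_subset) auto
  finally have cU: "card (\<pi> ` U) \<le> kC" using s card_image_le[of U \<pi>] by (simp add: U_def)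
  have "q \<notin> \<pi> ` U"
  proof
    assume "q \<in> \<pi> ` U"
    then obtain i where i: "i \<in> U" "\<pi> i = \<pi> m" using m by auto
    then have "i = m" using \<pi>(1) m by (auto simp: inj_on_def U_def)
    then show False using i by (auto simp: U_def A_def)
  qed
  then have "\<pi> ` U \<subseteq> {..<R} - {q}" using \<pi> by (auto simp: U_def)
  then show ?thesis using A cA cB cU
    by (intro exI[of _ A] exI[of _ B] exI[of _ "\<pi> ` U"]) (auto simp: B_def U_def)
qed

text \<open>As each size is at most \<open>R - 1\<close>, the bound on the sum makes any two sizes
  add up to at least \<open>R\<close>. At the index that \<open>\<pi>\<close> sends to
  \<open>q\<close>, one of \<open>\<sigma>\<close> and \<open>\<rho>\<close> has another value, and
  either of them can play the part of the first map in the construction.\<close>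

lemma covering_sets:
  fixes \<sigma> \<rho> \<pi> :: "nat \<Rightarrow> nat"
  assumes \<sigma>: "inj_on \<sigma> {..<R}" "\<sigma> ` {..<R} \<subseteq> {..<R}"
    and \<rho>: "inj_on \<rho> {..<R}" "\<rho> ` {..<R} \<subseteq> {..<R}"
    and \<pi>: "inj_on \<pi> {..<R}" "\<pi> ` {..<R} \<subseteq> {..<R}"
    and q: "q < R" and no: "\<And>i. i < R \<Longrightarrow> \<not> (\<sigma> i = q \<and> \<rho> i = q \<and> \<pi> i = q)"
    and k: "1 \<le> kA" "kA \<le> R - 1" "1 \<le> kB" "kB \<le> R - 1" "kC \<le> R - 1"
      "2 * R - 1 \<le> kA + kB + kC"
  obtains A B C where "A \<subseteq> {..<R} - {q}" "B \<subseteq> {..<R} - {q}" "C \<subseteq> {..<R} - {q}"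
    "card A \<le> kA" "card B \<le> kB" "card C \<le> kC" "{..<R} - {q} \<subseteq> A \<union> B \<union> C"
    "\<And>i. i < R \<Longrightarrow> \<sigma> i \<in> A \<or> \<rho> i \<in> B \<or> \<pi> i \<in> C"
proof -
  have "\<pi> ` {..<R} = {..<R}" using endo_inj_surj[OF _ \<pi>(2,1)] by simp
  then obtain m where m: "m < R" "\<pi> m = q" using q by (metis imageE lessThan_iff)
  have s: "R \<le> kA + kB" "R \<le> kA + kC" "R \<le> kB + kC" using k q by linarith+
  show ?thesis
  proof (cases "\<sigma> m = q")
    case False
    show ?thesis using covering_sets_aux[OF \<sigma> \<pi> m False q k(1,2) s(1,2), of \<rho>] that by metis
  next
    case True
    then have "\<rho> m \<noteq> q" using no m by blast
    from covering_sets_aux[OF \<rho> \<pi> m this q k(3,4) _ s(3), of kA \<sigma>] s(1)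
    obtain A B C where "A \<subseteq> {..<R} - {q}" "B \<subseteq> {..<R} - {q}" "C \<subseteq> {..<R} - {q}"
      "card A \<le> kB" "card B \<le> kA" "card C \<le> kC" "{..<R} - {q} \<subseteq> A \<union> B \<union> C"
      "\<forall>i<R. \<rho> i \<in> A \<or> \<sigma> i \<in> B \<or> \<pi> i \<in> C" by (auto simp: add.commute)
    then show ?thesis using that[of B A C] by blast
  qed
qed

context close_decompositions
begin

lemma common_matching:
  obtains \<pi> where "inj_on \<pi> {..<R}" "\<pi> ` {..<R} \<subseteq> {..<R}"
    "\<And>i. i < R \<Longrightarrow> \<exists>\<beta>. norm (a (\<pi> i) - \<beta> *\<^sub>R a' i) \<le> \<delta>"
    "\<And>i. i < R \<Longrightarrow> \<exists>\<beta>. norm (b (\<pi> i) - \<beta> *\<^sub>R b' i) \<le> \<delta>"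
    "\<And>i. i < R \<Longrightarrow> \<exists>\<beta>. norm (c (\<pi> i) - \<beta> *\<^sub>R c' i) \<le> \<delta>"
proof -
  \<comment> \<open>The matching was found for the third mode; rotating the modes cyclically
    supplies the other two.\<close>
  interpret A: close_decompositions R kB kC kA D \<epsilon> b b' c c' a a'
  proof (unfold_locales)
    fix u v w
    show "\<bar>(\<Sum>r<R. inner (b r) u * inner (c r) v * inner (a r) w) -
        (\<Sum>r<R. inner (b' r) u * inner (c' r) v * inner (a' r) w)\<bar> \<le> \<epsilon> * (norm u * norm v * norm w)"
      using close[of w u v] by (simp add: mult_ac)
  qed (use D2 RD eps0 eps_small kA kB kC k_sum dual_a dual_b dual_c bnd_a bnd_b bnd_c in auto)
  interpret B: close_decompositions R kC kA kB D \<epsilon> c c' a a' b b'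
  proof (unfold_locales)
    fix u v w
    show "\<bar>(\<Sum>r<R. inner (c r) u * inner (a r) v * inner (b r) w) -
        (\<Sum>r<R. inner (c' r) u * inner (a' r) v * inner (b' r) w)\<bar> \<le> \<epsilon> * (norm u * norm v * norm w)"
      using close[of v w u] by (simp add: mult_ac)
  qed (use D2 RD eps0 eps_small kA kB kC k_sum dual_a dual_b dual_c bnd_a bnd_b bnd_c in auto)
  obtain \<sigma> where \<sigma>: "inj_on \<sigma> {..<R}" "\<sigma> ` {..<R} \<subseteq> {..<R}"
    and \<sigma>m: "\<And>i. i < R \<Longrightarrow> \<exists>\<beta>. norm (a (\<sigma> i) - \<beta> *\<^sub>R a' i) \<le> \<delta>" using A.matching by blast
  obtain \<rho> where \<rho>: "inj_on \<rho> {..<R}" "\<rho> ` {..<R} \<subseteq> {..<R}"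
    and \<rho>m: "\<And>i. i < R \<Longrightarrow> \<exists>\<beta>. norm (b (\<rho> i) - \<beta> *\<^sub>R b' i) \<le> \<delta>" using B.matching by blast
  obtain \<pi> where \<pi>: "inj_on \<pi> {..<R}" "\<pi> ` {..<R} \<subseteq> {..<R}"
    and \<pi>m: "\<And>i. i < R \<Longrightarrow> \<exists>\<beta>. norm (c (\<pi> i) - \<beta> *\<^sub>R c' i) \<le> \<delta>" using matching by blast
  have agree: "\<exists>i<R. \<sigma> i = q \<and> \<rho> i = q \<and> \<pi> i = q" if q: "q < R" for q
  proof (rule ccontr)
    assume "\<not> ?thesis"
    then have no: "\<And>i. i < R \<Longrightarrow> \<not> (\<sigma> i = q \<and> \<rho> i = q \<and> \<pi> i = q)" by blast
    \<comment> \<open>Each rank is lowered by one because a dual vector uses up one column for the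
      value 1 at \<open>q\<close>.\<close>
    have caps: "1 \<le> kA - 1" "kA - 1 \<le> R - 1" "1 \<le> kB - 1" "kB - 1 \<le> R - 1" "kC - 1 \<le> R - 1"
      "2 * R - 1 \<le> (kA - 1) + (kB - 1) + (kC - 1)" using kA kB kC k_sum by linarith+
    obtain PA PB PC where P: "PA \<subseteq> {..<R} - {q}" "PB \<subseteq> {..<R} - {q}" "PC \<subseteq> {..<R} - {q}"
      "card PA \<le> kA - 1" "card PB \<le> kB - 1" "card PC \<le> kC - 1" "{..<R} - {q} \<subseteq> PA \<union> PB \<union> PC"
      and cov: "\<And>i. i < R \<Longrightarrow> \<sigma> i \<in> PA \<or> \<rho> i \<in> PB \<or> \<pi> i \<in> PC"
      using covering_sets[OF \<sigma> \<rho> \<pi> q no caps] by blast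
    have "card (insert q X) \<le> k" if "card X \<le> k - 1" "2 \<le> k" for X :: "nat set" and k
      using that card_insert_le_m1[of k X q] by auto
    then have ins: "insert q PA \<subseteq> {..<R}" "card (insert q PA) \<le> kA" "insert q PB \<subseteq> {..<R}"
      "card (insert q PB) \<le> kB" "insert q PC \<subseteq> {..<R}" "card (insert q PC) \<le> kC"
      using P q kA kB kC by auto
    obtain u where u: "norm u \<le> D" "inner (a q) u = 1"
      "\<And>s. s \<in> insert q PA \<Longrightarrow> s \<noteq> q \<Longrightarrow> inner (a s) u = 0"
      using robust_dualsE[OF dual_a ins(1,2) insertI1] by blast
    obtain v where v: "norm v \<le> D" "inner (b q) v = 1"
      "\<And>s. s \<in> insert q PB \<Longrightarrow> s \<noteq> q \<Longrightarrow> inner (b s) v = 0"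
      using robust_dualsE[OF dual_b ins(3,4) insertI1] by blast
    obtain w where w: "norm w \<le> D" "inner (c q) w = 1"
      "\<And>s. s \<in> insert q PC \<Longrightarrow> s \<noteq> q \<Longrightarrow> inner (c s) w = 0"
      using robust_dualsE[OF dual_c ins(5,6) insertI1] by blast
    have "(\<Sum>r<R. inner (a r) u * inner (b r) v * inner (c r) w) = (\<Sum>r<R. if r = q then 1 else 0)"
    proof (rule sum.cong)
      fix r assume "r \<in> {..<R}"
      then show "inner (a r) u * inner (b r) v * inner (c r) w = (if r = q then 1 else 0)"
        using u v w P(7) by (cases "r = q") auto
    qed simp
    then have lhs: "(\<Sum>r<R. inner (a r) u * inner (b r) v * inner (c r) w) = 1" using q by simp
    have le: "D ^ 4 * \<delta> \<le> D\<^sup>2"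
    proof -
      have "\<epsilon> * D ^ 22 \<le> 1" using eps_power[of 22] by simp
      also have "1 \<le> D\<^sup>2" using D_ge1 by simp
      finally show ?thesis by (simp add: power_add[symmetric] mult.left_commute)
    qed
    have bound: "\<bar>inner (a' i) u * inner (b' i) v * inner (c' i) w\<bar> \<le> D ^ 4 * \<delta> * D\<^sup>2 * D\<^sup>2" if i: "i < R" for i
    proof -
      have nn: "0 \<le> D ^ 4 * \<delta>" using \<delta>_bounds D_ge1 by simp
      have ga: "\<bar>inner (a' i) u\<bar> \<le> D\<^sup>2" by (rule order_trans[OF Cauchy_Schwarz_ineq2])
          (use bnd_a[OF i] u D_ge1 in \<open>auto simp: power2_eq_square intro!: mult_mono\<close>)
      have gb: "\<bar>inner (b' i) v\<bar> \<le> D\<^sup>2" by (rule order_trans[OF Cauchy_Schwarz_ineq2])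
          (use bnd_b[OF i] v D_ge1 in \<open>auto simp: power2_eq_square intro!: mult_mono\<close>)
      have gc: "\<bar>inner (c' i) w\<bar> \<le> D\<^sup>2" by (rule order_trans[OF Cauchy_Schwarz_ineq2])
          (use bnd_c[OF i] w D_ge1 in \<open>auto simp: power2_eq_square intro!: mult_mono\<close>)
      consider "\<sigma> i \<in> PA" | "\<rho> i \<in> PB" | "\<pi> i \<in> PC" using cov[OF i] by blast
      then show ?thesis
      proof cases
        case 1
        obtain \<beta> where \<beta>: "norm (a (\<sigma> i) - \<beta> *\<^sub>R a' i) \<le> \<delta>" using \<sigma>m[OF i] by blast
        have "\<sigma> i < R" using \<sigma> i by auto
        then have "\<bar>inner (a' i) u\<bar> \<le> D ^ 4 * \<delta>"
          using 1 P u(3)[of "\<sigma> i"] robust_duals_norm[OF dual_a] kA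
          by (intro match_orthogonal_bound[OF D2 _ bnd_a[OF i] \<beta> \<delta>_bounds(2) _ u(1)]) auto
        then have "\<bar>inner (a' i) u\<bar> * \<bar>inner (b' i) v\<bar> * \<bar>inner (c' i) w\<bar> \<le> (D ^ 4 * \<delta>) * D\<^sup>2 * D\<^sup>2"
          using gb gc nn by (intro mult_mono) auto
        then show ?thesis by (simp add: abs_mult)
      next
        case 2
        obtain \<beta> where \<beta>: "norm (b (\<rho> i) - \<beta> *\<^sub>R b' i) \<le> \<delta>" using \<rho>m[OF i] by blast
        have "\<rho> i < R" using \<rho> i by auto
        then have "\<bar>inner (b' i) v\<bar> \<le> D ^ 4 * \<delta>"
          using 2 P v(3)[of "\<rho> i"] robust_duals_norm[OF dual_b] kB
          by (intro match_orthogonal_bound[OF D2 _ bnd_b[OF i] \<beta> \<delta>_bounds(2) _ v(1)]) auto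
        then have "\<bar>inner (b' i) v\<bar> * \<bar>inner (a' i) u\<bar> * \<bar>inner (c' i) w\<bar> \<le> (D ^ 4 * \<delta>) * D\<^sup>2 * D\<^sup>2"
          using ga gc nn by (intro mult_mono) auto
        then show ?thesis by (simp add: abs_mult mult_ac)
      next
        case 3
        obtain \<beta> where \<beta>: "norm (c (\<pi> i) - \<beta> *\<^sub>R c' i) \<le> \<delta>" using \<pi>m[OF i] by blast
        have "\<pi> i < R" using \<pi> i by auto
        then have "\<bar>inner (c' i) w\<bar> \<le> D ^ 4 * \<delta>"
          using 3 P w(3)[of "\<pi> i"] robust_duals_norm[OF dual_c] kC
          by (intro match_orthogonal_bound[OF D2 _ bnd_c[OF i] \<beta> \<delta>_bounds(2) _ w(1)]) auto
        then have "\<bar>inner (c' i) w\<bar> * \<bar>inner (a' i) u\<bar> * \<bar>inner (b' i) v\<bar> \<le> (D ^ 4 * \<delta>) * D\<^sup>2 * D\<^sup>2"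
          using ga gb nn by (intro mult_mono) auto
        then show ?thesis by (simp add: abs_mult mult_ac)
      qed
    qed
    have "\<bar>\<Sum>r<R. inner (a' r) u * inner (b' r) v * inner (c' r) w\<bar> \<le> (\<Sum>r<R. D ^ 4 * \<delta> * D\<^sup>2 * D\<^sup>2)"
      by (rule order_trans[OF sum_abs]) (rule sum_mono, use bound in auto)
    also have "\<dots> = real R * (D ^ 4 * \<delta> * D\<^sup>2 * D\<^sup>2)" by simp
    also have "\<dots> \<le> D * (D ^ 4 * \<delta> * D\<^sup>2 * D\<^sup>2)"
      using RD \<delta>_bounds D_ge1 by (intro mult_right_mono) auto
    \<comment> \<open>The almost annihilated factor accounts for 22 of the exponent, the other two
      factors for 2 each, and the number of terms for 1.\<close>
    also have "\<dots> = \<epsilon> * D ^ 27" by (simp add: power_numeral_reduce mult_ac)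
    finally have rhs: "\<bar>\<Sum>r<R. inner (a' r) u * inner (b' r) v * inner (c' r) w\<bar> \<le> \<epsilon> * D ^ 27" .
    have "\<epsilon> * (norm u * norm v * norm w) \<le> \<epsilon> * (D * D * D)"
      using u v w D_ge1 eps0 by (intro mult_left_mono mult_mono) auto
    also have "\<dots> = \<epsilon> * D ^ 3" by (simp add: power_numeral_reduce)
    also have "\<dots> \<le> \<epsilon> * D ^ 27" using eps0 D_ge1 by (intro mult_left_mono power_increasing) auto
    finally have "1 \<le> 2 * (\<epsilon> * D ^ 27)" using close[of u v w] rhs lhs by linarith
    also have "\<dots> \<le> D * (\<epsilon> * D ^ 27)" using D2 eps0 D_ge1 by (intro mult_right_mono) auto
    also have "\<dots> = \<epsilon> * D ^ 28" by (simp add: power_numeral_reduce mult_ac)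
    also have "\<dots> < 1" by (rule eps_power) simp
    finally show False by simp
  qed
  \<comment> \<open>An index sent to \<open>\<pi> i\<close> by all three maps exists, and by
    injectivity of \<open>\<pi>\<close> it can only be \<open>i\<close>.\<close>
  have eq: "\<sigma> i = \<pi> i \<and> \<rho> i = \<pi> i" if i: "i < R" for i
  proof -
    have "\<pi> i < R" using \<pi> i by auto
    from agree[OF this] obtain m where "m < R" "\<sigma> m = \<pi> i" "\<rho> m = \<pi> i" "\<pi> m = \<pi> i" by blast
    moreover from this have "m = i" using \<pi> i by (auto simp: inj_on_def)
    ultimately show ?thesis by simp
  qed
  show ?thesis by (rule that[OF \<pi>]) (use \<sigma>m \<rho>m \<pi>m eq in auto)
qed

end

section \<open>Finitely supported vectors and their tensor products\<close>

text \<open>A single inner product space holds vectors of every dimension and, with the index pairing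
  \<open>prod_encode\<close>, tensors of every order.\<close>

typedef fvec = "{f :: nat \<Rightarrow> real. finite {i. f i \<noteq> 0}}"
  morphisms entry Abs_fvec by (rule exI[of _ "\<lambda>_. 0"]) simp

setup_lifting type_definition_fvec

lemma finite_support: "finite {i. entry x i \<noteq> 0}"
  using entry[of x] by simp

lemma fvec_eqI: "(\<And>i. entry x i = entry y i) \<Longrightarrow> x = y"
  by (simp add: entry_inject[symmetric] fun_eq_iff)

instantiation fvec :: real_vector
begin

lift_definition zero_fvec :: fvec is "\<lambda>_. 0" by simp
lift_definition plus_fvec :: "fvec \<Rightarrow> fvec \<Rightarrow> fvec" is "\<lambda>f g i. f i + g i"
  by (erule (1) finite_subset[rotated, OF finite_UnI]) auto
lift_definition minus_fvec :: "fvec \<Rightarrow> fvec \<Rightarrow> fvec" is "\<lambda>f g i. f i - g i"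
  by (erule (1) finite_subset[rotated, OF finite_UnI]) auto
lift_definition uminus_fvec :: "fvec \<Rightarrow> fvec" is "\<lambda>f i. - f i" by simp
lift_definition scaleR_fvec :: "real \<Rightarrow> fvec \<Rightarrow> fvec" is "\<lambda>c f i. c * f i"
  by (erule finite_subset[rotated]) auto

instance
  by standard (transfer; simp add: algebra_simps)+

end

instantiation fvec :: real_normed_vector
begin

definition norm_fvec :: "fvec \<Rightarrow> real" where "norm x = L2_set (entry x) {i. entry x i \<noteq> 0}"
definition sgn_fvec :: "fvec \<Rightarrow> fvec" where "sgn (x::fvec) = inverse (norm x) *\<^sub>R x"
definition dist_fvec :: "fvec \<Rightarrow> fvec \<Rightarrow> real" where "dist (x::fvec) y = norm (x - y)"
definition uniformity_fvec :: "(fvec \<times> fvec) filter" where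
  "uniformity = (INF e\<in>{0<..}. principal {(x::fvec, y). dist x y < e})"
definition open_fvec :: "fvec set \<Rightarrow> bool" where
  "open (U::fvec set) \<longleftrightarrow> (\<forall>x\<in>U. \<forall>\<^sub>F (x', y) in uniformity. x' = x \<longrightarrow> y \<in> U)"

lemma norm_fvec_eq:
  assumes "finite I" "{i. entry x i \<noteq> 0} \<subseteq> I"
  shows "norm x = L2_set (entry x) I"
  unfolding norm_fvec_def L2_set_def using assms by (auto intro!: sum.mono_neutral_left)

instance
proof
  fix x y :: fvec and r :: real
  show "norm x = 0 \<longleftrightarrow> x = 0"
  proof
    assume "norm x = 0"
    then show "x = 0"
      by (intro fvec_eqI) (auto simp: norm_fvec_def L2_set_eq_0_iff finite_support zero_fvec.rep_eq)
  qed (simp add: norm_fvec_def zero_fvec.rep_eq)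
  define I where "I = {i. entry x i \<noteq> 0} \<union> {i. entry y i \<noteq> 0}"
  have I: "finite I" by (simp add: I_def finite_support)
  have "norm (x + y) = L2_set (\<lambda>i. entry x i + entry y i) I"
    by (subst norm_fvec_eq[OF I]) (auto simp: I_def plus_fvec.rep_eq)
  also have "\<dots> \<le> L2_set (entry x) I + L2_set (entry y) I" by (rule L2_set_triangle_ineq)
  also have "\<dots> = norm x + norm y" by (subst (1 2) norm_fvec_eq[OF I]) (auto simp: I_def)
  finally show "norm (x + y) \<le> norm x + norm y" .
  have "norm (r *\<^sub>R x) = L2_set (\<lambda>i. r * entry x i) I"
    by (subst norm_fvec_eq[OF I]) (auto simp: I_def scaleR_fvec.rep_eq)
  also have "\<dots> = \<bar>r\<bar> * L2_set (entry x) I"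
    by (simp add: L2_set_def power_mult_distrib real_sqrt_mult flip: sum_distrib_left)
  also have "L2_set (entry x) I = norm x" by (subst norm_fvec_eq[OF I]) (auto simp: I_def)
  finally show "norm (r *\<^sub>R x) = \<bar>r\<bar> * norm x" .
qed (fact sgn_fvec_def dist_fvec_def uniformity_fvec_def open_fvec_def)+

end

instantiation fvec :: real_inner
begin

definition inner_fvec :: "fvec \<Rightarrow> fvec \<Rightarrow> real" where
  "inner x y = (\<Sum>i | entry x i \<noteq> 0. entry x i * entry y i)"

lemma inner_fvec_eq:
  assumes "finite I" "{i. entry x i \<noteq> 0} \<inter> {i. entry y i \<noteq> 0} \<subseteq> I"
  shows "inner x y = (\<Sum>i\<in>I. entry x i * entry y i)"
proof -
  have "inner x y = (\<Sum>i\<in>{i. entry x i \<noteq> 0} \<inter> {i. entry y i \<noteq> 0}. entry x i * entry y i)"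
    unfolding inner_fvec_def by (rule sum.mono_neutral_right) (auto simp: finite_support)
  also have "\<dots> = (\<Sum>i\<in>I. entry x i * entry y i)"
    by (rule sum.mono_neutral_left) (use assms in auto)
  finally show ?thesis .
qed

instance
proof
  fix x y z :: fvec and r s :: real
  show "inner x y = inner y x"
    unfolding inner_fvec_eq[of "{i. entry x i \<noteq> 0}" x y, OF finite_support Int_lower1]
      inner_fvec_eq[of "{i. entry x i \<noteq> 0}" y x, OF finite_support Int_lower2]
    by (simp add: mult.commute)
  show "inner (x + y) z = inner x z + inner y z"
    unfolding inner_fvec_eq[of "{i. entry z i \<noteq> 0}" _ z, OF finite_support Int_lower2]
    by (simp add: plus_fvec.rep_eq algebra_simps sum.distrib)
  show "inner (r *\<^sub>R x) y = r * inner x y"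
    unfolding inner_fvec_eq[of "{i. entry y i \<noteq> 0}" _ y, OF finite_support Int_lower2]
    by (simp add: scaleR_fvec.rep_eq sum_distrib_left mult.assoc)
  show "0 \<le> inner x x" unfolding inner_fvec_def by (rule sum_nonneg) simp
  show norm: "norm x = sqrt (inner x x)"
    by (simp add: norm_fvec_def inner_fvec_def L2_set_def power2_eq_square)
  show "inner x x = 0 \<longleftrightarrow> x = 0"
    using norm norm_eq_zero[of x] by simp
qed

end

section \<open>Tensor products by pairing indices\<close>

lift_definition tens :: "fvec \<Rightarrow> fvec \<Rightarrow> fvec" is
  "\<lambda>f g m. f (fst (prod_decode m)) * g (snd (prod_decode m))"
proof -
  fix f g :: "nat \<Rightarrow> real"
  assume fin: "finite {i. f i \<noteq> 0}" "finite {i. g i \<noteq> 0}"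
  have "{m. f (fst (prod_decode m)) * g (snd (prod_decode m)) \<noteq> 0}
      \<subseteq> prod_encode ` ({i. f i \<noteq> 0} \<times> {i. g i \<noteq> 0})"
  proof
    fix m assume "m \<in> {m. f (fst (prod_decode m)) * g (snd (prod_decode m)) \<noteq> 0}"
    then show "m \<in> prod_encode ` ({i. f i \<noteq> 0} \<times> {i. g i \<noteq> 0})"
      by (intro image_eqI[of _ _ "prod_decode m"]) (auto simp: mem_Times_iff)
  qed
  then show "finite {m. f (fst (prod_decode m)) * g (snd (prod_decode m)) \<noteq> 0}"
    by (rule finite_subset) (use fin in simp)
qed

lemma inner_tens: "inner (tens x y) (tens u v) = inner x u * inner y v"
proof -
  define X where "X = {i. entry x i \<noteq> 0}"
  define Y where "Y = {i. entry y i \<noteq> 0}"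
  have fin: "finite X" "finite Y" by (auto simp: X_def Y_def finite_support)
  have sub: "{m. entry (tens x y) m \<noteq> 0} \<subseteq> prod_encode ` (X \<times> Y)"
  proof
    fix m assume "m \<in> {m. entry (tens x y) m \<noteq> 0}"
    then show "m \<in> prod_encode ` (X \<times> Y)"
      by (intro image_eqI[of _ _ "prod_decode m"]) (auto simp: mem_Times_iff tens.rep_eq X_def Y_def)
  qed
  have "inner (tens x y) (tens u v) = (\<Sum>m\<in>prod_encode ` (X \<times> Y). entry (tens x y) m * entry (tens u v) m)"
    by (rule inner_fvec_eq) (use fin sub in auto)
  also have "\<dots> = (\<Sum>(i, j)\<in>X \<times> Y. (entry x i * entry u i) * (entry y j * entry v j))"
    by (subst sum.reindex) (auto simp: inj_prod_encode tens.rep_eq intro!: sum.cong)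
  also have "\<dots> = inner x u * inner y v"
    unfolding sum.cartesian_product[symmetric] inner_fvec_def X_def Y_def
    by (simp add: sum_product)
  finally show ?thesis .
qed

lemma norm_tens: "norm (tens x y) = norm x * norm y"
  by (simp add: norm_eq_sqrt_inner inner_tens real_sqrt_mult)

lift_definition fvec_of :: "nat \<Rightarrow> (nat \<Rightarrow> real) \<Rightarrow> fvec" is "\<lambda>n f i. if i < n then f i else 0"
  by simp

lemma inner_fvec_of: "inner (fvec_of n f) (fvec_of n g) = (\<Sum>i<n. f i * g i)"
  by (subst inner_fvec_eq[of "{..<n}"]) (auto simp: fvec_of.rep_eq)

text \<open>Ranges with \<open>b \<le> a\<close> give a vector of norm 1, matching the empty
  product. The index pairing is not associative, so grouping the modes differently gives different
  vectors; their inner products agree nevertheless, and later arguments rely on those alone.\<close>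

primrec tens_range :: "(nat \<Rightarrow> fvec) \<Rightarrow> nat \<Rightarrow> nat \<Rightarrow> fvec" where
  "tens_range x a 0 = fvec_of 1 (\<lambda>_. 1)"
| "tens_range x a (Suc b) = (if a \<le> b then tens (tens_range x a b) (x b) else fvec_of 1 (\<lambda>_. 1))"

lemma inner_tens_range: "inner (tens_range x a b) (tens_range y a b) = (\<Prod>j=a..<b. inner (x j) (y j))"
  by (induction b) (auto simp: inner_tens inner_fvec_of prod.atLeastLessThan_Suc)

lemma norm_tens_range: "norm (tens_range x a b) = (\<Prod>j=a..<b. norm (x j))"
  by (induction b) (auto simp: norm_tens prod.atLeastLessThan_Suc norm_eq_sqrt_inner[of "fvec_of _ _"] inner_fvec_of)

section \<open>Kruskal rank and dual vectors\<close>

lemma map_poly_of_real_mult: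
  "map_poly of_real (p * q) = (map_poly of_real p * map_poly of_real q :: complex poly)"
proof -
  interpret h: map_poly_comm_ring_hom "of_real :: real \<Rightarrow> complex" ..
  show ?thesis by (rule h.hom_mult)
qed

text \<open>This determines the length of the list of singular values: \<open>proots\<close> sees
  real roots only, and the entry at \<open>k - 1\<close> is the smallest one only if there are
  \<open>k\<close> of them. By the fundamental theorem of algebra a linear factor with a real root
  can be split off, and the quotient is again real-rooted.\<close>

lemma size_proots_real_rooted:
  fixes p :: "real poly"
  assumes "p \<noteq> 0" "\<And>z :: complex. poly (map_poly of_real p) z = 0 \<Longrightarrow> z \<in> \<real>"
  shows "size (proots p) = degree p"
  using assms
proof (induction "degree p" arbitrary: p rule: less_induct)
  case less
  show ?case
  proof (cases "degree p = 0")
    case True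
    then show ?thesis using size_proots_le[of p] by simp
  next
    case False
    have "\<not> constant (poly (map_poly complex_of_real p))"
      using False by (simp add: constant_degree)
    then obtain z where z: "poly (map_poly complex_of_real p) z = 0"
      using fundamental_theorem_of_algebra by blast
    then obtain r where r: "z = complex_of_real r" using less.prems(2) Reals_cases by blast
    then have "poly p r = 0" using z by simp
    then obtain q where q: "p = [:-r, 1:] * q" using poly_eq_0_iff_dvd by (metis dvdE)
    have q0: "q \<noteq> 0" using q less.prems by auto
    have "degree p = degree [:-r, 1:] + degree q" unfolding q by (rule degree_mult_eq) (use q0 in auto)
    then have d: "degree p = Suc (degree q)" by simp
    have "size (proots q) = degree q"
    proof (rule less.hyps)
      fix w :: complex assume "poly (map_poly of_real q) w = 0"
      then have "poly (map_poly of_real p) w = 0" unfolding q map_poly_of_real_mult by simp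
      then show "w \<in> \<real>" by (rule less.prems(2))
    qed (use d q0 in auto)
    moreover have "proots p = {#r#} + proots q" unfolding q using q0 by (subst proots_mult) auto
    ultimately show ?thesis using d by simp
  qed
qed

text \<open>The Hermitian form of \<open>H\<close> at an eigenvector is \<open>z\<close> times the
  squared length \<open>S\<close>, and by symmetry it equals its own conjugate.\<close>

lemma symmetric_eigenvalue_real:
  fixes G :: "real mat"
  assumes G: "G \<in> carrier_mat k k" and sym: "\<And>i j. i < k \<Longrightarrow> j < k \<Longrightarrow> G $$ (i, j) = G $$ (j, i)"
    and z: "poly (map_poly of_real (char_poly G)) (z :: complex) = 0"
  shows "z \<in> \<real>"
proof -
  define H where "H = map_mat complex_of_real G"
  have H: "H \<in> carrier_mat k k" using G by (simp add: H_def)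
  have "poly (char_poly H) z = 0" using z by (simp add: H_def of_real_hom.char_poly_hom[OF G])
  then have "eigenvalue H z" using eigenvalue_root_char_poly[OF H] by simp
  then obtain v where v: "v \<in> carrier_vec k" "v \<noteq> 0\<^sub>v k" "H *\<^sub>v v = z \<cdot>\<^sub>v v"
    using H by (auto simp: eigenvalue_def eigenvector_def)
  have Hv: "(\<Sum>j<k. of_real (G $$ (i, j)) * v $ j) = z * v $ i" if "i < k" for i
  proof -
    have "(H *\<^sub>v v) $ i = (\<Sum>j<k. of_real (G $$ (i, j)) * v $ j)"
      using that G v(1) H by (auto simp: scalar_prod_def H_def atLeast0LessThan intro!: sum.cong)
    then show ?thesis unfolding v(3) using v(1) that by simp
  qed
  define S where "S = (\<Sum>i<k. (cmod (v $ i))\<^sup>2)"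
  have zS: "z * of_real S = (\<Sum>i<k. \<Sum>j<k. cnj (v $ i) * of_real (G $$ (i, j)) * v $ j)"
  proof -
    have "z * of_real S = (\<Sum>i<k. cnj (v $ i) * (z * v $ i))"
      unfolding S_def of_real_sum sum_distrib_left complex_norm_square by (simp add: mult_ac)
    also have "\<dots> = (\<Sum>i<k. cnj (v $ i) * (\<Sum>j<k. of_real (G $$ (i, j)) * v $ j))"
      using Hv by simp
    finally show ?thesis by (simp add: sum_distrib_left mult.assoc)
  qed
  have "cnj (z * of_real S) = (\<Sum>i<k. \<Sum>j<k. v $ i * of_real (G $$ (i, j)) * cnj (v $ j))"
    unfolding zS by simp
  also have "\<dots> = (\<Sum>j<k. \<Sum>i<k. v $ i * of_real (G $$ (i, j)) * cnj (v $ j))" by (rule sum.swap)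
  also have "\<dots> = z * of_real S" unfolding zS using sym by (intro sum.cong) (auto simp: mult_ac)
  finally have eq: "cnj z * of_real S = z * of_real S" by simp
  have "S \<noteq> 0"
  proof
    assume "S = 0"
    then have "\<forall>i<k. v $ i = 0" unfolding S_def by (subst (asm) sum_nonneg_eq_0_iff) auto
    then have "v = 0\<^sub>v k" using v(1) by (intro eq_vecI) auto
    then show False using v(2) by simp
  qed
  then have "cnj z = z" using eq by simp
  then show ?thesis by (simp add: Reals_cnj_iff)
qed

section \<open>Quadratic forms and the smallest singular value\<close>

lemma scalar_prod_Cauchy_Schwarz:
  assumes "v \<in> carrier_vec k" "w \<in> carrier_vec k"
  shows "(scalar_prod v w)\<^sup>2 \<le> scalar_prod v v * scalar_prod w (w :: real vec)"
proof -
  have eq: "scalar_prod x y = inner (fvec_of k (vec_index x)) (fvec_of k (vec_index y))"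
    if "x \<in> carrier_vec k" "y \<in> carrier_vec k" for x y :: "real vec"
    using that by (simp add: scalar_prod_def inner_fvec_of atLeast0LessThan)
  show ?thesis using assms by (simp add: eq Cauchy_Schwarz_ineq)
qed

lemma scalar_prod_self_eq: "v \<in> carrier_vec k \<Longrightarrow> scalar_prod v v = (\<Sum>i<k. (v $ i)\<^sup>2)" for v :: "real vec"
  by (simp add: scalar_prod_def power2_eq_square atLeast0LessThan)

lemma scalar_prod_self_nonneg: "0 \<le> scalar_prod v (v :: real vec)"
  by (simp add: scalar_prod_def sum_nonneg)

lemma mult_mat_vec_bounded:
  fixes M :: "real mat"
  assumes M: "M \<in> carrier_mat k k"
  obtains C where "0 < C" "\<And>v. v \<in> carrier_vec k \<Longrightarrow>
    scalar_prod (M *\<^sub>v v) (M *\<^sub>v v) \<le> C * scalar_prod v v"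
proof
  define C where "C = 1 + (\<Sum>i<k. scalar_prod (row M i) (row M i))"
  show "0 < C" unfolding C_def by (intro add_pos_nonneg sum_nonneg) (auto simp: scalar_prod_self_nonneg)
  fix v :: "real vec" assume v: "v \<in> carrier_vec k"
  have "M *\<^sub>v v \<in> carrier_vec k" using M v by simp
  then have "scalar_prod (M *\<^sub>v v) (M *\<^sub>v v) = (\<Sum>i<k. (scalar_prod (row M i) v)\<^sup>2)"
    using M by (simp add: scalar_prod_self_eq)
  also have "\<dots> \<le> (\<Sum>i<k. scalar_prod (row M i) (row M i) * scalar_prod v v)"
    by (intro sum_mono scalar_prod_Cauchy_Schwarz) (use M v in auto)
  also have "\<dots> \<le> C * scalar_prod v v"
    by (simp add: C_def sum_distrib_left algebra_simps scalar_prod_self_nonneg)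
  finally show "scalar_prod (M *\<^sub>v v) (M *\<^sub>v v) \<le> C * scalar_prod v v" .
qed

text \<open>If the infimum of the Rayleigh quotient were not an eigenvalue, shifting by it would give
  an invertible positive semidefinite matrix, hence a strictly larger lower bound.\<close>

lemma rayleigh_lower_bound:
  fixes G :: "real mat"
  assumes G: "G \<in> carrier_mat k k" and sym: "transpose_mat G = G"
    and psd: "\<And>v. v \<in> carrier_vec k \<Longrightarrow> 0 \<le> scalar_prod v (G *\<^sub>v v)"
    and ev: "\<And>x. poly (char_poly G) x = 0 \<Longrightarrow> s \<le> x"
    and v: "v \<in> carrier_vec k"
  shows "s * scalar_prod v v \<le> scalar_prod v (G *\<^sub>v v)"
proof (rule ccontr)
  assume neg: "\<not> ?thesis"
  define S where "S = {scalar_prod v (G *\<^sub>v v) / scalar_prod v v | v. v \<in> carrier_vec k \<and> scalar_prod v v \<noteq> 0}"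
  define m where "m = Inf S"
  have v0: "scalar_prod v v \<noteq> 0"
  proof
    assume 0: "scalar_prod v v = 0"
    then show False using neg psd[OF v] by simp
  qed
  then have vp: "scalar_prod v v > 0" using scalar_prod_self_nonneg[of v] by simp
  have bdd: "bdd_below S"
    by (rule bdd_belowI[of _ 0]) (auto simp: S_def intro!: divide_nonneg_nonneg psd scalar_prod_self_nonneg)
  have inS: "scalar_prod v (G *\<^sub>v v) / scalar_prod v v \<in> S" using v v0 by (auto simp: S_def)
  have "m \<le> scalar_prod v (G *\<^sub>v v) / scalar_prod v v" unfolding m_def using inS bdd by (rule cInf_lower)
  also have "\<dots> < s" using neg vp by (simp add: divide_less_eq)
  finally have "m < s" .
  then have "\<not> eigenvalue G m" using ev eigenvalue_root_char_poly[OF G] by force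
  define H where "H = char_matrix G m"
  have H: "H \<in> carrier_mat k k" using G by (simp add: H_def)
  have "det H \<noteq> 0" using \<open>\<not> eigenvalue G m\<close> eigenvalue_det[OF G] by (simp add: H_def)
  from det_non_zero_imp_unit[OF H this, of undefined] obtain K where
    K: "K \<in> carrier_mat k k" "K * H = 1\<^sub>m k"
    by (auto simp: Units_def ring_mat_def)
  have Hv: "H *\<^sub>v x = G *\<^sub>v x - m \<cdot>\<^sub>v x" if x: "x \<in> carrier_vec k" for x
  proof -
    have "H *\<^sub>v x = G *\<^sub>v x + (- m \<cdot>\<^sub>m 1\<^sub>m k) *\<^sub>v x"
      unfolding H_def char_matrix_def using G x by (subst add_mult_distrib_mat_vec[of _ k k]) auto
    also have "(- m \<cdot>\<^sub>m 1\<^sub>m k) *\<^sub>v x = - m \<cdot>\<^sub>v x"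
    proof (intro eq_vecI)
      fix i assume "i < dim_vec (- m \<cdot>\<^sub>v x)"
      then have i: "i < k" using x by simp
      have "((- m \<cdot>\<^sub>m 1\<^sub>m k) *\<^sub>v x) $ i = (\<Sum>j = 0..<k. - m * (if j = i then 1 else 0) * x $ j)"
        using x i by (simp add: scalar_prod_def)
      also have "\<dots> = (\<Sum>j = 0..<k. if j = i then - m * x $ i else 0)" by (rule sum.cong) auto
      finally show "((- m \<cdot>\<^sub>m 1\<^sub>m k) *\<^sub>v x) $ i = (- m \<cdot>\<^sub>v x) $ i" using i x by simp
    qed (use x in simp)
    finally show ?thesis using x G by (intro eq_vecI) auto
  qed
  have G_sym: "scalar_prod x (G *\<^sub>v y) = scalar_prod y (G *\<^sub>v x)" if "x \<in> carrier_vec k" "y \<in> carrier_vec k" for x y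
    using that G sym by (metis comm_scalar_prod mult_mat_vec_carrier transpose_vec_mult_scalar)
  have H_sym: "scalar_prod x (H *\<^sub>v y) = scalar_prod y (H *\<^sub>v x)" if "x \<in> carrier_vec k" "y \<in> carrier_vec k" for x y
  proof -
    have Gx: "G *\<^sub>v x \<in> carrier_vec k" "G *\<^sub>v y \<in> carrier_vec k" using G that by auto
    show ?thesis using that Gx G_sym[OF that] comm_scalar_prod[OF that]
      by (simp add: Hv scalar_prod_minus_distrib[of _ k])
  qed
  have H_psd: "0 \<le> scalar_prod x (H *\<^sub>v x)"
    and H_val: "scalar_prod x (H *\<^sub>v x) = scalar_prod x (G *\<^sub>v x) - m * scalar_prod x x"
    if x: "x \<in> carrier_vec k" for x
  proof -
    have Gx: "G *\<^sub>v x \<in> carrier_vec k" using G x by auto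
    show val: "scalar_prod x (H *\<^sub>v x) = scalar_prod x (G *\<^sub>v x) - m * scalar_prod x x"
      using x Gx by (simp add: Hv scalar_prod_minus_distrib[of _ k])
    show "0 \<le> scalar_prod x (H *\<^sub>v x)"
    proof (cases "scalar_prod x x = 0")
      case True
      then show ?thesis using val psd[OF x] by simp
    next
      case False
      then have "scalar_prod x x > 0" using scalar_prod_self_nonneg[of x] by simp
      moreover have "m \<le> scalar_prod x (G *\<^sub>v x) / scalar_prod x x"
        unfolding m_def by (rule cInf_lower[OF _ bdd]) (use x False in \<open>auto simp: S_def\<close>)
      ultimately show ?thesis using val by (simp add: le_divide_eq)
    qed
  qed
  obtain C where C: "0 < C" "\<And>x. x \<in> carrier_vec k \<Longrightarrow> scalar_prod (H *\<^sub>v x) (H *\<^sub>v x) \<le> C * scalar_prod x x"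
    using mult_mat_vec_bounded[OF H] by blast
  obtain C' where C': "0 < C'" "\<And>x. x \<in> carrier_vec k \<Longrightarrow> scalar_prod (K *\<^sub>v x) (K *\<^sub>v x) \<le> C' * scalar_prod x x"
    using mult_mat_vec_bounded[OF K(1)] by blast
  \<comment> \<open>\<open>C\<close> bounds the square of the operator norm of \<open>H\<close>;
    since \<open>C \<le> (1 + C)\<^sup>2\<close>, the norm itself is bounded by
    \<open>B\<close>.\<close>
  define B where "B = 1 + C"
  have B: "0 < B" using C by (simp add: B_def)
  have gap: "scalar_prod x x / (B * C') \<le> scalar_prod x (H *\<^sub>v x)" if x: "x \<in> carrier_vec k" for x
  proof -
    define y where "y = H *\<^sub>v x"
    have y: "y \<in> carrier_vec k" "H *\<^sub>v y \<in> carrier_vec k" using H x by (auto simp: y_def)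
    have Hy: "scalar_prod y (H *\<^sub>v y) \<le> B * scalar_prod y y"
    proof -
      have 1: "(scalar_prod y (H *\<^sub>v y))\<^sup>2 \<le> scalar_prod y y * (C * scalar_prod y y)"
        using scalar_prod_Cauchy_Schwarz[OF y] mult_left_mono[OF C(2)[OF y(1)] scalar_prod_self_nonneg[of y]]
        by (rule order_trans)
      have "scalar_prod y y * (C * scalar_prod y y) = C * (scalar_prod y y)\<^sup>2" by (simp add: power2_eq_square)
      also have "\<dots> \<le> B\<^sup>2 * (scalar_prod y y)\<^sup>2"
        by (rule mult_right_mono) (use C in \<open>auto simp: B_def power2_eq_square algebra_simps\<close>)
      finally have "(scalar_prod y (H *\<^sub>v y))\<^sup>2 \<le> (B * scalar_prod y y)\<^sup>2" using 1 by (simp add: power_mult_distrib)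
      then show ?thesis by (rule power2_le_imp_le) (use B scalar_prod_self_nonneg[of y] in simp)
    qed
    \<comment> \<open>Positivity of the form at \<open>x + t \<cdot>\<^sub>v y\<close> shows that
      the form at \<open>x\<close> is at least the squared length of
      \<open>y = H *\<^sub>v x\<close> divided by \<open>B\<close>. Boundedness of the inverse
      \<open>K\<close> then bounds that length below in terms of \<open>x\<close>.\<close>
    define t where "t = - 1 / B"
    have ty: "t \<cdot>\<^sub>v y \<in> carrier_vec k" using y by simp
    have xty: "x + t \<cdot>\<^sub>v y \<in> carrier_vec k" using x y by simp
    have "H *\<^sub>v (x + t \<cdot>\<^sub>v y) = y + t \<cdot>\<^sub>v (H *\<^sub>v y)"
      using H x y ty by (simp add: mult_add_distrib_mat_vec[of _ k k] mult_mat_vec[of _ k k] y_def)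
    then have "scalar_prod (x + t \<cdot>\<^sub>v y) (H *\<^sub>v (x + t \<cdot>\<^sub>v y))
        = scalar_prod x y + t * scalar_prod x (H *\<^sub>v y) + t * (scalar_prod y y + t * scalar_prod y (H *\<^sub>v y))"
      using x y ty by (simp add: add_scalar_prod_distrib[of _ k] scalar_prod_add_distrib[of _ k] distrib_left)
    also have "scalar_prod x (H *\<^sub>v y) = scalar_prod y y" using H_sym[OF x y(1)] by (simp add: y_def)
    finally have "0 \<le> scalar_prod x y + 2 * t * scalar_prod y y + t\<^sup>2 * scalar_prod y (H *\<^sub>v y)"
      using H_psd[OF xty] by (simp add: algebra_simps power2_eq_square)
    also have "t\<^sup>2 * scalar_prod y (H *\<^sub>v y) \<le> t\<^sup>2 * (B * scalar_prod y y)"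
      using Hy by (intro mult_left_mono) auto
    also have "\<dots> = - t * scalar_prod y y" using B by (simp add: t_def power2_eq_square)
    finally have 1: "scalar_prod y y / B \<le> scalar_prod x y" by (simp add: t_def)
    have "K *\<^sub>v y = x" using K H x by (simp add: y_def assoc_mult_mat_vec[symmetric, of _ k k _ k])
    then have "scalar_prod x x \<le> C' * scalar_prod y y" using C'(2)[OF y(1)] by simp
    then have "scalar_prod x x / (B * C') \<le> scalar_prod y y / B"
      using B C'(1) by (simp add: divide_simps mult_ac)
    with 1 show ?thesis by (simp add: y_def)
  qed
  have "m + 1 / (B * C') \<le> Inf S"
  proof (rule cInf_greatest)
    show "S \<noteq> {}" using inS by blast
    fix q assume "q \<in> S"
    then obtain x where x: "x \<in> carrier_vec k" "scalar_prod x x \<noteq> 0"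
      "q = scalar_prod x (G *\<^sub>v x) / scalar_prod x x" by (auto simp: S_def)
    then have xp: "scalar_prod x x > 0" using scalar_prod_self_nonneg[of x] by simp
    have "scalar_prod x x / (B * C') + m * scalar_prod x x \<le> scalar_prod x (G *\<^sub>v x)"
      using gap[OF x(1)] H_val[OF x(1)] by simp
    then show "m + 1 / (B * C') \<le> q" using xp x(3) by (simp add: le_divide_eq algebra_simps)
  qed
  then have "1 / (B * C') \<le> 0" by (simp add: m_def)
  moreover have "0 < 1 / (B * C')" using B C'(1) by simp
  ultimately show False by linarith
qed

text \<open>The list is decreasing and has exactly \<open>k\<close> entries, so its
  \<open>k\<close>-th entry is the least one. The assumption therefore bounds every eigenvalue of
  the Gram matrix below by \<open>1 / \<tau>\<^sup>2\<close>, and the Rayleigh bound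
  applies.\<close>

lemma kth_singular_value_bound:
  fixes B :: "real mat"
  assumes B: "B \<in> carrier_mat n k" and k: "1 \<le> k" and \<tau>: "0 < \<tau>"
    and sv: "1 / \<tau> \<le> kth_singular_value k B" and v: "v \<in> carrier_vec k"
  shows "scalar_prod v v \<le> \<tau>\<^sup>2 * scalar_prod (B *\<^sub>v v) (B *\<^sub>v v)"
proof -
  define G where "G = transpose_mat B * B"
  have G: "G \<in> carrier_mat k k" using B by (simp add: G_def)
  have sym: "transpose_mat G = G" unfolding G_def using B by (subst transpose_mult[of _ k n _ k]) auto
  have GB: "scalar_prod x (G *\<^sub>v x) = scalar_prod (B *\<^sub>v x) (B *\<^sub>v x)" if x: "x \<in> carrier_vec k" for x
  proof -
    have "G *\<^sub>v x = transpose_mat B *\<^sub>v (B *\<^sub>v x)"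
      unfolding G_def using B x by (intro assoc_mult_mat_vec[of _ k n _ k]) auto
    then show ?thesis
      using transpose_vec_mult_scalar[of B n k x "B *\<^sub>v x"] B x
        comm_scalar_prod[of x k "transpose_mat B *\<^sub>v (B *\<^sub>v x)"] by auto
  qed
  define p where "p = char_poly G"
  have p: "degree p = k" "coeff p k = 1" using degree_monic_char_poly[OF G] by (auto simp: p_def)
  then have p0: "p \<noteq> 0" by auto
  have "size (proots p) = k"
    unfolding p(1)[symmetric]
  proof (rule size_proots_real_rooted[OF p0])
    fix z :: complex assume "poly (map_poly of_real p) z = 0"
    moreover have "G $$ (i, j) = G $$ (j, i)" if "i < k" "j < k" for i j
      using arg_cong[OF sym, of "\<lambda>M. M $$ (i, j)"] that G by simp
    ultimately show "z \<in> \<real>" unfolding p_def by (intro symmetric_eigenvalue_real[OF G])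
  qed
  define xs where "xs = sorted_list_of_multiset (image_mset sqrt (proots p))"
  have len: "length xs = k"
    using \<open>size (proots p) = k\<close> by (metis mset_sorted_list_of_multiset size_image_mset size_mset xs_def)
  have "kth_singular_value k B = rev xs ! (k - 1)"
    by (simp add: kth_singular_value_def singular_values_def xs_def p_def G_def)
  also have "\<dots> = xs ! 0" using len k by (simp add: rev_nth)
  finally have min: "1 / \<tau> \<le> xs ! 0" using sv by simp
  have ev: "1 / \<tau>\<^sup>2 \<le> x" if "poly p x = 0" for x
  proof -
    have "x \<in># proots p" using that p0 by simp
    then have "sqrt x \<in> set xs" by (simp add: xs_def)
    then obtain i where "i < length xs" "xs ! i = sqrt x" by (auto simp: in_set_conv_nth)
    moreover have "sorted xs" by (simp add: xs_def)
    ultimately have "xs ! 0 \<le> sqrt x" by (metis sorted_nth_mono zero_le)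
    then have le: "1 / \<tau> \<le> sqrt x" using min by simp
    \<comment> \<open>\<open>sqrt\<close> is negative at negative arguments, so a positive root
      already shows that \<open>x\<close> is positive.\<close>
    then have "0 < sqrt x" using \<tau> by (smt (verit) zero_less_divide_1_iff)
    then have "0 < x" by simp
    have "(1 / \<tau>)\<^sup>2 \<le> (sqrt x)\<^sup>2" using le \<tau> by (intro power_mono) auto
    then show ?thesis using \<open>0 < x\<close> by (simp add: power_divide)
  qed
  have "1 / \<tau>\<^sup>2 * scalar_prod v v \<le> scalar_prod v (G *\<^sub>v v)"
    by (rule rayleigh_lower_bound[OF G sym _ _ v])
      (use ev in \<open>auto simp: p_def GB scalar_prod_self_nonneg\<close>)
  then show ?thesis using \<tau> GB[OF v] by (simp add: divide_le_eq mult.commute)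
qed

section \<open>Dual vectors for the columns of a matrix\<close>

lemma bij_betw_pick:
  assumes "finite J"
  shows "bij_betw (pick J) {..<card J} J"
  unfolding bij_betw_def
proof
  show inj: "inj_on (pick J) {..<card J}"
    by (rule inj_onI) (metis assms lessThan_iff linorder_neq_iff pick_mono_le)
  have sub: "pick J ` {..<card J} \<subseteq> J" by (auto simp: pick_in_set_le)
  show "pick J ` {..<card J} = J"
    by (rule card_subset_eq[OF assms sub]) (simp add: card_image[OF inj])
qed

definition column_fvec :: "nat \<Rightarrow> real mat \<Rightarrow> nat \<Rightarrow> fvec" where
  "column_fvec n A r = fvec_of n (\<lambda>i. A $$ (i, r))"

lemma entry_sum: "entry (\<Sum>j\<in>J. x j) i = (\<Sum>j\<in>J. entry (x j) i)"
  by (induction J rule: infinite_finite_induct) (auto simp: zero_fvec.rep_eq plus_fvec.rep_eq)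

lemma norm_sum_columns:
  "(norm (\<Sum>r\<in>I. f r *\<^sub>R column_fvec n A r))\<^sup>2 = (\<Sum>i<n. (\<Sum>r\<in>I. f r * A $$ (i, r))\<^sup>2)"
proof -
  have "(\<Sum>r\<in>I. f r *\<^sub>R column_fvec n A r) = fvec_of n (\<lambda>i. \<Sum>r\<in>I. f r * A $$ (i, r))"
    by (rule fvec_eqI) (auto simp: entry_sum scaleR_fvec.rep_eq column_fvec_def fvec_of.rep_eq)
  then show ?thesis unfolding power2_norm_eq_inner by (simp add: inner_fvec_of power2_eq_square)
qed

lemma K_rank_robust_duals:
  assumes U: "U \<in> carrier_mat n R" and K: "K_rank \<tau> U = k" and k: "1 \<le> k" and \<tau>: "0 < \<tau>"
  shows "k \<le> R" "robust_duals R k \<tau> (column_fvec n U)"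
proof -
  define P where "P k \<longleftrightarrow> k \<le> R \<and> (k = 0 \<or> (\<forall>J \<subseteq> {..<R}. card J = k \<longrightarrow>
        1 / \<tau> \<le> kth_singular_value k (submatrix U UNIV J)))" for k
  have "k = Max {k. P k}" using K U by (simp add: K_rank_def P_def)
  moreover have "finite {k. P k}" by (rule finite_subset[of _ "{..R}"]) (auto simp: P_def)
  moreover have "P 0" by (simp add: P_def)
  ultimately have "P k" using Max_in[of "{k. P k}"] by auto
  then show kR: "k \<le> R" by (simp add: P_def)
  have sv: "1 / \<tau> \<le> kth_singular_value k (submatrix U UNIV J)" if "J \<subseteq> {..<R}" "card J = k" for J
    using \<open>P k\<close> k that by (auto simp: P_def)
  show "robust_duals R k \<tau> (column_fvec n U)"
  proof (rule robust_dualsI)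
    fix I r and f :: "nat \<Rightarrow> real"
    assume I: "I \<subseteq> {..<R}" "card I \<le> k" "r \<in> I" "f r = 1"
    have finI: "finite I" using I finite_subset by blast
    \<comment> \<open>\<open>K_rank\<close> tests sets of exactly \<open>k\<close> columns, whereas
      \<open>I\<close> may be smaller; it is padded to size \<open>k\<close> and the coefficients
      are continued by zero.\<close>
    have "k - card I \<le> card ({..<R} - I)" using I finI kR by (simp add: card_Diff_subset)
    then obtain Y where Y: "Y \<subseteq> {..<R} - I" "card Y = k - card I" "finite Y"
      using obtain_subset_with_card_n by metis
    define J where "J = I \<union> Y"
    have J: "J \<subseteq> {..<R}" "finite J" "I \<subseteq> J" using I Y finI by (auto simp: J_def)
    have cJ: "card J = k" unfolding J_def using Y I finI by (subst card_Un_disjoint) auto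
    define B where "B = submatrix U UNIV J"
    have cols: "{j. j < dim_col U \<and> j \<in> J} = J" using U J by auto
    have B: "B \<in> carrier_mat n k" using U cols cJ by (auto simp: B_def submatrix_def)
    have Bij: "B $$ (i, j) = U $$ (i, pick J j)" if "i < n" "j < k" for i j
      unfolding B_def using that U cols cJ by (subst submatrix_index) (auto simp: pick_UNIV)
    define g where "g i = (if i \<in> I then f i else 0)" for i
    define v where "v = vec k (\<lambda>j. g (pick J j))"
    have v: "v \<in> carrier_vec k" by (simp add: v_def)
    have re: "(\<Sum>j<k. h (pick J j)) = (\<Sum>j\<in>J. h j)" for h :: "nat \<Rightarrow> real"
      using sum.reindex_bij_betw[OF bij_betw_pick[OF J(2)], of h] cJ by simp
    have Bv: "(B *\<^sub>v v) $ i = (\<Sum>r\<in>I. f r * U $$ (i, r))" if "i < n" for i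
    proof -
      have "(B *\<^sub>v v) $ i = (\<Sum>j<k. B $$ (i, j) * g (pick J j))"
        using that B by (auto simp: scalar_prod_def v_def atLeast0LessThan)
      also have "\<dots> = (\<Sum>j\<in>J. U $$ (i, j) * g j)"
        using Bij[OF that] by (simp add: re[of "\<lambda>j. U $$ (i, j) * g j", symmetric])
      also have "\<dots> = (\<Sum>j\<in>I. f j * U $$ (i, j))"
        using J by (intro sum.mono_neutral_cong_right) (auto simp: g_def)
      finally show ?thesis .
    qed
    have "1 \<le> (\<Sum>j\<in>J. (g j)\<^sup>2)"
      using member_le_sum[of r J "\<lambda>j. (g j)\<^sup>2"] I J by (auto simp: g_def)
    also have "\<dots> = scalar_prod v v"
      by (simp add: scalar_prod_self_eq[OF v]) (simp add: v_def re[of "\<lambda>j. (g j)\<^sup>2"])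
    also have "\<dots> \<le> \<tau>\<^sup>2 * scalar_prod (B *\<^sub>v v) (B *\<^sub>v v)"
      by (rule kth_singular_value_bound[OF B k \<tau> _ v]) (use sv[OF J(1) cJ] in \<open>simp add: B_def\<close>)
    also have "scalar_prod (B *\<^sub>v v) (B *\<^sub>v v) = (norm (\<Sum>r\<in>I. f r *\<^sub>R column_fvec n U r))\<^sup>2"
      unfolding norm_sum_columns using B v Bv by (subst scalar_prod_self_eq[of _ n]) auto
    finally have "1\<^sup>2 \<le> (\<tau> * norm (\<Sum>r\<in>I. f r *\<^sub>R column_fvec n U r))\<^sup>2" by (simp add: power_mult_distrib)
    then show "1 \<le> \<tau> * norm (\<Sum>r\<in>I. f r *\<^sub>R column_fvec n U r)"
      by (rule power2_le_imp_le) (use \<tau> in simp)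
  qed (use \<tau> in simp)
qed

text \<open>More than \<open>n\<close> columns with \<open>n\<close> entries are dependent. This is
  the link between the ranks and the dimensions through which \<open>R\<close> is controlled in the
  end.\<close>

lemma robust_duals_le_dimension:
  assumes d: "robust_duals R k \<tau> (column_fvec n U)" and k: "k \<le> R"
  shows "k \<le> n"
proof (rule ccontr)
  assume "\<not> k \<le> n"
  then have "card {..<n} < card {..<k}" by simp
  then obtain \<alpha> q where q: "q \<in> {..<k}" "\<alpha> q = 1"
    and \<alpha>: "\<And>t. t \<in> {..<n} \<Longrightarrow> (\<Sum>r\<in>{..<k}. \<alpha> r * U $$ (t, r)) = 0"
    using underdetermined_system_normalized[of "{..<n}" "{..<k}" "\<lambda>r t. U $$ (t, r)"]
    by (metis finite_lessThan)
  have "(norm (\<Sum>r\<in>{..<k}. \<alpha> r *\<^sub>R column_fvec n U r))\<^sup>2 = 0"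
    unfolding norm_sum_columns using \<alpha> by simp
  moreover have "\<bar>\<alpha> q\<bar> \<le> \<tau> * norm (\<Sum>r\<in>{..<k}. \<alpha> r *\<^sub>R column_fvec n U r)"
    by (rule robust_duals_lower_bound[OF d]) (use k q in auto)
  ultimately show False using q by simp
qed

section \<open>Merging modes\<close>

lemma robust_duals_mono:
  assumes "robust_duals R k D x" "k' \<le> k" "D \<le> D'"
  shows "robust_duals R k' D' x"
  using assms unfolding robust_duals_def by (meson order_trans)

lemma distribute_elements:
  fixes m :: "'j \<Rightarrow> nat"
  assumes "finite J" "finite X" "card X \<le> (\<Sum>j\<in>J. m j)"
  shows "\<exists>P. (\<forall>j\<in>J. P j \<subseteq> X \<and> card (P j) \<le> m j) \<and> X \<subseteq> (\<Union>j\<in>J. P j)"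
  using assms
proof (induction J arbitrary: X rule: finite_induct)
  case empty
  then show ?case by auto
next
  case (insert i J)
  obtain Y where Y: "Y \<subseteq> X" "card Y = min (m i) (card X)"
    using obtain_subset_with_card_n[of "min (m i) (card X)" X] by auto
  have "card (X - Y) = card X - card Y" using Y insert.prems by (simp add: card_Diff_subset finite_subset)
  then have "card (X - Y) \<le> (\<Sum>j\<in>J. m j)" using Y insert.prems insert.hyps by auto
  then obtain P where P: "\<forall>j\<in>J. P j \<subseteq> X - Y \<and> card (P j) \<le> m j" "X - Y \<subseteq> (\<Union>j\<in>J. P j)"
    using insert.IH[of "X - Y"] insert.prems by auto
  show ?case
  proof (intro exI[of _ "P(i := Y)"] conjI ballI)
    fix j assume "j \<in> insert i J"
    then show "(P(i := Y)) j \<subseteq> X" "card ((P(i := Y)) j) \<le> m j" using P Y by auto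
  next
    show "X \<subseteq> (\<Union>j\<in>insert i J. (P(i := Y)) j)"
    proof
      fix x assume "x \<in> X"
      show "x \<in> (\<Union>j\<in>insert i J. (P(i := Y)) j)"
      proof (cases "x \<in> Y")
        case False
        then obtain j where "j \<in> J" "x \<in> P j" using P(2) \<open>x \<in> X\<close> by blast
        moreover from this have "j \<noteq> i" using insert.hyps by blast
        ultimately show ?thesis by force
      qed simp
    qed
  qed
qed

text \<open>A vector dual at \<open>r\<close> in mode \<open>j\<close> can annihilate
  \<open>k j - 1\<close> other columns. Distributing \<open>I - {r}\<close> over the modes within
  these capacities lets every \<open>s\<close> be annihilated in at least one mode.\<close>

lemma common_duals:
  fixes x :: "'j \<Rightarrow> nat \<Rightarrow> 'a::real_inner"
  assumes J: "finite J" and d: "\<And>j. j \<in> J \<Longrightarrow> robust_duals R (k j) (\<tau> j) (x j)" and k: "\<And>j. j \<in> J \<Longrightarrow> 1 \<le> k j"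
    and I: "I \<subseteq> {..<R}" "r \<in> I" "card I \<le> 1 + (\<Sum>j\<in>J. k j - 1)"
  obtains P w where "\<And>j. j \<in> J \<Longrightarrow> norm (w j) \<le> \<tau> j" "\<And>j. j \<in> J \<Longrightarrow> inner (x j r) (w j) = 1"
    "\<And>j s. j \<in> J \<Longrightarrow> s \<in> P j \<Longrightarrow> inner (x j s) (w j) = 0" "I - {r} \<subseteq> (\<Union>j\<in>J. P j)"
proof -
  have fin: "finite I" using I finite_subset by blast
  have "card (I - {r}) \<le> (\<Sum>j\<in>J. k j - 1)" using I fin by simp
  then obtain P where P: "\<forall>j\<in>J. P j \<subseteq> I - {r} \<and> card (P j) \<le> k j - 1" "I - {r} \<subseteq> (\<Union>j\<in>J. P j)"
    using distribute_elements[OF J, of "I - {r}" "\<lambda>j. k j - 1"] fin by auto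
  have "\<exists>w. norm w \<le> \<tau> j \<and> inner (x j r) w = 1 \<and> (\<forall>s\<in>P j. inner (x j s) w = 0)" if j: "j \<in> J" for j
  proof -
    have "insert r (P j) \<subseteq> {..<R}" using P j I by auto
    moreover have "card (insert r (P j)) \<le> k j"
      using P j k[OF j] card_insert_le_m1[of "k j" "P j" r] by auto
    ultimately obtain w where "norm w \<le> \<tau> j" "inner (x j r) w = 1"
      "\<And>s. s \<in> insert r (P j) \<Longrightarrow> s \<noteq> r \<Longrightarrow> inner (x j s) w = 0"
      using robust_dualsE[OF d[OF j] _ _ insertI1] by metis
    then show ?thesis using P j by (intro exI[of _ w]) auto
  qed
  then obtain w where "\<And>j. j \<in> J \<Longrightarrow> norm (w j) \<le> \<tau> j \<and> inner (x j r) (w j) = 1 \<and> (\<forall>s\<in>P j. inner (x j s) (w j) = 0)"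
    by metis
  then show ?thesis using that[of w P] P by blast
qed

text \<open>A product of dual vectors annihilates \<open>s\<close> as soon as one factor does, so
  the capacities \<open>k j - 1\<close> add up. The empty range fits in, with rank 1.\<close>

lemma robust_duals_tens_range:
  assumes d: "\<And>j. j \<in> {a..<b} \<Longrightarrow> robust_duals R (k j) (\<tau> j) (x j)"
    and k: "\<And>j. j \<in> {a..<b} \<Longrightarrow> 1 \<le> k j"
  shows "robust_duals R (1 + (\<Sum>j=a..<b. k j - 1)) (\<Prod>j=a..<b. \<tau> j) (\<lambda>r. tens_range (\<lambda>j. x j r) a b)"
  unfolding robust_duals_def
proof (intro allI impI)
  fix I r assume I: "I \<subseteq> {..<R}" "card I \<le> 1 + (\<Sum>j=a..<b. k j - 1)" "r \<in> I"
  obtain P w where w: "\<And>j. j \<in> {a..<b} \<Longrightarrow> norm (w j) \<le> \<tau> j" "\<And>j. j \<in> {a..<b} \<Longrightarrow> inner (x j r) (w j) = 1"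
    "\<And>j s. j \<in> {a..<b} \<Longrightarrow> s \<in> P j \<Longrightarrow> inner (x j s) (w j) = 0" "I - {r} \<subseteq> (\<Union>j\<in>{a..<b}. P j)"
    using common_duals[where J = "{a..<b}" and x = x and \<tau> = \<tau> and k = k, OF _ d k I(1,3,2)]
    by (metis finite_atLeastLessThan)
  show "\<exists>w. norm w \<le> (\<Prod>j=a..<b. \<tau> j) \<and> inner (tens_range (\<lambda>j. x j r) a b) w = 1 \<and>
    (\<forall>s\<in>I - {r}. inner (tens_range (\<lambda>j. x j s) a b) w = 0)"
  proof (intro exI[of _ "tens_range w a b"] conjI ballI)
    show "norm (tens_range w a b) \<le> (\<Prod>j=a..<b. \<tau> j)"
      unfolding norm_tens_range by (rule prod_mono) (use w in auto)
    show "inner (tens_range (\<lambda>j. x j r) a b) (tens_range w a b) = 1"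
      unfolding inner_tens_range using w by (intro prod.neutral) auto
    show "inner (tens_range (\<lambda>j. x j s) a b) (tens_range w a b) = 0" if "s \<in> I - {r}" for s
    proof -
      obtain j where "j \<in> {a..<b}" "s \<in> P j" using w(4) \<open>s \<in> I - {r}\<close> by blast
      then show ?thesis unfolding inner_tens_range using w(3) by (intro prod_zero) blast+
    qed
  qed
qed

text \<open>Contracting all modes except \<open>j\<close> with vectors dual to the
  \<open>x i\<close> turns a match of products into a match of factors with scalar
  \<open>\<beta> * \<kappa>\<close>. In mode \<open>j\<close> the test vector is the error
  \<open>z\<close> itself, which makes the contraction equal to its squared norm.\<close>

lemma tens_range_factor_match:
  assumes j: "a \<le> j" "j < b"
    and w: "\<And>i. i \<in> {a..<b} \<Longrightarrow> norm (w i) \<le> \<tau> i" "\<And>i. i \<in> {a..<b} \<Longrightarrow> inner (x i) (w i) = 1"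
    and m: "norm (tens_range x a b - \<beta> *\<^sub>R tens_range y a b) \<le> \<delta>"
  shows "\<exists>\<mu>. norm (x j - \<mu> *\<^sub>R y j) \<le> \<delta> * (\<Prod>i\<in>{a..<b} - {j}. \<tau> i)"
proof -
  define \<kappa> where "\<kappa> = (\<Prod>i\<in>{a..<b} - {j}. inner (y i) (w i))"
  define z where "z = x j - (\<beta> * \<kappa>) *\<^sub>R y j"
  define t where "t = tens_range (w(j := z)) a b"
  have J: "finite {a..<b}" "j \<in> {a..<b}" using j by auto
  have x: "inner (tens_range x a b) t = inner (x j) z"
  proof -
    have "inner (tens_range x a b) t = inner (x j) z * (\<Prod>i\<in>{a..<b} - {j}. inner (x i) ((w(j := z)) i))"
      unfolding t_def inner_tens_range by (subst prod.remove[OF J]) simp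
    also have "(\<Prod>i\<in>{a..<b} - {j}. inner (x i) ((w(j := z)) i)) = 1" using w by (intro prod.neutral) auto
    finally show ?thesis by simp
  qed
  have y: "inner (tens_range y a b) t = inner (y j) z * \<kappa>"
    unfolding t_def inner_tens_range \<kappa>_def by (subst prod.remove[OF J]) (auto intro!: prod.cong)
  have "inner (tens_range x a b - \<beta> *\<^sub>R tens_range y a b) t = inner z z"
    unfolding inner_diff_left inner_scaleR_left x y by (simp add: z_def inner_diff_left)
  then have "(norm z)\<^sup>2 \<le> norm (tens_range x a b - \<beta> *\<^sub>R tens_range y a b) * norm t"
    using norm_cauchy_schwarz[of "tens_range x a b - \<beta> *\<^sub>R tens_range y a b" t] by (simp add: power2_norm_eq_inner)
  also have "\<dots> \<le> \<delta> * norm t" using m by (rule mult_right_mono) simp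
  also have "norm t = norm z * (\<Prod>i\<in>{a..<b} - {j}. norm (w i))"
    unfolding t_def norm_tens_range by (subst prod.remove[OF J]) (auto intro!: prod.cong)
  also have "\<delta> * (norm z * (\<Prod>i\<in>{a..<b} - {j}. norm (w i))) \<le> \<delta> * (norm z * (\<Prod>i\<in>{a..<b} - {j}. \<tau> i))"
    using w(1) norm_ge_zero[THEN order_trans, OF m] by (intro mult_left_mono prod_mono) auto
  finally have "norm z * norm z \<le> (\<delta> * (\<Prod>i\<in>{a..<b} - {j}. \<tau> i)) * norm z"
    by (simp add: power2_eq_square mult_ac)
  moreover have "0 \<le> \<tau> i" if "i \<in> {a..<b}" for i using w(1)[OF that] norm_ge_zero order_trans by blast
  then have "0 \<le> \<delta> * (\<Prod>i\<in>{a..<b} - {j}. \<tau> i)"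
    using norm_ge_zero[THEN order_trans, OF m] by (intro mult_nonneg_nonneg prod_nonneg) auto
  ultimately have "norm z \<le> \<delta> * (\<Prod>i\<in>{a..<b} - {j}. \<tau> i)"
    by (cases "norm z = 0") (auto simp: mult_le_cancel_right)
  then show ?thesis unfolding z_def by blast
qed

lemma norm_diff_sums:
  fixes x y :: "'i \<Rightarrow> 'a::real_inner"
  shows "(norm ((\<Sum>r\<in>I. x r) - (\<Sum>r\<in>I. y r)))\<^sup>2 =
    (\<Sum>r\<in>I. \<Sum>s\<in>I. inner (x r) (x s)) - 2 * (\<Sum>r\<in>I. \<Sum>s\<in>I. inner (x r) (y s)) + (\<Sum>r\<in>I. \<Sum>s\<in>I. inner (y r) (y s))"
proof -
  have "(\<Sum>r\<in>I. \<Sum>s\<in>I. inner (y r) (x s)) = (\<Sum>r\<in>I. \<Sum>s\<in>I. inner (x r) (y s))"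
    by (subst sum.swap) (simp add: inner_commute)
  moreover have "inner (\<Sum>r\<in>I. z r) (\<Sum>s\<in>I. z' s) = (\<Sum>r\<in>I. \<Sum>s\<in>I. inner (z r) (z' s))" for z z' :: "'i \<Rightarrow> 'a"
    by (subst inner_sum_left) (simp add: inner_sum_right)
  ultimately show ?thesis unfolding power2_norm_eq_inner by (simp add: inner_diff_left inner_diff_right)
qed

lemma prod_subset_le:
  fixes f :: "'i \<Rightarrow> real"
  assumes "finite J" "I \<subseteq> J" "\<And>j. j \<in> J \<Longrightarrow> 1 \<le> f j"
  shows "(\<Prod>i\<in>I. f i) \<le> (\<Prod>i\<in>J. f i)"
proof (rule prod_mono2[OF assms(1,2)])
  show "1 \<le> f b" if "b \<in> J - I" for b using assms(3) that by auto
  show "0 \<le> f a" if "a \<in> I" for a using assms(2,3) that by (meson order_trans subsetD zero_le_one)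
qed

text \<open>In the next locale \<open>gram\<close> bounds the squared Frobenius distance of the two tensors, expanded so that
  it depends on the inner products of the columns only and holds in every model of the tensor product.\<close>

locale close_tensors =
  fixes l R :: nat and k :: "nat \<Rightarrow> nat" and \<tau> \<rho> \<rho>' :: "nat \<Rightarrow> real" and D \<epsilon> :: real
    and u v :: "nat \<Rightarrow> nat \<Rightarrow> fvec"
  assumes D2: "2 \<le> D" and RD: "real R \<le> D" and eps0: "0 \<le> \<epsilon>" and eps_small: "\<epsilon> * D ^ 30 < 1"
    and params: "\<And>j. j < l \<Longrightarrow> 1 \<le> \<tau> j \<and> 1 \<le> \<rho> j \<and> 1 \<le> \<rho>' j"
    and prodD: "(\<Prod>j<l. \<tau> j * \<rho> j * \<rho>' j) \<le> D"
    and l: "1 \<le> l" and k: "\<And>j. j < l \<Longrightarrow> 2 \<le> k j \<and> k j \<le> R"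
    and k_sum: "2 * R + l \<le> (\<Sum>j<l. k j) + 1"
    and duals: "\<And>j. j < l \<Longrightarrow> robust_duals R (k j) (\<tau> j) (u j)"
    and bnd_u: "\<And>j r. j < l \<Longrightarrow> r < R \<Longrightarrow> norm (u j r) \<le> \<rho> j"
    and bnd_v: "\<And>j r. j < l \<Longrightarrow> r < R \<Longrightarrow> norm (v j r) \<le> \<rho>' j"
    and gram: "(\<Sum>r<R. \<Sum>s<R. \<Prod>j<l. inner (v j r) (v j s)) - 2 * (\<Sum>r<R. \<Sum>s<R. \<Prod>j<l. inner (v j r) (u j s))
      + (\<Sum>r<R. \<Sum>s<R. \<Prod>j<l. inner (u j r) (u j s)) \<le> \<epsilon>\<^sup>2"
begin

lemma D_ge1: "1 \<le> D" "0 < D" "0 \<le> D" using D2 by auto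

lemma eps_power: "p \<le> 30 \<Longrightarrow> \<epsilon> * D ^ p < 1"
proof -
  assume "p \<le> 30"
  then have "\<epsilon> * D ^ p \<le> \<epsilon> * D ^ 30"
    using eps0 D_ge1 by (intro mult_left_mono power_increasing) auto
  then show ?thesis using eps_small by simp
qed

lemma eps_power_mono: "p \<le> q \<Longrightarrow> \<epsilon> * D ^ p \<le> \<epsilon> * D ^ q"
  using eps0 D_ge1 by (intro mult_left_mono power_increasing) auto

lemma prod_le_D:
  assumes "I \<subseteq> {..<l}" "\<And>j. j < l \<Longrightarrow> 0 \<le> f j \<and> f j \<le> \<tau> j * \<rho> j * \<rho>' j"
  shows "(\<Prod>j\<in>I. f j) \<le> D"
proof -
  have "(\<Prod>j\<in>I. f j) \<le> (\<Prod>j\<in>I. \<tau> j * \<rho> j * \<rho>' j)" by (rule prod_mono) (use assms in auto)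
  also have "\<dots> \<le> (\<Prod>j<l. \<tau> j * \<rho> j * \<rho>' j)"
  proof (rule prod_subset_le[OF _ assms(1)])
    fix j assume "j \<in> {..<l}"
    then have "1 * 1 * 1 \<le> \<tau> j * \<rho> j * \<rho>' j" using params[of j] by (intro mult_mono) auto
    then show "1 \<le> \<tau> j * \<rho> j * \<rho>' j" by simp
  qed simp
  finally show ?thesis using prodD by simp
qed

lemma param_le:
  assumes "j < l"
  shows "\<tau> j \<le> \<tau> j * \<rho> j * \<rho>' j" "\<rho>' j \<le> \<tau> j * \<rho> j * \<rho>' j" "\<tau> j * \<rho>' j \<le> \<tau> j * \<rho> j * \<rho>' j"
    "\<tau> j * \<rho> j \<le> \<tau> j * \<rho> j * \<rho>' j"
proof -
  note p = params[OF assms]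
  have "\<tau> j * 1 * 1 \<le> \<tau> j * \<rho> j * \<rho>' j" using p by (intro mult_mono) auto
  then show "\<tau> j \<le> \<tau> j * \<rho> j * \<rho>' j" by simp
  have "1 * 1 * \<rho>' j \<le> \<tau> j * \<rho> j * \<rho>' j" using p by (intro mult_mono) auto
  then show "\<rho>' j \<le> \<tau> j * \<rho> j * \<rho>' j" by simp
  have "\<tau> j * 1 * \<rho>' j \<le> \<tau> j * \<rho> j * \<rho>' j" using p by (intro mult_mono) auto
  then show "\<tau> j * \<rho>' j \<le> \<tau> j * \<rho> j * \<rho>' j" by simp
  have "\<tau> j * \<rho> j * 1 \<le> \<tau> j * \<rho> j * \<rho>' j" using p by (intro mult_mono) auto
  then show "\<tau> j * \<rho> j \<le> \<tau> j * \<rho> j * \<rho>' j" by simp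
qed

lemma single_le_D:
  assumes "j < l"
  shows "\<tau> j \<le> D" "\<rho>' j \<le> D" "\<tau> j * \<rho> j \<le> D"
proof -
  have le: "\<tau> j * \<rho> j * \<rho>' j \<le> D"
    using prod_le_D[of "{j}" "\<lambda>j. \<tau> j * \<rho> j * \<rho>' j"] assms params by (fastforce intro!: mult_nonneg_nonneg)
  show "\<tau> j \<le> D" "\<rho>' j \<le> D" "\<tau> j * \<rho> j \<le> D" using le param_le[OF assms] by linarith+
qed

text \<open>\<open>T\<close> stands for any model of the tensor product. Two are used: one bracketed
  into three blocks for the matching, and the plain range of all modes for the scalars.\<close>

lemma close_realization:
  assumes T: "\<And>x y. inner (T x) (T y) = (\<Prod>j<l. inner (x j) (y j))"
  shows "norm ((\<Sum>r<R. T (\<lambda>j. v j r)) - (\<Sum>r<R. T (\<lambda>j. u j r)) :: fvec) \<le> \<epsilon>"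
  by (rule power2_le_imp_le[OF _ eps0]) (use gram in \<open>simp add: norm_diff_sums T\<close>)

lemma close_contraction:
  assumes T: "\<And>x y. inner (T x) (T y) = (\<Prod>j<l. inner (x j) (y j))"
  shows "\<bar>(\<Sum>r<R. inner (T (\<lambda>j. u j r)) w) - (\<Sum>r<R. inner (T (\<lambda>j. v j r)) w)\<bar> \<le> \<epsilon> * norm (w :: fvec)"
proof -
  have "\<bar>(\<Sum>r<R. inner (T (\<lambda>j. u j r)) w) - (\<Sum>r<R. inner (T (\<lambda>j. v j r)) w)\<bar> =
      \<bar>inner ((\<Sum>r<R. T (\<lambda>j. v j r)) - (\<Sum>r<R. T (\<lambda>j. u j r))) w\<bar>"
    by (simp add: inner_diff_left inner_sum_left)
  also have "\<dots> \<le> norm ((\<Sum>r<R. T (\<lambda>j. v j r)) - (\<Sum>r<R. T (\<lambda>j. u j r))) * norm w"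
    by (rule Cauchy_Schwarz_ineq2)
  also have "\<dots> \<le> \<epsilon> * norm w" using close_realization[OF T] by (rule mult_right_mono) simp
  finally show ?thesis .
qed

section \<open>Three blocks of modes and the common matching\<close>

text \<open>The middle mode is the first at which the partial sums of \<open>k j - 1\<close> reach
  \<open>R\<close>, so the first block has rank at most \<open>R\<close>. If the last block is
  truncated to \<open>R\<close>, the other two already supply \<open>R + 2\<close>; otherwise
  nothing is lost and the total suffices. Since \<open>k a \<le> R\<close>, neither outer block is
  empty.\<close>

lemma grouping:
  obtains a where "a < l" "2 \<le> 1 + (\<Sum>j=0..<a. k j - 1)" "1 + (\<Sum>j=0..<a. k j - 1) \<le> R"
    "2 \<le> min R (1 + (\<Sum>j=Suc a..<l. k j - 1))"
    "2 * R + 2 \<le> (1 + (\<Sum>j=0..<a. k j - 1)) + k a + min R (1 + (\<Sum>j=Suc a..<l. k j - 1))"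
proof -
  define s where "s m = (\<Sum>j=0..<m. k j - 1)" for m
  have R2: "2 \<le> R" using k[of 0] l by auto
  have total: "2 * R \<le> s l + 1"
  proof -
    have "(\<Sum>j<l. k j) = (\<Sum>j<l. (k j - 1) + 1)" using k by (intro sum.cong) force+
    also have "\<dots> = s l + l" unfolding sum.distrib by (simp add: s_def atLeast0LessThan)
    finally show ?thesis using k_sum by linarith
  qed
  have "\<not> R \<le> s 0" "R \<le> s l" using total R2 by (auto simp: s_def)
  then obtain a where a: "a < l" "\<not> R \<le> s a" "R \<le> s (Suc a)"
    using ex_least_nat_less[of "\<lambda>m. R \<le> s m" l] by auto
  have sa: "s (Suc a) = s a + (k a - 1)" by (simp add: s_def)
  have ka: "2 \<le> k a" "k a \<le> R" using k[OF a(1)] by auto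
  have "a \<noteq> 0"
  proof
    assume "a = 0"
    then have "s a = 0" by (simp add: s_def)
    then show False using a(3) sa ka by linarith
  qed
  then have "k 0 - 1 \<le> s a" unfolding s_def by (intro member_le_sum) auto
  then have sa1: "1 \<le> s a" using k[of 0] l by auto
  have rest: "s l = s (Suc a) + (\<Sum>j=Suc a..<l. k j - 1)"
    using a sum.atLeastLessThan_concat[of 0 "Suc a" l "\<lambda>j. k j - 1"] by (simp add: s_def)
  show ?thesis
    by (rule that[OF a(1)], unfold s_def[symmetric]) (use a sa ka sa1 rest total R2 in auto)
qed

lemma matching_factors:
  obtains \<pi> where "inj_on \<pi> {..<R}" "\<pi> ` {..<R} \<subseteq> {..<R}"
    "\<And>i j. i < R \<Longrightarrow> j < l \<Longrightarrow> \<exists>\<mu>. norm (u j (\<pi> i) - \<mu> *\<^sub>R v j i) \<le> \<epsilon> * D ^ 19"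
proof -
  obtain a where a: "a < l" "2 \<le> 1 + (\<Sum>j=0..<a. k j - 1)" "1 + (\<Sum>j=0..<a. k j - 1) \<le> R"
    "2 \<le> min R (1 + (\<Sum>j=Suc a..<l. k j - 1))"
    "2 * R + 2 \<le> (1 + (\<Sum>j=0..<a. k j - 1)) + k a + min R (1 + (\<Sum>j=Suc a..<l. k j - 1))"
    by (rule grouping)
  define g where "g x b c r = tens_range (\<lambda>j. x j r) b c" for x :: "nat \<Rightarrow> nat \<Rightarrow> fvec" and b c r
  have d: "robust_duals R (1 + (\<Sum>j=b..<c. k j - 1)) D (g u b c)" if "c \<le> l" for b c
    unfolding g_def
  proof (rule robust_duals_mono[OF robust_duals_tens_range[of b c R k \<tau> u]])
    show "(\<Prod>j=b..<c. \<tau> j) \<le> D"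
      by (rule prod_le_D) (use that params param_le in force)+
    show "robust_duals R (k j) (\<tau> j) (u j)" "1 \<le> k j" if "j \<in> {b..<c}" for j
      using that \<open>c \<le> l\<close> duals[of j] k[of j] by auto
  qed simp
  have bnd: "norm (g v b c i) \<le> D" if "c \<le> l" "i < R" for b c i
  proof -
    have "norm (g v b c i) \<le> (\<Prod>j=b..<c. \<rho>' j)"
      unfolding g_def norm_tens_range by (rule prod_mono) (use that bnd_v in auto)
    also have "\<dots> \<le> D" by (rule prod_le_D) (use that params param_le in force)+
    finally show ?thesis .
  qed
  have split: "(\<Prod>j<l. f j) = (\<Prod>j=0..<a. f j) * ((\<Prod>j=a..<Suc a. f j) * (\<Prod>j=Suc a..<l. f j))" for f :: "nat \<Rightarrow> real"
    using a(1) prod.atLeastLessThan_concat[of 0 a l f] prod.atLeastLessThan_concat[of a "Suc a" l f]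
    by (simp add: atLeast0LessThan)
  define T where "T x = tens (tens_range x 0 a) (tens (tens_range x a (Suc a)) (tens_range x (Suc a) l))" for x
  have T: "inner (T x) (T y) = (\<Prod>j<l. inner (x j) (y j))" for x y
    unfolding T_def inner_tens inner_tens_range split ..
  interpret G: close_decompositions R "1 + (\<Sum>j=0..<a. k j - 1)" "k a" "min R (1 + (\<Sum>j=Suc a..<l. k j - 1))" D \<epsilon>
    "g u 0 a" "g v 0 a" "g u a (Suc a)" "g v a (Suc a)" "g u (Suc a) l" "g v (Suc a) l"
  proof
    show "2 \<le> k a" "k a \<le> R" using k[OF a(1)] by auto
    show "robust_duals R (1 + (\<Sum>j=0..<a. k j - 1)) D (g u 0 a)" using a by (intro d) auto
    show "robust_duals R (k a) D (g u a (Suc a))" using d[of "Suc a" a] k[OF a(1)] a(1) by simp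
    show "robust_duals R (min R (1 + (\<Sum>j=Suc a..<l. k j - 1))) D (g u (Suc a) l)"
      by (rule robust_duals_mono[OF d]) auto
    fix x y z :: fvec
    have in3: "inner (T (\<lambda>j. f j r)) (tens x (tens y z)) =
        inner (g f 0 a r) x * inner (g f a (Suc a) r) y * inner (g f (Suc a) l r) z" for f r
      by (simp add: T_def inner_tens g_def)
    show "\<bar>(\<Sum>r<R. inner (g u 0 a r) x * inner (g u a (Suc a) r) y * inner (g u (Suc a) l r) z) -
        (\<Sum>r<R. inner (g v 0 a r) x * inner (g v a (Suc a) r) y * inner (g v (Suc a) l r) z)\<bar>
        \<le> \<epsilon> * (norm x * norm y * norm z)"
      using close_contraction[of T "tens x (tens y z)", OF T] unfolding in3 by (simp add: norm_tens mult.assoc)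
  qed (use a D2 RD eps0 eps_small bnd in auto)
  obtain \<pi> where \<pi>: "inj_on \<pi> {..<R}" "\<pi> ` {..<R} \<subseteq> {..<R}"
    and m1: "\<And>i. i < R \<Longrightarrow> \<exists>\<beta>. norm (g u 0 a (\<pi> i) - \<beta> *\<^sub>R g v 0 a i) \<le> \<epsilon> * D ^ 18"
    and m2: "\<And>i. i < R \<Longrightarrow> \<exists>\<beta>. norm (g u a (Suc a) (\<pi> i) - \<beta> *\<^sub>R g v a (Suc a) i) \<le> \<epsilon> * D ^ 18"
    and m3: "\<And>i. i < R \<Longrightarrow> \<exists>\<beta>. norm (g u (Suc a) l (\<pi> i) - \<beta> *\<^sub>R g v (Suc a) l i) \<le> \<epsilon> * D ^ 18"
    using G.common_matching by blast
  have fac: "\<exists>\<mu>. norm (u j (\<pi> i) - \<mu> *\<^sub>R v j i) \<le> \<epsilon> * D ^ 19"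
    if i: "i < R" and j: "b \<le> j" "j < c" "c \<le> l" and m: "\<exists>\<beta>. norm (g u b c (\<pi> i) - \<beta> *\<^sub>R g v b c i) \<le> \<epsilon> * D ^ 18"
    for i j b c
  proof -
    have "\<pi> i < R" using \<pi> i by auto
    have "\<exists>w. norm w \<le> \<tau> j \<and> inner (u j (\<pi> i)) w = 1" if "j < l" for j
      using robust_dualsE[OF duals[OF that], of "{\<pi> i}" "\<pi> i"] k[OF that] \<open>\<pi> i < R\<close> by auto
    then obtain w where w: "\<And>j. j < l \<Longrightarrow> norm (w j) \<le> \<tau> j \<and> inner (u j (\<pi> i)) (w j) = 1" by metis
    obtain \<beta> where \<beta>: "norm (g u b c (\<pi> i) - \<beta> *\<^sub>R g v b c i) \<le> \<epsilon> * D ^ 18" using m by blast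
    \<comment> \<open>Passing from a block to one factor costs the dual vectors of the other modes
      in the block, hence one more power of \<open>D\<close>.\<close>
    obtain \<mu> where "norm (u j (\<pi> i) - \<mu> *\<^sub>R v j i) \<le> (\<epsilon> * D ^ 18) * (\<Prod>i\<in>{b..<c} - {j}. \<tau> i)"
      using tens_range_factor_match[OF j(1,2) _ _ \<beta>[unfolded g_def], of w \<tau>] w j(3) by auto
    also have "\<dots> \<le> (\<epsilon> * D ^ 18) * D"
      using eps0 D_ge1 by (intro mult_left_mono prod_le_D) (use j params param_le in force)+
    finally show ?thesis by (auto simp: power_numeral_reduce mult_ac)
  qed
  show ?thesis
  proof (rule that[OF \<pi>])
    fix i j assume i: "i < R" and j: "j < l"
    consider "0 \<le> j" "j < a" | "a \<le> j" "j < Suc a" | "Suc a \<le> j" "j < l" using j by linarith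
    then show "\<exists>\<mu>. norm (u j (\<pi> i) - \<mu> *\<^sub>R v j i) \<le> \<epsilon> * D ^ 19"
      by cases (use fac[OF i _ _ _ m1[OF i]] fac[OF i _ _ _ m2[OF i]] fac[OF i _ _ _ m3[OF i]] a(1) in auto)
  qed
qed

section \<open>Scalars of the matched columns\<close>

text \<open>The scalars of the individual matches carry no information on their product, which only
  the whole tensor sees. They are therefore replaced by pairings with dual vectors at
  \<open>\<pi> i\<close> that jointly annihilate all other columns: the product of the
  \<open>\<theta> j i\<close> is then literally the \<open>i\<close>-th term of the contracted
  tensor of the \<open>v j\<close>, and the contracted tensor of the \<open>u j\<close> equals
  1.\<close>

theorem recovery:
  obtains \<pi> \<theta> where "inj_on \<pi> {..<R}" "\<pi> ` {..<R} \<subseteq> {..<R}"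
    "\<And>i j. i < R \<Longrightarrow> j < l \<Longrightarrow> norm (v j i - \<theta> j i *\<^sub>R u j (\<pi> i)) \<le> \<epsilon> * D ^ 25"
    "\<And>i. i < R \<Longrightarrow> \<bar>(\<Prod>j<l. \<theta> j i) - 1\<bar> \<le> \<epsilon> * D ^ 26"
proof -
  obtain \<pi> where \<pi>: "inj_on \<pi> {..<R}" "\<pi> ` {..<R} \<subseteq> {..<R}"
    and m: "\<And>i j. i < R \<Longrightarrow> j < l \<Longrightarrow> \<exists>\<mu>. norm (u j (\<pi> i) - \<mu> *\<^sub>R v j i) \<le> \<epsilon> * D ^ 19"
    by (rule matching_factors) blast
  have \<pi>R: "\<pi> i < R" if "i < R" for i using \<pi> that by auto
  define \<eta> where "\<eta> = \<epsilon> * D ^ 19"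
  have \<eta>: "\<eta> * D\<^sup>2 < 1" "0 \<le> \<eta>"
    using eps_power[of 21] eps0 D_ge1 by (auto simp: \<eta>_def mult.assoc power_add[symmetric])
  have nu: "1 \<le> D * norm (u j r)" if "j < l" "r < R" for j r
    using robust_duals_norm[OF robust_duals_mono[OF duals[OF that(1)] order_refl single_le_D(1)[OF that(1)]] _ that(2)]
      k[OF that(1)] by auto
  have nv: "norm (v j r) \<le> D" if "j < l" "r < R" for j r
    using bnd_v[OF that] single_le_D(2)[OF that(1)] by linarith
  have "\<exists>P w. (\<forall>j<l. norm (w j) \<le> \<tau> j \<and> inner (u j q) (w j) = 1 \<and> (\<forall>s\<in>P j. inner (u j s) (w j) = 0)) \<and>
      {..<R} - {q} \<subseteq> (\<Union>j<l. P j)" if q: "q < R" for q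
  proof -
    have "(\<Sum>j<l. k j) = (\<Sum>j<l. (k j - 1) + 1)" using k by (intro sum.cong) force+
    also have "\<dots> = (\<Sum>j<l. k j - 1) + l" unfolding sum.distrib by simp
    finally have "card {..<R} \<le> 1 + (\<Sum>j<l. k j - 1)" using k_sum q by simp
    then obtain P w where "\<And>j. j \<in> {..<l} \<Longrightarrow> norm (w j) \<le> \<tau> j" "\<And>j. j \<in> {..<l} \<Longrightarrow> inner (u j q) (w j) = 1"
      "\<And>j s. j \<in> {..<l} \<Longrightarrow> s \<in> P j \<Longrightarrow> inner (u j s) (w j) = 0" "{..<R} - {q} \<subseteq> (\<Union>j<l. P j)"
      using common_duals[where J = "{..<l}" and x = u and \<tau> = \<tau> and k = k and I = "{..<R}" and R = R and r = q]
        duals k q by (smt (verit, ccfv_threshold) finite_lessThan lessThan_iff order_refl one_le_numeral order_trans)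
    then show ?thesis by (intro exI[of _ P] exI[of _ w]) auto
  qed
  then obtain P w where w: "\<And>q j. q < R \<Longrightarrow> j < l \<Longrightarrow> norm (w q j) \<le> \<tau> j \<and> inner (u j q) (w q j) = 1"
    and w0: "\<And>q j s. q < R \<Longrightarrow> j < l \<Longrightarrow> s \<in> P q j \<Longrightarrow> inner (u j s) (w q j) = 0"
    and P: "\<And>q. q < R \<Longrightarrow> {..<R} - {q} \<subseteq> (\<Union>j<l. P q j)" by metis
  define \<theta> where "\<theta> j i = inner (v j i) (w (\<pi> i) j)" for j i
  show ?thesis
  proof (rule that[OF \<pi>, of \<theta>])
    fix i j assume i: "i < R" and j: "j < l"
    obtain \<mu> where \<mu>: "norm (u j (\<pi> i) - \<mu> *\<^sub>R v j i) \<le> \<eta>" using m[OF i j] by (auto simp: \<eta>_def)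
    have \<mu>1: "1 \<le> D ^ 3 * \<bar>\<mu>\<bar>"
      by (rule match_scale_bound[OF D2 nu[OF j \<pi>R[OF i]] nv[OF j i] \<mu> \<eta>(1)])
    then have \<mu>0: "\<mu> \<noteq> 0" by auto
    define e where "e = v j i - (1 / \<mu>) *\<^sub>R u j (\<pi> i)"
    have "norm e \<le> D ^ 3 * \<bar>\<mu>\<bar> * norm e" using \<mu>1 mult_right_mono[of 1 "D ^ 3 * \<bar>\<mu>\<bar>" "norm e"] by simp
    also have "\<dots> = D ^ 3 * norm (\<mu> *\<^sub>R e)" by simp
    also have "\<mu> *\<^sub>R e = - (u j (\<pi> i) - \<mu> *\<^sub>R v j i)" using \<mu>0 by (simp add: e_def scaleR_diff_right)
    also have "D ^ 3 * norm (- (u j (\<pi> i) - \<mu> *\<^sub>R v j i)) \<le> D ^ 3 * \<eta>"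
      unfolding norm_minus_cancel using \<mu> D_ge1 by (intro mult_left_mono) auto
    finally have e: "norm e \<le> D ^ 3 * \<eta>" .
    note w1 = w[OF \<pi>R[OF i] j]
    \<comment> \<open>This eliminates the unknown \<open>\<mu>\<close>: the new scalar differs from
      \<open>1 / \<mu>\<close> only by a pairing with the error \<open>e\<close>.\<close>
    have "\<theta> j i = 1 / \<mu> + inner e (w (\<pi> i) j)"
      using w1 by (simp add: \<theta>_def e_def inner_diff_left)
    then have "v j i - \<theta> j i *\<^sub>R u j (\<pi> i) = e - inner e (w (\<pi> i) j) *\<^sub>R u j (\<pi> i)"
      by (simp add: e_def scaleR_add_left)
    also have "norm \<dots> \<le> norm e + \<bar>inner e (w (\<pi> i) j)\<bar> * norm (u j (\<pi> i))"
      using norm_triangle_ineq4[of e "inner e (w (\<pi> i) j) *\<^sub>R u j (\<pi> i)"] by simp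
    also have "\<dots> \<le> norm e + (norm e * \<tau> j) * \<rho> j"
    proof (intro add_left_mono mult_mono)
      have "\<bar>inner e (w (\<pi> i) j)\<bar> \<le> norm e * norm (w (\<pi> i) j)" by (rule Cauchy_Schwarz_ineq2)
      also have "\<dots> \<le> norm e * \<tau> j" using w1 by (intro mult_left_mono) auto
      finally show "\<bar>inner e (w (\<pi> i) j)\<bar> \<le> norm e * \<tau> j" .
    qed (use bnd_u[OF j \<pi>R[OF i]] params[OF j] in auto)
    also have "\<dots> = norm e * (1 + \<tau> j * \<rho> j)" by (simp add: algebra_simps)
    also have "\<dots> \<le> (D ^ 3 * \<eta>) * (D * D)"
    proof (intro mult_mono e)
      have "1 + \<tau> j * \<rho> j \<le> D + D" using single_le_D(3)[OF j] D_ge1 by linarith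
      also have "\<dots> \<le> D * D" using mult_right_mono[OF D2 D_ge1(3)] by simp
      finally show "1 + \<tau> j * \<rho> j \<le> D * D" .
    qed (use \<eta> D_ge1 params[OF j] in auto)
    also have "\<dots> = \<epsilon> * D ^ 24" by (simp add: \<eta>_def power_numeral_reduce mult_ac)
    also have "\<dots> \<le> \<epsilon> * D ^ 25" by (rule eps_power_mono) simp
    finally show "norm (v j i - \<theta> j i *\<^sub>R u j (\<pi> i)) \<le> \<epsilon> * D ^ 25" .
  next
    fix i assume i: "i < R"
    define q where "q = \<pi> i"
    have q: "q < R" using \<pi>R[OF i] by (simp add: q_def)
    have T: "inner (tens_range x 0 l) (tens_range y 0 l) = (\<Prod>j<l. inner (x j) (y j))" for x y
      by (simp add: inner_tens_range atLeast0LessThan)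
    have "norm (tens_range (w q) 0 l) \<le> (\<Prod>j<l. \<tau> j)"
      unfolding norm_tens_range atLeast0LessThan by (rule prod_mono) (use w[OF q] in auto)
    also have "\<dots> \<le> D" by (rule prod_le_D) (use params param_le in force)+
    finally have "\<epsilon> * norm (tens_range (w q) 0 l) \<le> \<epsilon> * D" using eps0 by (rule mult_left_mono)
    then have close: "\<bar>(\<Sum>r<R. \<Prod>j<l. inner (u j r) (w q j)) - (\<Sum>r<R. \<Prod>j<l. inner (v j r) (w q j))\<bar> \<le> \<epsilon> * D"
      using close_contraction[of "\<lambda>x. tens_range x 0 l" "tens_range (w q) 0 l", OF T] unfolding T by linarith
    have "(\<Prod>j<l. inner (u j r) (w q j)) = (if r = q then 1 else 0)" if r: "r < R" for r
    proof (cases "r = q")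
      case True
      then show ?thesis using w[OF q] by (auto intro!: prod.neutral)
    next
      case False
      then obtain j where "j < l" "r \<in> P q j" using P[OF q] r by auto
      then show ?thesis using w0[OF q] False by (auto intro!: prod_zero)
    qed
    then have lhs: "(\<Sum>r<R. \<Prod>j<l. inner (u j r) (w q j)) = 1" using q by simp
    \<comment> \<open>The column \<open>\<pi> r\<close> differs from \<open>q\<close>, so it is
      annihilated in some mode; there \<open>v j r\<close> is almost annihilated, and the other
      modes contribute at most a product of \<open>\<tau> j' * \<rho>' j'\<close>.\<close>
    have small: "\<bar>\<Prod>j<l. inner (v j r) (w q j)\<bar> \<le> D ^ 4 * \<eta> * D" if r: "r < R" "r \<noteq> i" for r
    proof -
      have "\<pi> r \<noteq> q" using \<pi>(1) r i by (auto simp: q_def inj_on_def)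
      then obtain j where j: "j < l" "\<pi> r \<in> P q j" using P[OF q] \<pi>R[OF r(1)] by auto
      obtain \<mu> where \<mu>: "norm (u j (\<pi> r) - \<mu> *\<^sub>R v j r) \<le> \<eta>" using m[OF r(1) j(1)] by (auto simp: \<eta>_def)
      have "norm (w q j) \<le> D" using w[OF q j(1)] single_le_D(1)[OF j(1)] by linarith
      then have 1: "\<bar>inner (v j r) (w q j)\<bar> \<le> D ^ 4 * \<eta>"
        by (intro match_orthogonal_bound[OF D2 nu[OF j(1) \<pi>R[OF r(1)]] nv[OF j(1) r(1)] \<mu> \<eta>(1) w0[OF q j]])
      have "(\<Prod>j'\<in>{..<l} - {j}. \<bar>inner (v j' r) (w q j')\<bar>) \<le> (\<Prod>j'\<in>{..<l} - {j}. \<tau> j' * \<rho>' j')"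
      proof (rule prod_mono)
        fix j' assume "j' \<in> {..<l} - {j}"
        then have j': "j' < l" by simp
        have "\<bar>inner (v j' r) (w q j')\<bar> \<le> norm (v j' r) * norm (w q j')" by (rule Cauchy_Schwarz_ineq2)
        also have "\<dots> \<le> \<rho>' j' * \<tau> j'"
          using bnd_v[OF j' r(1)] w[OF q j'] params[OF j'] by (intro mult_mono) auto
        finally show "0 \<le> \<bar>inner (v j' r) (w q j')\<bar> \<and> \<bar>inner (v j' r) (w q j')\<bar> \<le> \<tau> j' * \<rho>' j'"
          by (simp add: mult.commute)
      qed
      also have "\<dots> \<le> D" by (rule prod_le_D) (use params param_le in force)+
      finally have 2: "(\<Prod>j'\<in>{..<l} - {j}. \<bar>inner (v j' r) (w q j')\<bar>) \<le> D" .
      have "\<bar>\<Prod>j<l. inner (v j r) (w q j)\<bar> =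
          \<bar>inner (v j r) (w q j)\<bar> * (\<Prod>j'\<in>{..<l} - {j}. \<bar>inner (v j' r) (w q j')\<bar>)"
        unfolding abs_prod using j by (intro prod.remove) auto
      also have "\<dots> \<le> (D ^ 4 * \<eta>) * D"
        by (rule mult_mono[OF 1 2]) (use \<eta> D_ge1 in \<open>auto intro!: prod_nonneg\<close>)
      finally show ?thesis .
    qed
    have "(\<Sum>r<R. \<Prod>j<l. inner (v j r) (w q j)) =
        (\<Prod>j<l. \<theta> j i) + (\<Sum>r\<in>{..<R} - {i}. \<Prod>j<l. inner (v j r) (w q j))"
      using i by (subst sum.remove[of _ i]) (auto simp: \<theta>_def q_def)
    moreover have "\<bar>\<Sum>r\<in>{..<R} - {i}. \<Prod>j<l. inner (v j r) (w q j)\<bar> \<le> (\<Sum>r\<in>{..<R} - {i}. D ^ 4 * \<eta> * D)"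
      by (rule order_trans[OF sum_abs]) (rule sum_mono, use small in auto)
    moreover have "(\<Sum>r\<in>{..<R} - {i}. D ^ 4 * \<eta> * D) \<le> D * (D ^ 4 * \<eta> * D)"
    proof -
      have "real (card ({..<R} - {i})) \<le> D" using RD card_mono[of "{..<R}" "{..<R} - {i}"] by simp
      then show ?thesis unfolding sum_constant using \<eta> D_ge1 by (intro mult_right_mono) auto
    qed
    moreover have "D * (D ^ 4 * \<eta> * D) = \<epsilon> * D ^ 25" by (simp add: \<eta>_def power_numeral_reduce mult_ac)
    moreover have "\<epsilon> * D \<le> \<epsilon> * D ^ 25" using eps_power_mono[of 1 25] by simp
    ultimately have "\<bar>(\<Prod>j<l. \<theta> j i) - 1\<bar> \<le> 2 * (\<epsilon> * D ^ 25)" using close lhs by linarith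
    also have "\<dots> \<le> D * (\<epsilon> * D ^ 25)" using D2 eps0 D_ge1 by (intro mult_right_mono) auto
    also have "\<dots> = \<epsilon> * D ^ 26" by (simp add: power_numeral_reduce mult_ac)
    finally show "\<bar>(\<Prod>j<l. \<theta> j i) - 1\<bar> \<le> \<epsilon> * D ^ 26" .
  qed
qed

end

section \<open>Matrices and the main theorem\<close>

lemma euclidean_norm_column:
  assumes "A \<in> carrier_mat n R" "r < R"
  shows "euclidean_norm (col A r) = norm (column_fvec n A r)"
  using assms
  by (simp add: euclidean_norm_def column_fvec_def norm_eq_sqrt_inner inner_fvec_of power2_eq_square)

text \<open>After expanding the square, a sum over multi-indices of products over the modes factors
  into a product of sums, one inner product of columns per mode.\<close>

lemma tensor_frobenius_norm_gram:
  assumes U: "\<And>j. j < l \<Longrightarrow> U j \<in> carrier_mat (n j) R" and V: "\<And>j. j < l \<Longrightarrow> V j \<in> carrier_mat (n j) R"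
  defines "u j \<equiv> column_fvec (n j) (U j)" and "v j \<equiv> column_fvec (n j) (V j)"
  shows "(tensor_frobenius_norm l n (tensor_diff (cp_tensor l R V) (cp_tensor l R U)))\<^sup>2 =
    (\<Sum>r<R. \<Sum>s<R. \<Prod>j<l. inner (v j r) (v j s)) - 2 * (\<Sum>r<R. \<Sum>s<R. \<Prod>j<l. inner (v j r) (u j s))
      + (\<Sum>r<R. \<Sum>s<R. \<Prod>j<l. inner (u j r) (u j s))"
proof -
  define I where "I = (\<Pi>\<^sub>E j\<in>{..<l}. {..<n j})"
  define x where "x A i r = (\<Prod>j<l. A j $$ (i j, r))" for A :: "nat \<Rightarrow> real mat" and i r
  have cp: "cp_tensor l R A i = (\<Sum>r<R. x A i r)"
    if "i \<in> I" "\<And>j. j < l \<Longrightarrow> A j \<in> carrier_mat (n j) R" for A i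
    unfolding cp_tensor_def outer_product_def x_def
    by (intro sum.cong prod.cong) (use that carrier_matD in \<open>fastforce simp: I_def PiE_iff intro!: index_col\<close>)+
  have swap: "(\<Sum>i\<in>I. \<Sum>r<R. \<Sum>s<R. x A i r * x B i s) =
      (\<Sum>r<R. \<Sum>s<R. \<Prod>j<l. inner (column_fvec (n j) (A j) r) (column_fvec (n j) (B j) s))" for A B
  proof -
    have entries: "(\<Sum>i\<in>I. x A i r * x B i s) = (\<Prod>j<l. inner (column_fvec (n j) (A j) r) (column_fvec (n j) (B j) s))" for r s
      unfolding x_def I_def prod.distrib[symmetric] column_fvec_def inner_fvec_of
      by (rule prod_sum_PiE[symmetric]) auto
    have "(\<Sum>i\<in>I. \<Sum>r<R. \<Sum>s<R. x A i r * x B i s) = (\<Sum>r<R. \<Sum>s<R. \<Sum>i\<in>I. x A i r * x B i s)"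
      by (subst sum.swap) (intro sum.cong refl sum.swap)
    then show ?thesis unfolding entries .
  qed
  have "(tensor_frobenius_norm l n (tensor_diff (cp_tensor l R V) (cp_tensor l R U)))\<^sup>2 =
      (\<Sum>i\<in>I. ((\<Sum>r<R. x V i r) - (\<Sum>r<R. x U i r))\<^sup>2)"
    unfolding tensor_frobenius_norm_def I_def[symmetric]
    by (simp add: sum_nonneg tensor_diff_def cp U V)
  also have "\<dots> = (\<Sum>i\<in>I. (\<Sum>r<R. \<Sum>s<R. x V i r * x V i s) - 2 * (\<Sum>r<R. \<Sum>s<R. x V i r * x U i s)
      + (\<Sum>r<R. \<Sum>s<R. x U i r * x U i s))"
    using norm_diff_sums[of "x V _" "{..<R}" "x U _"] by (intro sum.cong refl) simp
  also have "\<dots> = (\<Sum>i\<in>I. \<Sum>r<R. \<Sum>s<R. x V i r * x V i s) - 2 * (\<Sum>i\<in>I. \<Sum>r<R. \<Sum>s<R. x V i r * x U i s)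
      + (\<Sum>i\<in>I. \<Sum>r<R. \<Sum>s<R. x U i r * x U i s)"
    by (simp add: sum.distrib sum_subtractf sum_distrib_left)
  finally show ?thesis unfolding swap u_def v_def .
qed

section \<open>Diagonal matrices\<close>

definition diagonal :: "nat \<Rightarrow> (nat \<Rightarrow> real) \<Rightarrow> real mat" where
  "diagonal R d = mat R R (\<lambda>(i, j). if i = j then d i else 0)"

lemma diagonal_carrier: "diagonal R d \<in> carrier_mat R R" "diagonal_mat (diagonal R d)"
  by (auto simp: diagonal_def diagonal_mat_def)

lemma mult_diagonal:
  assumes A: "A \<in> carrier_mat m R" and i: "i < m" "r < R"
  shows "(A * diagonal R d) $$ (i, r) = A $$ (i, r) * d r"
proof -
  have "(A * diagonal R d) $$ (i, r) = (\<Sum>s = 0..<R. A $$ (i, s) * (if s = r then d s else 0))"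
    using A i by (simp add: diagonal_def scalar_prod_def)
  also have "\<dots> = (\<Sum>s = 0..<R. if s = r then A $$ (i, r) * d r else 0)" by (rule sum.cong) auto
  finally show ?thesis using i by simp
qed

lemma mat_product_diagonal: "mat_product R l (\<lambda>j. diagonal R (d j)) = diagonal R (\<lambda>r. \<Prod>j<l. d j r)"
proof -
  have "foldr (*) (map (\<lambda>j. diagonal R (d j)) js) (1\<^sub>m R) = diagonal R (\<lambda>r. \<Prod>j\<leftarrow>js. d j r)" for js
  proof (induction js)
    case Nil
    show ?case by (rule eq_matI) (auto simp: diagonal_def)
  next
    case (Cons j js)
    have "foldr (*) (map (\<lambda>j. diagonal R (d j)) (j # js)) (1\<^sub>m R) =
        diagonal R (d j) * diagonal R (\<lambda>r. \<Prod>j\<leftarrow>js. d j r)" using Cons.IH by simp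
    also have "\<dots> = diagonal R (\<lambda>r. \<Prod>j\<leftarrow>j # js. d j r)"
    proof (rule eq_matI)
      fix i r assume "i < dim_row (diagonal R (\<lambda>r. \<Prod>j\<leftarrow>j # js. d j r))"
        "r < dim_col (diagonal R (\<lambda>r. \<Prod>j\<leftarrow>j # js. d j r))"
      then have "i < R" "r < R" by (auto simp: diagonal_def)
      then show "(diagonal R (d j) * diagonal R (\<lambda>r. \<Prod>j\<leftarrow>js. d j r)) $$ (i, r) =
          diagonal R (\<lambda>r. \<Prod>j\<leftarrow>j # js. d j r) $$ (i, r)"
        by (subst mult_diagonal[OF diagonal_carrier(1)]) (auto simp: diagonal_def)
    qed (auto simp: diagonal_def)
    finally show ?case .
  qed
  moreover have "(\<Prod>j\<leftarrow>[0..<l]. d j r) = (\<Prod>j<l. d j r)" for r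
    using prod.distinct_set_conv_list[of "[0..<l]" "\<lambda>j. d j r"] by (simp add: atLeast0LessThan)
  ultimately show ?thesis by (simp add: mat_product_def)
qed

text \<open>The induction step is \<open>(x - 1) * (y - 1) \<ge> 1\<close> for \<open>x\<close> and
  \<open>y\<close> at least 2. It is applied to the dimensions in order to bound
  \<open>R\<close>.\<close>

lemma sum_le_prod:
  fixes n :: "nat \<Rightarrow> nat"
  assumes "\<And>j. j < l \<Longrightarrow> 2 \<le> n j" "1 \<le> l"
  shows "(\<Sum>j<l. n j) \<le> (\<Prod>j<l. n j) \<and> 2 \<le> (\<Prod>j<l. n j)"
  using assms
proof (induction l)
  case (Suc l)
  show ?case
  proof (cases "l = 0")
    case True
    then show ?thesis using Suc.prems by simp
  next
    case False
    define p where "p = (\<Prod>j<l. n j)"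
    have IH: "(\<Sum>j<l. n j) \<le> p" "2 \<le> p" using Suc False by (auto simp: p_def)
    have n: "2 \<le> n l" using Suc.prems by simp
    have "p + n l \<le> p * n l"
    proof -
      obtain x y where "p = x + 2" "n l = y + 2" using IH(2) n by (metis le_add_diff_inverse2)
      then show ?thesis by (simp add: algebra_simps)
    qed
    moreover have "2 \<le> p + n l" using n by simp
    ultimately show ?thesis using IH by (simp add: p_def[symmetric])
  qed
qed simp

lemma frobenius_norm_le:
  assumes A: "A \<in> carrier_mat m R" and le: "\<And>r. r < R \<Longrightarrow> (\<Sum>i<m. (A $$ (i, r))\<^sup>2) \<le> B\<^sup>2" and B: "0 \<le> B"
  shows "frobenius_norm A \<le> real R * B"
proof (cases "R = 0")
  case True
  then show ?thesis using A by (simp add: frobenius_norm_def)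
next
  case False
  have "(\<Sum>i<m. \<Sum>j<R. (A $$ (i, j))\<^sup>2) = (\<Sum>j<R. \<Sum>i<m. (A $$ (i, j))\<^sup>2)" by (rule sum.swap)
  also have "\<dots> \<le> (\<Sum>j<R. B\<^sup>2)" by (rule sum_mono) (use le in auto)
  also have "\<dots> = real R * B\<^sup>2" by simp
  also have "\<dots> \<le> (real R * real R) * B\<^sup>2"
    using False by (intro mult_right_mono) (auto simp: mult_le_cancel_left1 Suc_leI)
  also have "\<dots> = (real R * B)\<^sup>2" by (simp add: power2_eq_square)
  finally have "sqrt (\<Sum>i<m. \<Sum>j<R. (A $$ (i, j))\<^sup>2) \<le> real R * B"
    using B by (intro real_le_lsqrt) auto
  then show ?thesis using A by (simp add: frobenius_norm_def)
qed

section \<open>Choice of \<open>D\<close> and assembly of the matrices\<close>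

lemma robust_tensor_uniqueness:
  fixes U V :: "nat \<Rightarrow> real mat"
  assumes l: "1 \<le> l" and params: "\<And>j. j < l \<Longrightarrow> 1 \<le> \<tau> j \<and> 1 \<le> \<rho> j \<and> 1 \<le> \<rho>' j"
    and U: "\<And>j. j < l \<Longrightarrow> U j \<in> carrier_mat (n j) R" "\<And>j. j < l \<Longrightarrow> column_bounded (\<rho> j) (U j)"
    and K: "\<And>j. j < l \<Longrightarrow> K_rank (\<tau> j) (U j) = k j" "\<And>j. j < l \<Longrightarrow> 2 \<le> k j"
    and k_sum: "2 * R + l \<le> (\<Sum>j<l. k j) + 1"
    and \<epsilon>': "0 < \<epsilon>'" "\<epsilon>' < 1"
    and V: "\<And>j. j < l \<Longrightarrow> V j \<in> carrier_mat (n j) R" "\<And>j. j < l \<Longrightarrow> column_bounded (\<rho>' j) (V j)"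
    and close: "tensor_frobenius_norm l n (tensor_diff (cp_tensor l R V) (cp_tensor l R U)) \<le>
      (\<epsilon>' / real R) ^ (2 ^ l) * (\<Prod>j<l. (\<tau> j * \<rho> j * \<rho>' j * real (n j)) powr (- 30))"
  shows "\<exists>P L. permutation_matrix R P \<and> (\<forall>j<l. L j \<in> carrier_mat R R \<and> diagonal_mat (L j)) \<and>
    frobenius_norm (mat_product R l L - 1\<^sub>m R) \<le> \<epsilon>' \<and>
    (\<forall>j<l. frobenius_norm (V j - U j * P * L j) \<le> \<epsilon>')"
proof -
  define u where "u j = column_fvec (n j) (U j)" for j
  define v where "v j = column_fvec (n j) (V j)" for j
  have kR: "k j \<le> R" and duals: "robust_duals R (k j) (\<tau> j) (u j)" if "j < l" for j
    using K_rank_robust_duals[OF U(1)[OF that] K(1)[OF that]] K(2)[OF that] params[OF that]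
    by (auto simp: u_def)
  have kn: "k j \<le> n j" if "j < l" for j
    using robust_duals_le_dimension[OF duals[OF that, unfolded u_def] kR[OF that]] .
  then have n2: "2 \<le> n j" if "j < l" for j using K(2) that order_trans by blast
  have R2: "2 \<le> R" using kR[of 0] K(2)[of 0] l by simp
  define N where "N = (\<Prod>j<l. n j)"
  have N: "(\<Sum>j<l. n j) \<le> N" "2 \<le> N" using sum_le_prod[OF n2 l] by (auto simp: N_def)
  have "(\<Sum>j<l. k j) \<le> (\<Sum>j<l. n j)" by (rule sum_mono) (use kn in auto)
  then have RN: "R \<le> N" using k_sum l N R2 by linarith
  \<comment> \<open>The parameters alone give only \<open>1 \<le> p\<close>; the factor
    \<open>N\<close> lifts \<open>D\<close> above both 2 and \<open>R\<close>.\<close>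
  define D where "D = (\<Prod>j<l. \<tau> j * \<rho> j * \<rho>' j * real (n j))"
  define p where "p = (\<Prod>j<l. \<tau> j * \<rho> j * \<rho>' j)"
  have Dp: "D = p * real N" by (simp add: D_def p_def N_def prod.distrib)
  have "1 \<le> p" unfolding p_def
  proof (rule prod_ge_1)
    fix j assume "j \<in> {..<l}"
    then have "1 * 1 * 1 \<le> \<tau> j * \<rho> j * \<rho>' j" using params[of j] by (intro mult_mono) auto
    then show "1 \<le> \<tau> j * \<rho> j * \<rho>' j" by simp
  qed
  then have ND: "real N \<le> D" and pD: "p \<le> D"
    using N mult_right_mono[of 1 p "real N"] mult_left_mono[of 1 "real N" p] by (auto simp: Dp)
  have D2: "2 \<le> D" and RD: "real R \<le> D" using ND N(2) RN by linarith+
  define \<epsilon> where "\<epsilon> = (\<epsilon>' / real R) ^ (2 ^ l) * (\<Prod>j<l. (\<tau> j * \<rho> j * \<rho>' j * real (n j)) powr (- 30))"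
  have "(\<Prod>j<l. (\<tau> j * \<rho> j * \<rho>' j * real (n j)) powr (- 30)) = D powr (- 30)"
    unfolding D_def by (rule prod_powr_distrib[symmetric])
  also have "\<dots> = inverse (D ^ 30)" using D2 by (simp add: powr_minus)
  finally have \<epsilon>: "\<epsilon> * D ^ 30 = (\<epsilon>' / real R) ^ (2 ^ l)" using D2 by (simp add: \<epsilon>_def)
  also have "\<dots> \<le> (\<epsilon>' / real R) ^ 1"
    using \<epsilon>' R2 by (intro power_decreasing) (auto simp: divide_le_eq)
  also have "\<dots> \<le> \<epsilon>'" using \<epsilon>' R2 by (simp add: divide_le_eq mult_le_cancel_left1)
  finally have \<epsilon>D: "\<epsilon> * D ^ 30 \<le> \<epsilon>'" .
  have \<epsilon>0: "0 \<le> \<epsilon>" unfolding \<epsilon>_def using \<epsilon>' by (intro mult_nonneg_nonneg prod_nonneg) auto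
  interpret close_tensors l R k \<tau> \<rho> \<rho>' D \<epsilon> u v
  proof
    show "norm (u j r) \<le> \<rho> j" if "j < l" "r < R" for j r
      using U(2)[OF that(1)] euclidean_norm_column[OF U(1)[OF that(1)] that(2)] carrier_matD(2)[OF U(1)[OF that(1)]] that(2)
      by (auto simp: column_bounded_def u_def)
    show "norm (v j r) \<le> \<rho>' j" if "j < l" "r < R" for j r
      using V(2)[OF that(1)] euclidean_norm_column[OF V(1)[OF that(1)] that(2)] carrier_matD(2)[OF V(1)[OF that(1)]] that(2)
      by (auto simp: column_bounded_def v_def)
    have "0 \<le> tensor_frobenius_norm l n (tensor_diff (cp_tensor l R V) (cp_tensor l R U))"
      by (simp add: tensor_frobenius_norm_def sum_nonneg)
    then have "(tensor_frobenius_norm l n (tensor_diff (cp_tensor l R V) (cp_tensor l R U)))\<^sup>2 \<le> \<epsilon>\<^sup>2"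
      using close unfolding \<epsilon>_def[symmetric] by (intro power_mono)
    then show "(\<Sum>r<R. \<Sum>s<R. \<Prod>j<l. inner (v j r) (v j s)) - 2 * (\<Sum>r<R. \<Sum>s<R. \<Prod>j<l. inner (v j r) (u j s))
      + (\<Sum>r<R. \<Sum>s<R. \<Prod>j<l. inner (u j r) (u j s)) \<le> \<epsilon>\<^sup>2"
      unfolding u_def v_def using tensor_frobenius_norm_gram[of l U n R V] U(1) V(1) by simp
  qed (use D2 RD \<epsilon>0 \<epsilon>D \<epsilon>' params pD l K(2) kR k_sum duals in \<open>auto simp: p_def\<close>)
  obtain \<pi> \<theta> where \<pi>: "inj_on \<pi> {..<R}" "\<pi> ` {..<R} \<subseteq> {..<R}"
    and rec: "\<And>i j. i < R \<Longrightarrow> j < l \<Longrightarrow> norm (v j i - \<theta> j i *\<^sub>R u j (\<pi> i)) \<le> \<epsilon> * D ^ 25"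
    and unit: "\<And>i. i < R \<Longrightarrow> \<bar>(\<Prod>j<l. \<theta> j i) - 1\<bar> \<le> \<epsilon> * D ^ 26"
    using recovery by blast
  have final: "real R * (\<epsilon> * D ^ 26) \<le> \<epsilon>'"
  proof -
    have "real R * (\<epsilon> * D ^ 26) \<le> D * (\<epsilon> * D ^ 26)" using RD \<epsilon>0 D2 by (intro mult_right_mono) auto
    also have "\<dots> = \<epsilon> * D ^ 27" by (simp add: power_numeral_reduce mult_ac)
    also have "\<dots> \<le> \<epsilon> * D ^ 30" by (rule eps_power_mono) simp
    finally show ?thesis using \<epsilon>D by simp
  qed
  \<comment> \<open>\<open>permutes\<close> demands the identity outside the index range.\<close>
  define \<pi>' where "\<pi>' x = (if x < R then \<pi> x else x)" for x
  define P :: "real mat" where "P = mat R R (\<lambda>(i, j). if i = \<pi>' j then 1 else 0)"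
  have "\<pi>' permutes {..<R}"
  proof (rule bij_imp_permutes)
    have "inj_on \<pi>' {..<R}" using \<pi>(1) by (auto simp: inj_on_def \<pi>'_def)
    moreover have "\<pi>' ` {..<R} \<subseteq> {..<R}" using \<pi>(2) by (auto simp: \<pi>'_def)
    ultimately show "bij_betw \<pi>' {..<R} {..<R}" by (auto simp: bij_betw_def endo_inj_surj)
  qed (simp add: \<pi>'_def)
  then have perm: "permutation_matrix R P" unfolding permutation_matrix_def P_def by blast
  define L where "L j = diagonal R (\<theta> j)" for j
  have UP: "(U j * P * L j) $$ (i, r) = \<theta> j r * U j $$ (i, \<pi> r)" if j: "j < l" and i: "i < n j" "r < R" for i j r
  proof -
    have c: "U j * P \<in> carrier_mat (n j) R" using U(1)[OF j] by (simp add: P_def)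
    have "\<pi> r < R" using \<pi> i by auto
    have "(U j * P) $$ (i, r) = (\<Sum>s = 0..<R. U j $$ (i, s) * (if s = \<pi> r then 1 else 0))"
      using U(1)[OF j] i by (simp add: P_def scalar_prod_def \<pi>'_def)
    also have "\<dots> = (\<Sum>s = 0..<R. if s = \<pi> r then U j $$ (i, \<pi> r) else 0)" by (rule sum.cong) auto
    finally have "(U j * P) $$ (i, r) = U j $$ (i, \<pi> r)" using \<open>\<pi> r < R\<close> by simp
    then show ?thesis unfolding L_def mult_diagonal[OF c i] by simp
  qed
  have "frobenius_norm (mat_product R l L - 1\<^sub>m R) \<le> real R * (\<epsilon> * D ^ 26)"
  proof (rule frobenius_norm_le)
    show "mat_product R l L - 1\<^sub>m R \<in> carrier_mat R R"
      unfolding L_def mat_product_diagonal by (intro minus_carrier_mat) simp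
    fix r assume r: "r < R"
    have "(\<Sum>i<R. ((mat_product R l L - 1\<^sub>m R) $$ (i, r))\<^sup>2) = (\<Sum>i<R. if i = r then ((\<Prod>j<l. \<theta> j r) - 1)\<^sup>2 else 0)"
      unfolding L_def mat_product_diagonal by (intro sum.cong) (use r in \<open>auto simp: diagonal_def\<close>)
    also have "\<dots> = \<bar>(\<Prod>j<l. \<theta> j r) - 1\<bar>\<^sup>2" using r by simp
    also have "\<dots> \<le> (\<epsilon> * D ^ 26)\<^sup>2" using unit[OF r] by (intro power_mono) auto
    finally show "(\<Sum>i<R. ((mat_product R l L - 1\<^sub>m R) $$ (i, r))\<^sup>2) \<le> (\<epsilon> * D ^ 26)\<^sup>2" .
  qed (use \<epsilon>0 D2 in auto)
  moreover have "frobenius_norm (V j - U j * P * L j) \<le> real R * (\<epsilon> * D ^ 26)" if j: "j < l" for j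
  proof (rule frobenius_norm_le)
    have carr: "U j * P * L j \<in> carrier_mat (n j) R"
      using U(1)[OF j] by (intro mult_carrier_mat) (auto simp: P_def L_def diagonal_def)
    show "V j - U j * P * L j \<in> carrier_mat (n j) R" using carr by (rule minus_carrier_mat)
    fix r assume r: "r < R"
    have dif: "v j r - \<theta> j r *\<^sub>R u j (\<pi> r) = fvec_of (n j) (\<lambda>i. V j $$ (i, r) - \<theta> j r * U j $$ (i, \<pi> r))"
      by (rule fvec_eqI)
        (auto simp: u_def v_def column_fvec_def minus_fvec.rep_eq scaleR_fvec.rep_eq fvec_of.rep_eq)
    have "(\<Sum>i<n j. ((V j - U j * P * L j) $$ (i, r))\<^sup>2) = (\<Sum>i<n j. (V j $$ (i, r) - \<theta> j r * U j $$ (i, \<pi> r))\<^sup>2)"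
    proof (intro sum.cong refl)
      fix i assume i: "i \<in> {..<n j}"
      have "(V j - U j * P * L j) $$ (i, r) = V j $$ (i, r) - (U j * P * L j) $$ (i, r)"
        using carr i r by (intro index_minus_mat) auto
      then show "((V j - U j * P * L j) $$ (i, r))\<^sup>2 = (V j $$ (i, r) - \<theta> j r * U j $$ (i, \<pi> r))\<^sup>2"
        using UP[OF j _ r] i by simp
    qed
    also have "\<dots> = (norm (v j r - \<theta> j r *\<^sub>R u j (\<pi> r)))\<^sup>2"
      unfolding dif power2_norm_eq_inner by (simp add: inner_fvec_of power2_eq_square)
    also have "\<dots> \<le> (\<epsilon> * D ^ 26)\<^sup>2"
      using rec[OF r j] eps_power_mono[of 25 26] by (intro power_mono) auto
    finally show "(\<Sum>i<n j. ((V j - U j * P * L j) $$ (i, r))\<^sup>2) \<le> (\<epsilon> * D ^ 26)\<^sup>2" .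
  qed (use \<epsilon>0 D2 in auto)
  ultimately show ?thesis
    using perm final diagonal_carrier by (intro exI[of _ P] exI[of _ L]) (auto simp: L_def intro: order_trans)
qed

theorem theorem2p7:
  shows "\<exists>c::real. c > 0 \<and>
    (\<forall>(l::nat) (R::nat) (n :: nat \<Rightarrow> nat) (k :: nat \<Rightarrow> nat)
       (\<tau> :: nat \<Rightarrow> real) (\<rho> :: nat \<Rightarrow> real) (\<rho>' :: nat \<Rightarrow> real) (U :: nat \<Rightarrow> real mat).
       l \<le> R \<longrightarrow>
       (\<forall>j<l. \<tau> j \<ge> 1 \<and> \<rho> j \<ge> 1 \<and> \<rho>' j \<ge> 1) \<longrightarrow>
       (\<forall>j<l. U j \<in> carrier_mat (n j) R \<and> column_bounded (\<rho> j) (U j) \<and>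
              K_rank (\<tau> j) (U j) = k j \<and> k j \<ge> 2) \<longrightarrow>
       int (\<Sum>j<l. k j) \<ge> 2 * int R + int l - 1 \<longrightarrow>
       (\<forall>\<epsilon>'::real. 0 < \<epsilon>' \<and> \<epsilon>' < 1 \<longrightarrow>
         (let T = cp_tensor l R U;
              \<epsilon> = (\<epsilon>' / real R) ^ (2 ^ l) *
                  (\<Prod>j<l. (\<tau> j * \<rho> j * \<rho>' j * real (n j)) powr (- c))
          in \<forall>V :: nat \<Rightarrow> real mat.
               (\<forall>j<l. V j \<in> carrier_mat (n j) R \<and> column_bounded (\<rho>' j) (V j)) \<longrightarrow>
               tensor_frobenius_norm l n (tensor_diff (cp_tensor l R V) T) \<le> \<epsilon> \<longrightarrow>
               (\<exists>(P :: real mat) (L :: nat \<Rightarrow> real mat).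
                  permutation_matrix R P \<and>
                  (\<forall>j<l. L j \<in> carrier_mat R R \<and> diagonal_mat (L j)) \<and>
                  frobenius_norm (mat_product R l L - 1\<^sub>m R) \<le> \<epsilon>' \<and>
                  (\<forall>j<l. frobenius_norm (V j - U j * P * L j) \<le> \<epsilon>')))))"
proof (intro exI[of _ "30 :: real"] conjI allI impI, goal_cases)
  case 1
  show ?case by simp
next
  case (2 l R n k \<tau> \<rho> \<rho>' U \<epsilon>')
  show ?case unfolding Let_def
  proof (intro allI impI)
    fix V :: "nat \<Rightarrow> real mat"
    assume V: "\<forall>j<l. V j \<in> carrier_mat (n j) R \<and> column_bounded (\<rho>' j) (V j)"
      and close: "tensor_frobenius_norm l n (tensor_diff (cp_tensor l R V) (cp_tensor l R U)) \<le>
        (\<epsilon>' / real R) ^ (2 ^ l) * (\<Prod>j<l. (\<tau> j * \<rho> j * \<rho>' j * real (n j)) powr (- 30))"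
    show "\<exists>P L. permutation_matrix R P \<and> (\<forall>j<l. L j \<in> carrier_mat R R \<and> diagonal_mat (L j)) \<and>
      frobenius_norm (mat_product R l L - 1\<^sub>m R) \<le> \<epsilon>' \<and>
      (\<forall>j<l. frobenius_norm (V j - U j * P * L j) \<le> \<epsilon>')"
    proof (cases "l = 0")
      case True
      \<comment> \<open>The empty sum of ranks is at least \<open>2 * R - 1\<close> only for
        \<open>R = 0\<close>, so the matrix whose norm has to be bounded is empty.\<close>
      then have "R = 0" using 2(4) by simp
      have "permutation_matrix R (mat R R (\<lambda>(i, j). if i = id j then 1 else 0))"
        unfolding permutation_matrix_def using permutes_id by blast
      then show ?thesis
        using True \<open>R = 0\<close> 2(5) by (auto simp: mat_product_def frobenius_norm_def intro!: exI)
    next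
      case False
      have "2 * R + l \<le> (\<Sum>j<l. k j) + 1" using 2(4) by linarith
      then show ?thesis
        using False 2(2,3,5) V close by (intro robust_tensor_uniqueness) auto
    qed
  qed
qed

end
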